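(* Let $(K,D_K)$ be a parameterized differential field over a differential field $(k,D_k)$ with $D_k=k\cdot\partial_t$, and let $\omega\in\Omega_{K/k}$ with $\mathbf d\omega=0$. Let $D$ be a non-zero linear $\partial_t$-operator with coefficients in $k$ of the smallest order such that $D[\omega]=0$ in $H^1(K/k)$ (with the Gauss--Manin connection); if there is no non-zero $D$ with $D[\omega]=0$, put $D:=0$. Let $\tilde\partial_t\in D_K$ be a lift of $1\otimes\partial_t$ with respect to the structure map $D_K\to K\otimes_kD_k$, and let $\widetilde D$ be the corresponding lift of $D$ (that is, $\widetilde D=\sum_ic_i\tilde\partial_t^i$ if $D=\sum_ic_i\partial_t^i$). Since $D[\omega]=0$, there is $a\in K$ such that $L_{\widetilde D}(\omega)=\mathbf d a$ in $\Omega_{K/k}$; let $a$ be such an element. Consider the $D_K$-algebra $$R:=K\{y\}\big/\big(\mathbf d y-\omega,\ \widetilde Dy-a\big)_{D_K},$$ which is isomorphic as a $K$-algebra to a ring of polynomials over $K$ (possibly, in countably many variables) and, in particular, is a domain. Then the field $L:=\mathrm{Frac}(R)$ is a PPV extension of $K$ for the equation $\mathbf d y=\omega$.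
   Context: Differential field: a pair $(k,D_k)$, where $k$ is a field of characteristic zero and $D_k$ is a finite-dimensional $k$-vector space with a Lie bracket (additive, not necessarily $k$-linear) and a $k$-linear homomorphism of Lie rings $D_k\to\mathrm{Der}(k,k)$ with $[\partial,a\delta]=a[\partial,\delta]+\partial(a)\delta$. The superscript $D_k$ denotes elements annihilated by $D_k$. For a differential field $(K,D_K)$, $\Omega_K:=D_K^\vee$, $\Omega^i_K:=\wedge^i_K\Omega_K$ with the de Rham differential $\mathbf d$ ($\mathbf d a(\partial)=\partial(a)$, $\mathbf d\omega(\partial,\delta)=\partial(\omega(\delta))-\delta(\omega(\partial))-\omega([\partial,\delta])$, graded Leibniz rule). The Lie derivative is $L_\partial=\mathbf d\circ i_\partial+i_\partial\circ\mathbf d$ on $\Omega_K^\bullet$, $i_\partial$ being contraction. A parameterized differential field over $(k,D_k)$ is a differential field $(K,D_K)$ with a field embedding $k\to K$ and a surjective $K$-linear structure map $D_K\to K\otimes_kD_k$ such that if $\delta\mapsto\sum b_i\otimes\partial_i$ then $\delta(a)=\sum b_i\partial_i(a)$ for $a\in k$, such that the induced map $\Omega^\bullet_k\to\Omega^\bullet_K$ commutes with $\mathbf d$, and such that $K^{D_{K/k}}=k$, where $D_{K/k}$ is the kernel of the structure map. Put $\Omega_{K/k}:=D_{K/k}^\vee$, with the de Rham complex $\Omega^\bullet_{K/k}$ of $(K,D_{K/k})$, and $H^1(K/k):=\mathrm{Ker}(\Omega^1_{K/k}\xrightarrow{\mathbf d}\Omega^2_{K/k})/\mathbf d(K)$.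 For a lift $\tilde\partial\in D_K$ of $1\otimes\partial$, $\partial\in D_k$, the operator $L_{\tilde\partial}$ on $\Omega^\bullet_K$ descends to the quotient $\Omega^\bullet_{K/k}$; the Gauss--Manin connection is the $D_k$-module structure on $H^1(K/k)$ given by $\partial[\omega]=[L_{\tilde\partial}(\omega)]$ (independent of the lift). For $\widetilde D=\sum_ic_i\tilde\partial_t^i$ put $L_{\widetilde D}:=\sum_ic_iL_{\tilde\partial_t}^i$ on $\Omega_{K/k}$. $K\{y\}$ is the ring of $D_K$-polynomials in one differential indeterminate $y$ over $K$; $(\Sigma)_{D_K}$ is the $D_K$-differential ideal generated by $\Sigma$; $\mathbf d y-\omega$ means the collection of elements $\delta(y)-\omega(\delta)$, $\delta\in D_{K/k}$. A PPV extension of $K$ for $\mathbf d y=\omega$ is a $D_K$-field $L$ over $K$ (a field extension with an action of $D_K$ by derivations extending that on $K$, $K$-linear and compatible with brackets) such that $L^{D_{K/k}}=k$ and $L$ is generated as a $D_K$-field over $K$ by an element $z$ with $\delta(z)=\omega(\delta)$ for all $\delta\in D_{K/k}$.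
   Formalization: When D = 0, the element a is required to be 0: the condition L_D̃(ω) = da alone would allow any a in k, and a non-zero a would put a unit in the ideal and make R = 0. *)

theory Defs
  imports
    "HOL-Library.Poly_Mapping"
    "HOL-Computational_Algebra.Polynomial"
    "HOL-Algebra.QuotRing"
    "HOL-Algebra.Subrings"
begin

section \<open>Differential fields\<close>

record ('k, 'd) dfield =
  scl :: "'k \<Rightarrow> 'd \<Rightarrow> 'd"
  brk :: "'d \<Rightarrow> 'd \<Rightarrow> 'd"
  act :: "'d \<Rightarrow> 'k \<Rightarrow> 'k"

locale differential_field =
  fixes F :: "('k::field_char_0, 'd::ab_group_add) dfield"
  assumes vector_space: "vector_space (scl F)"
    and finite_dim: "\<exists>B. finite B \<and> module.span (scl F) B = UNIV"
    and brk_add_left: "brk F (x + y) z = brk F x z + brk F y z"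
    and brk_add_right: "brk F x (y + z) = brk F x y + brk F x z"
    and brk_self: "brk F x x = 0"
    and jacobi: "brk F x (brk F y z) + brk F y (brk F z x) + brk F z (brk F x y) = 0"
    and act_add: "act F x (a + b) = act F x a + act F x b"
    and act_mult: "act F x (a * b) = act F x a * b + a * act F x b"
    and act_plus: "act F (x + y) a = act F x a + act F y a"
    and act_scl: "act F (scl F c x) a = c * act F x a"
    and act_brk: "act F (brk F x y) a = act F x (act F y a) - act F y (act F x a)"
    and brk_scl: "brk F x (scl F c y) = scl F c (brk F x y) + scl F (act F x c) y"


section \<open>Differential forms\<close>

text \<open>
  Since \<open>D\<close> is finite-dimensional over a field of characteristic zero, the exterior power
  \<open>\<Omega>\<^sup>p\<close> of the dual of \<open>D\<close> is identified with the alternating \<open>p\<close>-linear forms on \<open>D\<close>. A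
  \<open>p\<close>-form is a function on lists of length \<open>p\<close>. The argument \<open>S\<close> is the subspace of \<open>D\<close>
  on which the forms live (all of \<open>D\<close>, or \<open>D_{K/k}\<close>); forms take the value 0 on every list
  that is not a list of \<open>p\<close> elements of \<open>S\<close>, so that equality of forms is equality of functions.
\<close>

definition forms :: "('k::field_char_0, 'd::ab_group_add) dfield \<Rightarrow> 'd set \<Rightarrow> nat \<Rightarrow> ('d list \<Rightarrow> 'k) set" where
  "forms F S p = {\<omega>.
     (\<forall>xs. \<not> (length xs = p \<and> set xs \<subseteq> S) \<longrightarrow> \<omega> xs = 0) \<and>
     (\<forall>xs ys x y c. length xs + length ys + 1 = p \<and> set (xs @ x # y # ys) \<subseteq> S \<longrightarrow>
        \<omega> (xs @ (x + scl F c y) # ys) = \<omega> (xs @ x # ys) + c * \<omega> (xs @ y # ys)) \<and>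
     (\<forall>xs. \<not> distinct xs \<longrightarrow> \<omega> xs = 0)}"

definition restrict_form :: "'d set \<Rightarrow> ('d list \<Rightarrow> 'k::zero) \<Rightarrow> 'd list \<Rightarrow> 'k" where
  "restrict_form S \<omega> xs = (if set xs \<subseteq> S then \<omega> xs else 0)"

definition form0 :: "'k::zero \<Rightarrow> 'd list \<Rightarrow> 'k" where
  "form0 a xs = (if xs = [] then a else 0)"

text \<open>
  The de Rham differential in all degrees, by the Koszul formula; with the determinant
  convention for wedge products it is the unique extension of the formulas in degrees 0 and 1
  (see the two lemmas below) satisfying the graded Leibniz rule.
\<close>

definition de_rham :: "('k::field_char_0, 'd::ab_group_add) dfield \<Rightarrow> 'd set \<Rightarrow> ('d list \<Rightarrow> 'k) \<Rightarrow> 'd list \<Rightarrow> 'k" where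
  "de_rham F S \<omega> = restrict_form S (\<lambda>xs.
     (\<Sum>i<length xs. (- 1) ^ i * act F (xs ! i) (\<omega> (nths xs (- {i})))) +
     (\<Sum>i<length xs. \<Sum>j\<in>{i<..<length xs}.
        (- 1) ^ (i + j) * \<omega> (brk F (xs ! i) (xs ! j) # nths xs (- {i, j}))))"

lemma de_rham_form0: "x \<in> S \<Longrightarrow> de_rham F S (form0 a) [x] = act F x a"
  by (simp add: de_rham_def restrict_form_def form0_def nths_Cons greaterThanLessThan_def)

lemma de_rham_form1:
  assumes "x \<in> S" "y \<in> S"
  shows "de_rham F S \<omega> [x, y] = act F x (\<omega> [y]) - act F y (\<omega> [x]) - \<omega> [brk F x y]"
proof -
  have "{0<..<Suc (Suc 0)} = {Suc 0}" "{Suc 0<..<Suc (Suc 0)} = {}" by auto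
  then show ?thesis
    using assms by (simp add: de_rham_def restrict_form_def nths_Cons)
qed

definition contract :: "'d \<Rightarrow> ('d list \<Rightarrow> 'k) \<Rightarrow> 'd list \<Rightarrow> 'k" where
  "contract x \<omega> xs = \<omega> (x # xs)"

definition lie_der :: "('k::field_char_0, 'd::ab_group_add) dfield \<Rightarrow> 'd \<Rightarrow> ('d list \<Rightarrow> 'k) \<Rightarrow> 'd list \<Rightarrow> 'k" where
  "lie_der F x \<omega> = (\<lambda>xs. de_rham F UNIV (contract x \<omega>) xs + contract x (de_rham F UNIV \<omega>) xs)"


section \<open>Parameterized differential fields\<close>

text \<open>
  The tensor product of \<open>K\<close> and \<open>D_k\<close> over \<open>k\<close> is the free \<open>K\<close>-vector space on the set \<open>D_k\<close>
  (finitely supported functions) modulo the \<open>K\<close>-subspace \<open>tensor_null\<close> generated by the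
  relations of \<open>k\<close>-linearity in the second factor. Its elements are cosets of that subspace.
\<close>

record (overloaded) ('k, 'dk, 'K, 'dK) pdfield =
  base_fld :: "('k, 'dk) dfield"
  ext_fld :: "('K, 'dK) dfield"
  emb :: "'k \<Rightarrow> 'K"
  str :: "'dK \<Rightarrow> ('dk \<Rightarrow>\<^sub>0 'K) set"

definition tensor_scl :: "'K::field_char_0 \<Rightarrow> ('dk \<Rightarrow>\<^sub>0 'K) \<Rightarrow> 'dk \<Rightarrow>\<^sub>0 'K" where
  "tensor_scl c = Poly_Mapping.map ((*) c)"

definition tensor_null ::
  "('k::field_char_0, 'dk::ab_group_add, 'K::field_char_0, 'dK::ab_group_add) pdfield \<Rightarrow> ('dk \<Rightarrow>\<^sub>0 'K) set" where
  "tensor_null P = module.span tensor_scl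
     ({Poly_Mapping.single (x + y) 1 - Poly_Mapping.single x 1 - Poly_Mapping.single y 1 | x y. True} \<union>
      {Poly_Mapping.single (scl (base_fld P) c x) 1 - Poly_Mapping.single x (emb P c) | c x. True})"

definition tensor_class ::
  "('k::field_char_0, 'dk::ab_group_add, 'K::field_char_0, 'dK::ab_group_add) pdfield \<Rightarrow>
   ('dk \<Rightarrow>\<^sub>0 'K) \<Rightarrow> ('dk \<Rightarrow>\<^sub>0 'K) set" where
  "tensor_class P p = {q. q - p \<in> tensor_null P}"

definition pure_tensor ::
  "('k::field_char_0, 'dk::ab_group_add, 'K::field_char_0, 'dK::ab_group_add) pdfield \<Rightarrow>
   'K \<Rightarrow> 'dk \<Rightarrow> ('dk \<Rightarrow>\<^sub>0 'K) set" where
  "pure_tensor P b x = tensor_class P (Poly_Mapping.single x b)"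

definition rel_der ::
  "('k::field_char_0, 'dk::ab_group_add, 'K::field_char_0, 'dK::ab_group_add) pdfield \<Rightarrow> 'dK set" where
  "rel_der P = {x. str P x = tensor_class P 0}"

text \<open>
  The map on forms induced by the structure map: each argument is sent to a representative
  \<open>\<Sum> b_i \<otimes> \<partial>_i\<close> of its image, and the form on \<open>D_k\<close> is extended \<open>K\<close>-multilinearly.
\<close>

primrec extend_form :: "('k \<Rightarrow> 'K::field_char_0) \<Rightarrow> ('dk list \<Rightarrow> 'k) \<Rightarrow> ('dk \<Rightarrow>\<^sub>0 'K) list \<Rightarrow> 'K" where
  "extend_form \<iota> \<eta> [] = \<iota> (\<eta> [])"
| "extend_form \<iota> \<eta> (p # ps) =
     (\<Sum>x\<in>Poly_Mapping.keys p. Poly_Mapping.lookup p x * extend_form \<iota> (contract x \<eta>) ps)"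

definition induced_form ::
  "('k::field_char_0, 'dk::ab_group_add, 'K::field_char_0, 'dK::ab_group_add) pdfield \<Rightarrow>
   ('dk list \<Rightarrow> 'k) \<Rightarrow> 'dK list \<Rightarrow> 'K" where
  "induced_form P \<eta> xs = extend_form (emb P) \<eta> (map (\<lambda>x. SOME p. p \<in> str P x) xs)"

locale parameterized_differential_field =
  base: differential_field "base_fld P" + ext: differential_field "ext_fld P"
  for P :: "('k::field_char_0, 'dk::ab_group_add, 'K::field_char_0, 'dK::ab_group_add) pdfield" +
  assumes emb_add: "emb P (a + b) = emb P a + emb P b"
    and emb_mult: "emb P (a * b) = emb P a * emb P b"
    and emb_one: "emb P 1 = 1"
    and str_surj: "range (str P) = range (tensor_class P)"
    and str_add: "p \<in> str P x \<Longrightarrow> q \<in> str P y \<Longrightarrow> p + q \<in> str P (x + y)"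
    and str_scl: "p \<in> str P x \<Longrightarrow> tensor_scl c p \<in> str P (scl (ext_fld P) c x)"
    and str_act: "p \<in> str P x \<Longrightarrow>
      act (ext_fld P) x (emb P a) =
        (\<Sum>y\<in>Poly_Mapping.keys p. Poly_Mapping.lookup p y * emb P (act (base_fld P) y a))"
    and induced_de_rham: "\<eta> \<in> forms (base_fld P) UNIV n \<Longrightarrow>
      induced_form P (de_rham (base_fld P) UNIV \<eta>) = de_rham (ext_fld P) UNIV (induced_form P \<eta>)"
    and rel_constants: "{a. \<forall>x\<in>rel_der P. act (ext_fld P) x a = 0} = range (emb P)"


section \<open>Relative forms and the Gauss--Manin connection\<close>

definition rel_forms ::
  "('k::field_char_0, 'dk::ab_group_add, 'K::field_char_0, 'dK::ab_group_add) pdfield \<Rightarrow> nat \<Rightarrow> ('dK list \<Rightarrow> 'K) set" where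
  "rel_forms P p = forms (ext_fld P) (rel_der P) p"

definition rel_de_rham ::
  "('k::field_char_0, 'dk::ab_group_add, 'K::field_char_0, 'dK::ab_group_add) pdfield \<Rightarrow>
   ('dK list \<Rightarrow> 'K) \<Rightarrow> 'dK list \<Rightarrow> 'K" where
  "rel_de_rham P = de_rham (ext_fld P) (rel_der P)"

text \<open>
  \<open>\<Omega>_{K/k}\<close> is the quotient of \<open>\<Omega>_K\<close> by restriction to \<open>D_{K/k}\<close>; the operator induced by the
  Lie derivative on relative 1-forms is computed on an arbitrary 1-form lifting the argument.
\<close>

definition rel_lie ::
  "('k::field_char_0, 'dk::ab_group_add, 'K::field_char_0, 'dK::ab_group_add) pdfield \<Rightarrow>
   'dK \<Rightarrow> ('dK list \<Rightarrow> 'K) \<Rightarrow> 'dK list \<Rightarrow> 'K" where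
  "rel_lie P x \<omega> = restrict_form (rel_der P)
     (lie_der (ext_fld P) x (SOME \<eta>. \<eta> \<in> forms (ext_fld P) UNIV 1 \<and> restrict_form (rel_der P) \<eta> = \<omega>))"

text \<open>
  A linear operator \<open>\<Sum> c_i \<partial>^i\<close> is represented by the polynomial with coefficients \<open>c_i\<close>;
  its order is the degree of the polynomial.
\<close>

definition rel_lie_op ::
  "('k::field_char_0, 'dk::ab_group_add, 'K::field_char_0, 'dK::ab_group_add) pdfield \<Rightarrow>
   'dK \<Rightarrow> 'k poly \<Rightarrow> ('dK list \<Rightarrow> 'K) \<Rightarrow> 'dK list \<Rightarrow> 'K" where
  "rel_lie_op P x D \<omega> = (\<lambda>xs. \<Sum>i\<le>Polynomial.degree D.
     emb P (Polynomial.coeff D i) * (rel_lie P x ^^ i) \<omega> xs)"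

definition closed_forms1 ::
  "('k::field_char_0, 'dk::ab_group_add, 'K::field_char_0, 'dK::ab_group_add) pdfield \<Rightarrow> ('dK list \<Rightarrow> 'K) set" where
  "closed_forms1 P = {\<omega> \<in> rel_forms P 1. rel_de_rham P \<omega> = (\<lambda>_. 0)}"

text \<open>\<open>coh_class P \<omega>\<close> is the class of \<open>\<omega>\<close> in \<open>H\<^sup>1(K/k)\<close>, as a coset of the exact forms.\<close>

definition coh_class ::
  "('k::field_char_0, 'dk::ab_group_add, 'K::field_char_0, 'dK::ab_group_add) pdfield \<Rightarrow>
   ('dK list \<Rightarrow> 'K) \<Rightarrow> ('dK list \<Rightarrow> 'K) set" where
  "coh_class P \<omega> = {\<eta> \<in> closed_forms1 P. \<exists>f. (\<lambda>xs. \<eta> xs - \<omega> xs) = rel_de_rham P (form0 f)}"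

definition gauss_manin ::
  "('k::field_char_0, 'dk::ab_group_add, 'K::field_char_0, 'dK::ab_group_add) pdfield \<Rightarrow>
   'dk \<Rightarrow> ('dK list \<Rightarrow> 'K) set \<Rightarrow> ('dK list \<Rightarrow> 'K) set" where
  "gauss_manin P x h =
     coh_class P (rel_lie P (SOME u. str P u = pure_tensor P 1 x) (SOME \<omega>. \<omega> \<in> h))"

definition gauss_manin_op ::
  "('k::field_char_0, 'dk::ab_group_add, 'K::field_char_0, 'dK::ab_group_add) pdfield \<Rightarrow>
   'dk \<Rightarrow> 'k poly \<Rightarrow> ('dK list \<Rightarrow> 'K) set \<Rightarrow> ('dK list \<Rightarrow> 'K) set" where
  "gauss_manin_op P x D h = coh_class P (\<lambda>xs. \<Sum>i\<le>Polynomial.degree D.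
     emb P (Polynomial.coeff D i) * (SOME \<omega>. \<omega> \<in> (gauss_manin P x ^^ i) h) xs)"

definition annihilates ::
  "('k::field_char_0, 'dk::ab_group_add, 'K::field_char_0, 'dK::ab_group_add) pdfield \<Rightarrow>
   'dk \<Rightarrow> 'k poly \<Rightarrow> ('dK list \<Rightarrow> 'K) \<Rightarrow> bool" where
  "annihilates P x D \<omega> \<longleftrightarrow> gauss_manin_op P x D (coh_class P \<omega>) = coh_class P (\<lambda>_. 0)"

definition minimal_annihilator ::
  "('k::field_char_0, 'dk::ab_group_add, 'K::field_char_0, 'dK::ab_group_add) pdfield \<Rightarrow>
   'dk \<Rightarrow> ('dK list \<Rightarrow> 'K) \<Rightarrow> 'k poly \<Rightarrow> bool" where
  "minimal_annihilator P x \<omega> D \<longleftrightarrow>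
     (if \<exists>D'. D' \<noteq> 0 \<and> annihilates P x D' \<omega>
      then D \<noteq> 0 \<and> annihilates P x D \<omega> \<and>
           (\<forall>D'. D' \<noteq> 0 \<and> annihilates P x D' \<omega> \<longrightarrow> Polynomial.degree D \<le> Polynomial.degree D')
      else D = 0)"


section \<open>Differential algebras\<close>

text \<open>
  A ring with operators \<open>dact\<close> indexed by \<open>D\<close> and a structure map \<open>alg\<close> from the base field;
  the laws are in \<open>differential_algebra\<close>.
\<close>

record ('r, 'd, 'k) dalg = "'r ring" +
  dact :: "'d \<Rightarrow> 'r \<Rightarrow> 'r"
  alg :: "'k \<Rightarrow> 'r"

locale differential_algebra = cring A
  for F :: "('k::field_char_0, 'd::ab_group_add) dfield" and A :: "('r, 'd, 'k) dalg" (structure) +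
  assumes alg_closed: "alg A c \<in> carrier A"
    and alg_add: "alg A (c + c') = alg A c \<oplus> alg A c'"
    and alg_mult: "alg A (c * c') = alg A c \<otimes> alg A c'"
    and alg_one: "alg A 1 = \<one>"
    and dact_closed: "r \<in> carrier A \<Longrightarrow> dact A x r \<in> carrier A"
    and dact_add: "r \<in> carrier A \<Longrightarrow> s \<in> carrier A \<Longrightarrow> dact A x (r \<oplus> s) = dact A x r \<oplus> dact A x s"
    and dact_mult: "r \<in> carrier A \<Longrightarrow> s \<in> carrier A \<Longrightarrow>
      dact A x (r \<otimes> s) = dact A x r \<otimes> s \<oplus> r \<otimes> dact A x s"
    and dact_alg: "dact A x (alg A c) = alg A (act F x c)"
    and dact_plus: "r \<in> carrier A \<Longrightarrow> dact A (x + y) r = dact A x r \<oplus> dact A y r"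
    and dact_scl: "r \<in> carrier A \<Longrightarrow> dact A (scl F c x) r = alg A c \<otimes> dact A x r"
    and dact_brk: "r \<in> carrier A \<Longrightarrow>
      dact A (brk F x y) r = dact A x (dact A y r) \<ominus> dact A y (dact A x r)"

definition diff_ideal :: "('r, 'd, 'k) dalg \<Rightarrow> 'r set \<Rightarrow> 'r set" where
  "diff_ideal A S = \<Inter>{I. ideal I A \<and> S \<subseteq> I \<and> (\<forall>x. \<forall>r\<in>I. dact A x r \<in> I)}"

definition quot_dalg :: "('r, 'd, 'k) dalg \<Rightarrow> 'r set \<Rightarrow> ('r set, 'd, 'k) dalg" where
  "quot_dalg A I = ring.extend (A Quot I)
     (dalg.fields (\<lambda>x X. \<Union>r\<in>X. I +>\<^bsub>A\<^esub> dact A x r) (\<lambda>c. I +>\<^bsub>A\<^esub> alg A c))"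

text \<open>The field of fractions of a domain, with the action extended by the quotient rule.\<close>

definition frac :: "('r, 'm) ring_scheme \<Rightarrow> 'r \<Rightarrow> 'r \<Rightarrow> ('r \<times> 'r) set" where
  "frac A r s = {(r', s'). r' \<in> carrier A \<and> s' \<in> carrier A - {\<zero>\<^bsub>A\<^esub>} \<and> r \<otimes>\<^bsub>A\<^esub> s' = r' \<otimes>\<^bsub>A\<^esub> s}"

definition frac_dalg :: "('r, 'd, 'k) dalg \<Rightarrow> (('r \<times> 'r) set, 'd, 'k) dalg" where
  "frac_dalg A = \<lparr>
     carrier = {frac A r s | r s. r \<in> carrier A \<and> s \<in> carrier A - {\<zero>\<^bsub>A\<^esub>}},
     monoid.mult = (\<lambda>X Y. \<Union>(r, s)\<in>X. \<Union>(r', s')\<in>Y. frac A (r \<otimes>\<^bsub>A\<^esub> r') (s \<otimes>\<^bsub>A\<^esub> s')),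
     one = frac A \<one>\<^bsub>A\<^esub> \<one>\<^bsub>A\<^esub>,
     zero = frac A \<zero>\<^bsub>A\<^esub> \<one>\<^bsub>A\<^esub>,
     add = (\<lambda>X Y. \<Union>(r, s)\<in>X. \<Union>(r', s')\<in>Y.
       frac A (r \<otimes>\<^bsub>A\<^esub> s' \<oplus>\<^bsub>A\<^esub> r' \<otimes>\<^bsub>A\<^esub> s) (s \<otimes>\<^bsub>A\<^esub> s')),
     dact = (\<lambda>x X. \<Union>(r, s)\<in>X.
       frac A (dact A x r \<otimes>\<^bsub>A\<^esub> s \<ominus>\<^bsub>A\<^esub> r \<otimes>\<^bsub>A\<^esub> dact A x s) (s \<otimes>\<^bsub>A\<^esub> s)),
     alg = (\<lambda>c. frac A (alg A c) \<one>\<^bsub>A\<^esub>)\<rparr>"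


section \<open>Differential polynomials\<close>

definition pvar :: "'v \<Rightarrow> ('v \<Rightarrow>\<^sub>0 nat) \<Rightarrow>\<^sub>0 'k::field_char_0" where
  "pvar v = Poly_Mapping.single (Poly_Mapping.single v 1) 1"

definition pconst :: "'k::field_char_0 \<Rightarrow> ('v \<Rightarrow>\<^sub>0 nat) \<Rightarrow>\<^sub>0 'k" where
  "pconst c = Poly_Mapping.single 0 c"

text \<open>The ring of polynomials in the variables \<open>V\<close>.\<close>

definition mpoly_ring :: "'v set \<Rightarrow> (('v \<Rightarrow>\<^sub>0 nat) \<Rightarrow>\<^sub>0 'k::field_char_0) ring" where
  "mpoly_ring V = \<lparr>
     carrier = {p. \<forall>m\<in>Poly_Mapping.keys p. Poly_Mapping.keys m \<subseteq> V},
     monoid.mult = (*), one = 1, zero = 0, add = (+)\<rparr>"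

text \<open>
  Polynomials in variables indexed by words: the variable of the word \<open>[\<delta>_1, \<dots>, \<delta>_m]\<close>
  stands for \<open>\<delta>_1 (\<dots> (\<delta>_m y))\<close>. The operator \<open>word_der F x\<close> is the derivation that extends \<open>x\<close>
  on the coefficients and sends the variable of \<open>w\<close> to the variable of \<open>x # w\<close>.
\<close>

definition word_der ::
  "('k::field_char_0, 'd::ab_group_add) dfield \<Rightarrow> 'd \<Rightarrow>
   (('d list \<Rightarrow>\<^sub>0 nat) \<Rightarrow>\<^sub>0 'k) \<Rightarrow> ('d list \<Rightarrow>\<^sub>0 nat) \<Rightarrow>\<^sub>0 'k" where
  "word_der F x p = (\<Sum>m\<in>Poly_Mapping.keys p.
     Poly_Mapping.single m (act F x (Poly_Mapping.lookup p m)) +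
     (\<Sum>w\<in>Poly_Mapping.keys m.
        Poly_Mapping.single
          (m - Poly_Mapping.single w 1 + Poly_Mapping.single (x # w) 1)
          (of_nat (Poly_Mapping.lookup m w) * Poly_Mapping.lookup p m)))"

lemma (in differential_field) word_der_pvar: "word_der F x (pvar w) = pvar (x # w)"
proof -
  have "act F x 1 = 0" using act_mult[of x 1 1] by simp
  then show ?thesis by (simp add: word_der_def pvar_def)
qed

lemma (in differential_field) word_der_pconst: "word_der F x (pconst c) = pconst (act F x c)"
proof -
  have "act F x 0 = 0" using act_add[of x 0 0] by simp
  then show ?thesis by (cases "c = 0") (simp_all add: word_der_def pconst_def)
qed

definition word_dalg ::
  "('k::field_char_0, 'd::ab_group_add) dfield \<Rightarrow> (('d list \<Rightarrow>\<^sub>0 nat) \<Rightarrow>\<^sub>0 'k, 'd, 'k) dalg" where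
  "word_dalg F = ring.extend (mpoly_ring UNIV) (dalg.fields (word_der F) pconst)"

text \<open>
  The ring \<open>K{y}\<close> of differential polynomials is the free \<open>D\<close>-algebra over \<open>K\<close> on \<open>y\<close>. As \<open>D\<close>
  need not have a commuting basis, it is presented by imposing \<open>K\<close>-linearity and compatibility
  with brackets on the polynomials in words.
\<close>

definition word_relations ::
  "('k::field_char_0, 'd::ab_group_add) dfield \<Rightarrow> (('d list \<Rightarrow>\<^sub>0 nat) \<Rightarrow>\<^sub>0 'k) set" where
  "word_relations F =
     {pvar ((x + x') # w) - pvar (x # w) - pvar (x' # w) | x x' w. True} \<union>
     {pvar (scl F c x # w) - pconst c * pvar (x # w) | c x w. True} \<union>
     {pvar (brk F x x' # w) - (pvar (x # x' # w) - pvar (x' # x # w)) | x x' w. True}"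

type_synonym ('k, 'd) dpoly = "(('d list \<Rightarrow>\<^sub>0 nat) \<Rightarrow>\<^sub>0 'k) set"

definition dpoly_alg ::
  "('k::field_char_0, 'd::ab_group_add) dfield \<Rightarrow> (('k, 'd) dpoly, 'd, 'k) dalg" where
  "dpoly_alg F = quot_dalg (word_dalg F) (diff_ideal (word_dalg F) (word_relations F))"

definition dpoly_var :: "('k::field_char_0, 'd::ab_group_add) dfield \<Rightarrow> ('k, 'd) dpoly" where
  "dpoly_var F = diff_ideal (word_dalg F) (word_relations F) +>\<^bsub>word_dalg F\<^esub> pvar []"


section \<open>PPV extensions for \<open>dy = \<omega>\<close>\<close>

text \<open>
  The generators of the ideal \<open>(dy - \<omega>, \<Sum> c_i u\<^sup>i y - a)\<close> of \<open>K{y}\<close>, for \<open>D = \<Sum> c_i \<partial>\<^sup>i\<close>. When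
  \<open>D = 0\<close> the second generator is \<open>- a\<close>, while \<open>a\<close> is only determined up to a constant; a non-zero
  \<open>a\<close> would then give the unit ideal, so for \<open>D = 0\<close> this is meant to be used with \<open>a = 0\<close>.
\<close>

definition ppv_generators ::
  "('k::field_char_0, 'dk::ab_group_add, 'K::field_char_0, 'dK::ab_group_add) pdfield \<Rightarrow>
   ('dK list \<Rightarrow> 'K) \<Rightarrow> 'dK \<Rightarrow> 'k poly \<Rightarrow> 'K \<Rightarrow> ('K, 'dK) dpoly set" where
  "ppv_generators P \<omega> u D a =
     (let A = dpoly_alg (ext_fld P); y = dpoly_var (ext_fld P) in
       {dact A x y \<ominus>\<^bsub>A\<^esub> alg A (\<omega> [x]) | x. x \<in> rel_der P} \<union>
       {(\<Oplus>\<^bsub>A\<^esub>i\<in>{..Polynomial.degree D}.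
           alg A (emb P (Polynomial.coeff D i)) \<otimes>\<^bsub>A\<^esub> (dact A u ^^ i) y) \<ominus>\<^bsub>A\<^esub> alg A a})"

definition ppv_ring ::
  "('k::field_char_0, 'dk::ab_group_add, 'K::field_char_0, 'dK::ab_group_add) pdfield \<Rightarrow>
   ('dK list \<Rightarrow> 'K) \<Rightarrow> 'dK \<Rightarrow> 'k poly \<Rightarrow> 'K \<Rightarrow> (('K, 'dK) dpoly set, 'dK, 'K) dalg" where
  "ppv_ring P \<omega> u D a =
     quot_dalg (dpoly_alg (ext_fld P)) (diff_ideal (dpoly_alg (ext_fld P)) (ppv_generators P \<omega> u D a))"

definition ppv_extension ::
  "('k::field_char_0, 'dk::ab_group_add, 'K::field_char_0, 'dK::ab_group_add) pdfield \<Rightarrow>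
   ('dK list \<Rightarrow> 'K) \<Rightarrow> ('l, 'dK, 'K) dalg \<Rightarrow> bool" where
  "ppv_extension P \<omega> L \<longleftrightarrow>
     field L \<and> differential_algebra (ext_fld P) L \<and>
     {r \<in> carrier L. \<forall>x\<in>rel_der P. dact L x r = \<zero>\<^bsub>L\<^esub>} = range (\<lambda>c. alg L (emb P c)) \<and>
     (\<exists>z\<in>carrier L.
        (\<forall>x\<in>rel_der P. dact L x z = alg L (\<omega> [x])) \<and>
        (\<forall>M. subfield M L \<and> range (alg L) \<subseteq> M \<and> z \<in> M \<and> (\<forall>x. \<forall>r\<in>M. dact L x r \<in> M)
           \<longrightarrow> M = carrier L))"

end

theory Submission
  imports Defs
begin

text \<open>
Fix the lift \<open>u\<close> and put \<open>\<omega>\<^sub>i = L\<^sub>u\<^sup>i \<omega>\<close>. In \<open>R\<close> the elements \<open>y\<^sub>i = u\<^sup>i y\<close> satisfy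
\<open>\<delta> y\<^sub>i = \<omega>\<^sub>i(\<delta>)\<close> for \<open>\<delta> \<in> D_{K/k}\<close>, and the equation for \<open>D\<close> expresses \<open>y\<^sub>n\<close>, where \<open>n\<close> is the
order of \<open>D\<close>, through the lower ones. Conversely these formulas define an action of \<open>D_K\<close> on
the polynomial ring in the \<open>y\<^sub>i\<close>, so \<open>R\<close> is this polynomial ring. By minimality of \<open>D\<close> no
non-trivial \<open>k\<close>-linear combination of the \<open>\<omega>\<^sub>i\<close> with \<open>i < n\<close> is exact. Comparing coefficients of
top and next to top degree then shows that the only \<open>D_{K/k}\<close>-constants of \<open>R\<close> are those in \<open>k\<close>
and that \<open>R\<close> has no proper non-zero ideal stable under \<open>D_{K/k}\<close>. The ideal of denominators of
a constant fraction is stable, so the fraction already lies in \<open>R\<close>, hence in \<open>k\<close>.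
\<close>

section \<open>Derivations and polynomial rings\<close>

text \<open>The ideal defining R is known only through generators, so nothing excludes beforehand
  that it contains 1. The polynomial ring with its explicit action is the witness against this. That
  the formulas define an action is an integrability condition: every \<omega>_i is closed,
  [u, \<delta>] lies in D_{K/k} for \<delta> in D_{K/k} because the form dual to the parameter is
  closed, and \<omega>_{i+1}(\<delta>) = u(\<omega>_i(\<delta>)) - \<omega>_i([u, \<delta>]). The
  expression substituted for y_n has the right derivatives because the sum of the c_i \<omega>_i is
  d a. R and the polynomial ring are compared inside the algebra of words, of which both are
  quotients, so that only two kernels have to be matched. Constants and ideals are studied with
  D_{K/k} alone: it sends each y_i into K and hence never raises the degree, whereas u shifts the
  variables. Characteristic zero enters through the multiplicities produced by differentiating
  monomials.\<close>

locale ring_derivation =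
  fixes d :: "'a::comm_ring_1 \<Rightarrow> 'a"
  assumes add: "d (a + b) = d a + d b"
    and mult: "d (a * b) = d a * b + a * d b"
begin

lemma zero [simp]: "d 0 = 0"
  using add[of 0 0] by simp

lemma one [simp]: "d 1 = 0"
  using mult[of 1 1] by simp

lemma uminus: "d (- a) = - d a"
  using add[of a "- a"] by (simp add: eq_neg_iff_add_eq_0 add.commute)

lemma diff: "d (a - b) = d a - d b"
  using add[of a "- b"] by (simp add: uminus)

lemma sum: "d (sum f A) = (\<Sum>x\<in>A. d (f x))"
  by (induction A rule: infinite_finite_induct) (simp_all add: add)

end

text \<open>Linearity in D and the bracket law for an action on polynomials are equalities between
  two derivations. Knowing that both sides are derivations reduces them to constants and variables,
  by \<open>derivations_agree\<close>.\<close>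

lemma ring_derivation_add:
  assumes "ring_derivation d" "ring_derivation d'"
  shows "ring_derivation (\<lambda>p. d p + d' p)"
proof -
  interpret d: ring_derivation d by fact
  interpret d': ring_derivation d' by fact
  show ?thesis by unfold_locales (simp_all add: d.add d'.add d.mult d'.mult algebra_simps)
qed

lemma ring_derivation_scale:
  assumes "ring_derivation d"
  shows "ring_derivation (\<lambda>p. c * d p)"
proof -
  interpret d: ring_derivation d by fact
  show ?thesis by unfold_locales (simp_all add: d.add d.mult algebra_simps)
qed

lemma ring_derivation_commutator:
  assumes "ring_derivation d" "ring_derivation d'"
  shows "ring_derivation (\<lambda>p. d (d' p) - d' (d p))"
proof -
  interpret d: ring_derivation d by fact
  interpret d': ring_derivation d' by fact
  show ?thesis by unfold_locales (simp_all add: d.add d'.add d.mult d'.mult algebra_simps)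
qed

lemma poly_mapping_single_induct [case_names single add]:
  assumes "\<And>m c. P (Poly_Mapping.single m c)"
    and "\<And>p q. P p \<Longrightarrow> P q \<Longrightarrow> P (p + q)"
  shows "P (p :: 'm \<Rightarrow>\<^sub>0 'c::comm_monoid_add)"
proof -
  have sum: "p = (\<Sum>m\<in>Poly_Mapping.keys p. Poly_Mapping.single m (Poly_Mapping.lookup p m))"
    by (rule poly_mapping_eqI) (auto simp: lookup_sum lookup_single when_def in_keys_iff)
  have "P (\<Sum>m\<in>A. Poly_Mapping.single m (Poly_Mapping.lookup p m))" if "finite A" for A
    using that
  proof (induction A)
    case empty
    show ?case using assms(1)[of _ 0] by simp
  qed (auto intro: assms)
  then show ?thesis by (subst sum) simp
qed

section \<open>Constants, variables and monomials\<close>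

lemma pconst_0 [simp]: "pconst 0 = 0"
  by (simp add: pconst_def)

lemma pconst_1 [simp]: "pconst 1 = 1"
  by (simp add: pconst_def)

lemma pconst_add: "pconst (a + b) = pconst a + pconst b"
  by (simp add: pconst_def single_add)

lemma pconst_mult: "pconst (a * b) = pconst a * pconst b"
  by (simp add: pconst_def mult_single)

lemma pconst_diff: "pconst (a - b) = pconst a - pconst b"
  by (simp add: pconst_def single_diff)

lemma pconst_sum: "pconst (\<Sum>i\<in>A. f i) = (\<Sum>i\<in>A. pconst (f i))"
  by (induction A rule: infinite_finite_induct) (simp_all add: pconst_add)

lemma lookup_pconst_mult: "Poly_Mapping.lookup (pconst c * p) m = c * Poly_Mapping.lookup p m"
  by (simp add: pconst_def mult_map_scale_conv_mult[symmetric] Poly_Mapping.map.rep_eq when_def)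

lemma prod_single:
  "finite A \<Longrightarrow> (\<Prod>w\<in>A. Poly_Mapping.single (f w) (1::'c::comm_semiring_1)) = Poly_Mapping.single (\<Sum>w\<in>A. f w) 1"
  by (induction A rule: finite_induct) (simp_all add: mult_single)

lemma pvar_power: "pvar w ^ n = Poly_Mapping.single (Poly_Mapping.single w n) 1"
  by (induction n) (simp_all add: pvar_def mult_single single_add[symmetric])

lemma single_eq_monomial:
  "Poly_Mapping.single m c = pconst c * (\<Prod>w\<in>Poly_Mapping.keys m. pvar w ^ Poly_Mapping.lookup m w)"
proof -
  have "m = (\<Sum>w\<in>Poly_Mapping.keys m. Poly_Mapping.single w (Poly_Mapping.lookup m w))"
    by (rule poly_mapping_eqI) (auto simp: lookup_sum lookup_single when_def in_keys_iff)
  then show ?thesis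
    by (simp add: pvar_power prod_single pconst_def mult_single)
qed

text \<open>Polynomials in \<open>V\<close> form a subset of a fixed type and not a type of their
  own, because the set of variables will depend on the order of the operator.\<close>

abbreviation polys_in :: "'v set \<Rightarrow> (('v \<Rightarrow>\<^sub>0 nat) \<Rightarrow>\<^sub>0 'k::field_char_0) set" where
  "polys_in V \<equiv> carrier (mpoly_ring V)"

lemma polys_in_iff: "p \<in> polys_in V \<longleftrightarrow> (\<forall>m\<in>Poly_Mapping.keys p. Poly_Mapping.keys m \<subseteq> V)"
  by (simp add: mpoly_ring_def)

lemma polys_in_UNIV [simp]: "p \<in> polys_in UNIV"
  by (simp add: polys_in_iff)

lemma polys_in_pconst [simp]: "pconst c \<in> polys_in V"
  by (simp add: polys_in_iff pconst_def)

lemma polys_in_0 [simp]: "0 \<in> polys_in V"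
  by (simp add: polys_in_iff)

lemma polys_in_1 [simp]: "1 \<in> polys_in V"
  by (simp add: polys_in_iff)

lemma polys_in_pvar: "v \<in> V \<Longrightarrow> pvar v \<in> polys_in V"
  by (simp add: polys_in_iff pvar_def)

lemma polys_in_add: "p \<in> polys_in V \<Longrightarrow> q \<in> polys_in V \<Longrightarrow> p + q \<in> polys_in V"
  using keys_add[of p q] by (auto simp: polys_in_iff)

lemma polys_in_uminus: "p \<in> polys_in V \<Longrightarrow> - p \<in> polys_in V"
  by (simp add: polys_in_iff in_keys_iff)

lemma polys_in_diff: "p \<in> polys_in V \<Longrightarrow> q \<in> polys_in V \<Longrightarrow> p - q \<in> polys_in V"
  using polys_in_add[of p V "- q"] polys_in_uminus[of q V] by simp

lemma polys_in_mult:
  assumes "p \<in> polys_in V" "q \<in> polys_in V"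
  shows "p * q \<in> polys_in V"
proof -
  have "Poly_Mapping.keys m \<subseteq> V" if m: "m \<in> Poly_Mapping.keys (p * q)" for m
  proof -
    obtain a b where "m = a + b" "a \<in> Poly_Mapping.keys p" "b \<in> Poly_Mapping.keys q"
      using m keys_mult[of p q] by blast
    then show ?thesis using assms keys_add[of a b] unfolding polys_in_iff by blast
  qed
  then show ?thesis by (simp add: polys_in_iff)
qed

lemma polys_in_sum: "(\<And>x. x \<in> A \<Longrightarrow> f x \<in> polys_in V) \<Longrightarrow> sum f A \<in> polys_in V"
  by (induction A rule: infinite_finite_induct) (auto intro: polys_in_add)

lemma polys_in_induct [consumes 1, case_names pconst pvar add mult]:
  assumes "p \<in> polys_in V"
    and const: "\<And>c. P (pconst c)"
    and var: "\<And>v. v \<in> V \<Longrightarrow> P (pvar v)"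
    and add: "\<And>p q. p \<in> polys_in V \<Longrightarrow> q \<in> polys_in V \<Longrightarrow> P p \<Longrightarrow> P q \<Longrightarrow> P (p + q)"
    and mult: "\<And>p q. p \<in> polys_in V \<Longrightarrow> q \<in> polys_in V \<Longrightarrow> P p \<Longrightarrow> P q \<Longrightarrow> P (p * q)"
  shows "P p"
proof -
  let ?Q = "\<lambda>p. p \<in> polys_in V \<and> P p"
  have one: "?Q 1" using const[of 1] by simp
  have pow: "?Q (pvar v ^ n)" if "v \<in> V" for v n
    using that by (induction n) (auto intro: one[THEN conjunct2] mult polys_in_mult polys_in_pvar var)
  have prod: "?Q (\<Prod>w\<in>A. pvar w ^ f w)" if "finite A" "A \<subseteq> V" for A f
    using that by (induction A rule: finite_induct) (auto intro: one[THEN conjunct2] mult polys_in_mult dest: pow)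
  have single: "?Q (Poly_Mapping.single m c)" if "Poly_Mapping.keys m \<subseteq> V" for m c
    unfolding single_eq_monomial using prod[OF finite_keys that] by (auto intro: mult polys_in_mult const)
  have sum: "p = (\<Sum>m\<in>Poly_Mapping.keys p. Poly_Mapping.single m (Poly_Mapping.lookup p m))"
    by (rule poly_mapping_eqI) (auto simp: lookup_sum lookup_single when_def in_keys_iff)
  have "?Q (\<Sum>m\<in>A. Poly_Mapping.single m (Poly_Mapping.lookup p m))" if "finite A" "A \<subseteq> Poly_Mapping.keys p" for A
    using that
  proof (induction A)
    case empty
    then show ?case using const[of 0] by simp
  next
    case (insert m A)
    have "Poly_Mapping.keys m \<subseteq> V" using assms(1) insert.prems by (auto simp: polys_in_iff)
    then show ?case using single insert by (auto intro!: add polys_in_add)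
  qed
  from this[OF finite_keys subset_refl] show ?thesis by (subst sum) simp
qed

lemma mpoly_ring_simps [simp]:
  "p \<otimes>\<^bsub>mpoly_ring V\<^esub> q = p * q" "p \<oplus>\<^bsub>mpoly_ring V\<^esub> q = p + q"
  "\<one>\<^bsub>mpoly_ring V\<^esub> = 1" "\<zero>\<^bsub>mpoly_ring V\<^esub> = 0"
  by (simp_all add: mpoly_ring_def)

lemma cring_mpoly_ring: "cring (mpoly_ring V)"
proof (rule cringI)
  show "abelian_group (mpoly_ring V)"
    by (rule abelian_groupI) (auto simp: polys_in_add ac_simps intro: bexI[OF _ polys_in_uminus])
  show "Group.comm_monoid (mpoly_ring V)"
    by unfold_locales (auto simp: polys_in_mult ac_simps)
qed (simp add: distrib_right)

text \<open>The linear order on the variables orders the monomials, and the product of two leading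
  terms cannot cancel.\<close>

lemma domain_mpoly_ring: "domain (mpoly_ring (V :: 'v::linorder set))"
proof -
  interpret cring "mpoly_ring V" by (rule cring_mpoly_ring)
  show ?thesis by unfold_locales auto
qed


subsection \<open>Evaluation and extension of derivations\<close>

definition peval :: "('k::field_char_0 \<Rightarrow> 'b::comm_ring_1) \<Rightarrow> ('v \<Rightarrow> 'b) \<Rightarrow> (('v \<Rightarrow>\<^sub>0 nat) \<Rightarrow>\<^sub>0 'k) \<Rightarrow> 'b" where
  "peval f g p = (\<Sum>m\<in>Poly_Mapping.keys p.
     f (Poly_Mapping.lookup p m) * (\<Prod>w\<in>Poly_Mapping.keys m. g w ^ Poly_Mapping.lookup m w))"

locale poly_evaluation =
  fixes f :: "'k::field_char_0 \<Rightarrow> 'b::comm_ring_1" and g :: "'v \<Rightarrow> 'b"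
  assumes hom_add: "f (a + b) = f a + f b"
    and hom_mult: "f (a * b) = f a * f b"
    and hom_one: "f 1 = 1"
begin

lemma hom_zero: "f 0 = 0"
  using hom_add[of 0 0] by simp

lemma peval_single:
  "peval f g (Poly_Mapping.single m c) = f c * (\<Prod>w\<in>Poly_Mapping.keys m. g w ^ Poly_Mapping.lookup m w)"
  by (simp add: peval_def hom_zero)

lemma peval_pconst: "peval f g (pconst c) = f c"
  by (simp add: peval_single pconst_def)

lemma peval_pvar: "peval f g (pvar v) = g v"
  by (simp add: peval_single pvar_def hom_one)

lemma peval_add: "peval f g (p + q) = peval f g p + peval f g q"
  unfolding peval_def by (rule setsum_keys_plus_distrib) (simp_all add: hom_zero hom_add algebra_simps)

lemma peval_mult_single:
  "peval f g (Poly_Mapping.single m c * Poly_Mapping.single n c') =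
   peval f g (Poly_Mapping.single m c) * peval f g (Poly_Mapping.single n c')"
proof -
  \<comment> \<open>The monomials are all written over one common support, where exponents add
    variable by variable; the additional factors have exponent 0.\<close>
  define A where "A = Poly_Mapping.keys m \<union> Poly_Mapping.keys n"
  have ext: "(\<Prod>w\<in>Poly_Mapping.keys l. g w ^ Poly_Mapping.lookup l w) = (\<Prod>w\<in>A. g w ^ Poly_Mapping.lookup l w)"
    if "Poly_Mapping.keys l \<subseteq> A" for l
    using that by (intro prod.mono_neutral_left) (auto simp: A_def in_keys_iff)
  have "Poly_Mapping.keys (m + n) \<subseteq> A" using keys_add[of m n] by (simp add: A_def)
  moreover have "Poly_Mapping.keys m \<subseteq> A" "Poly_Mapping.keys n \<subseteq> A" by (simp_all add: A_def)
  ultimately show ?thesis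
    unfolding mult_single peval_single hom_mult
    by (simp only: ext) (simp add: lookup_add power_add prod.distrib algebra_simps)
qed

lemma peval_mult: "peval f g (p * q) = peval f g p * peval f g q"
proof (induction p rule: poly_mapping_single_induct)
  case (single m c)
  show ?case
    by (induction q rule: poly_mapping_single_induct)
       (simp_all add: peval_mult_single peval_add distrib_left)
qed (simp add: peval_add distrib_right)

lemma peval_diff: "peval f g (p - q) = peval f g p - peval f g q"
  using peval_add[of "p - q" q] by simp

end

text \<open>The chain rule: the derivation that is \<open>d\<close> on the coefficients and sends
  the variable \<open>w\<close> to \<open>g w\<close>. Both \<open>word_der\<close> and the action
  \<open>E\<close> on the polynomial model are instances.\<close>

definition pder :: "('k::field_char_0 \<Rightarrow> 'k) \<Rightarrow> ('v \<Rightarrow> ('v \<Rightarrow>\<^sub>0 nat) \<Rightarrow>\<^sub>0 'k) \<Rightarrow>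
    (('v \<Rightarrow>\<^sub>0 nat) \<Rightarrow>\<^sub>0 'k) \<Rightarrow> (('v \<Rightarrow>\<^sub>0 nat) \<Rightarrow>\<^sub>0 'k)" where
  "pder d g p = (\<Sum>m\<in>Poly_Mapping.keys p.
     Poly_Mapping.single m (d (Poly_Mapping.lookup p m)) +
     (\<Sum>w\<in>Poly_Mapping.keys m.
        Poly_Mapping.single (m - Poly_Mapping.single w 1)
          (of_nat (Poly_Mapping.lookup m w) * Poly_Mapping.lookup p m) * g w))"

lemma pder_add:
  assumes "ring_derivation d"
  shows "pder d g (p + q) = pder d g p + pder d g q"
proof -
  interpret ring_derivation d by fact
  show ?thesis
    unfolding pder_def
    by (rule setsum_keys_plus_distrib)
      (simp_all add: add single_add distrib_left distrib_right sum.distrib algebra_simps)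
qed

lemma pder_single:
  assumes "ring_derivation d"
  shows "pder d g (Poly_Mapping.single m c) = Poly_Mapping.single m (d c) +
     (\<Sum>w\<in>Poly_Mapping.keys m.
        Poly_Mapping.single (m - Poly_Mapping.single w 1) (of_nat (Poly_Mapping.lookup m w) * c) * g w)"
  by (simp add: pder_def ring_derivation.zero[OF assms])

lemma pder_mult_single:
  fixes m :: "'v \<Rightarrow>\<^sub>0 nat" and c :: "'k::field_char_0"
  assumes "ring_derivation d"
  shows "pder d g (Poly_Mapping.single m c * Poly_Mapping.single n c') =
    pder d g (Poly_Mapping.single m c) * Poly_Mapping.single n c' +
    Poly_Mapping.single m c * pder d g (Poly_Mapping.single n c')"
proof -
  interpret ring_derivation d by fact
  define A where "A = Poly_Mapping.keys m \<union> Poly_Mapping.keys n"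
  define T where "T l c w = Poly_Mapping.single (l - Poly_Mapping.single w 1) (of_nat (Poly_Mapping.lookup l w) * c)"
    for l :: "'v \<Rightarrow>\<^sub>0 nat" and c :: 'k and w
  have ext: "pder d g (Poly_Mapping.single l c) = Poly_Mapping.single l (d c) + (\<Sum>w\<in>A. T l c w * g w)"
    if "Poly_Mapping.keys l \<subseteq> A" for l c
    using that unfolding pder_single[OF assms] T_def
    by (intro arg_cong2[where f = plus] refl sum.mono_neutral_left) (auto simp: A_def in_keys_iff)
  \<comment> \<open>Subtraction of exponents is truncated. If \<open>w\<close> does not occur in
    \<open>l\<close>, the factor \<open>of_nat 0\<close> kills both sides; otherwise the subtraction
    is exact and commutes with adding \<open>l'\<close>.\<close>
  have shift: "T l c w * Poly_Mapping.single l' c' =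
      Poly_Mapping.single (l + l' - Poly_Mapping.single w 1) (of_nat (Poly_Mapping.lookup l w) * c * c')" for l l' c c' w
  proof (cases "Poly_Mapping.lookup l w = 0")
    case False
    then have "l - Poly_Mapping.single w 1 + l' = l + l' - Poly_Mapping.single w 1"
      by (intro poly_mapping_eqI) (auto simp: lookup_add lookup_minus lookup_single when_def)
    then show ?thesis by (simp add: T_def mult_single)
  qed (simp add: T_def)
  have split: "T (m + n) (c * c') w = T m c w * Poly_Mapping.single n c' + Poly_Mapping.single m c * T n c' w" for w
    unfolding mult.commute[of "Poly_Mapping.single m c"] shift unfolding T_def
    by (simp add: lookup_add single_add[symmetric] add.commute[of n m] algebra_simps)
  have "Poly_Mapping.keys (m + n) \<subseteq> A" using keys_add[of m n] by (simp add: A_def)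
  moreover have "Poly_Mapping.keys m \<subseteq> A" "Poly_Mapping.keys n \<subseteq> A" by (simp_all add: A_def)
  ultimately show ?thesis
    by (simp only: mult_single ext split)
      (simp add: mult single_add mult_single distrib_left distrib_right sum.distrib sum_distrib_left sum_distrib_right algebra_simps)
qed

lemma pder_derivation:
  assumes "ring_derivation d"
  shows "ring_derivation (pder d g)"
proof
  show "pder d g (p * q) = pder d g p * q + p * pder d g q" for p q
  proof (induction p rule: poly_mapping_single_induct)
    case (single m c)
    show ?case
      by (induction q rule: poly_mapping_single_induct)
        (simp_all add: pder_mult_single[OF assms] pder_add[OF assms] algebra_simps)
  qed (simp add: pder_add[OF assms] algebra_simps)
qed (rule pder_add[OF assms])

lemma pder_pconst:
  assumes "ring_derivation d"
  shows "pder d g (pconst c) = pconst (d c)"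
  by (simp add: pder_single[OF assms] pconst_def)

lemma pder_pvar:
  assumes "ring_derivation d"
  shows "pder d g (pvar w) = g w"
  by (simp add: pder_single[OF assms] pvar_def ring_derivation.one[OF assms])

lemma pder_closed:
  assumes "ring_derivation d" "\<And>v. v \<in> V \<Longrightarrow> g v \<in> polys_in V" "p \<in> polys_in V"
  shows "pder d g p \<in> polys_in V"
proof -
  interpret ring_derivation "pder d g" by (rule pder_derivation) fact
  show ?thesis
    using assms(3)
    by (induction rule: polys_in_induct)
      (auto simp: pder_pconst[OF assms(1)] pder_pvar[OF assms(1)] add mult assms(2) intro: polys_in_add polys_in_mult)
qed

lemma derivations_agree:
  assumes "ring_derivation d" "ring_derivation d'"
    and "\<And>c. d (pconst c) = d' (pconst c)" "\<And>v. v \<in> V \<Longrightarrow> d (pvar v) = d' (pvar v)" "p \<in> polys_in V"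
  shows "d p = d' p"
  using assms(5)
  by (induction rule: polys_in_induct)
    (simp_all add: assms ring_derivation.add[OF assms(1)] ring_derivation.add[OF assms(2)]
      ring_derivation.mult[OF assms(1)] ring_derivation.mult[OF assms(2)])

lemma (in differential_field) act_derivation: "ring_derivation (act F x)"
  by unfold_locales (simp_all add: act_add act_mult)

lemma word_der_eq_pder: "word_der F x = pder (act F x) (\<lambda>w. pvar (x # w))"
proof
  show "word_der F x p = pder (act F x) (\<lambda>w. pvar (x # w)) p" for p
    unfolding word_der_def pder_def pvar_def by (simp add: mult_single)
qed

lemma (in differential_field) word_der_derivation: "ring_derivation (word_der F x)"
  unfolding word_der_eq_pder by (intro pder_derivation act_derivation)


subsection \<open>Adjoining primitives\<close>

definition mdeg :: "('v \<Rightarrow>\<^sub>0 nat) \<Rightarrow> nat" where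
  "mdeg m = (\<Sum>i\<in>Poly_Mapping.keys m. Poly_Mapping.lookup m i)"

lemma mdeg_add_single: "mdeg (m + Poly_Mapping.single i (Suc 0)) = Suc (mdeg m)"
  unfolding mdeg_def
  by (subst setsum_keys_plus_distrib) simp_all

lemma mdeg_eq_0_iff [simp]: "mdeg m = 0 \<longleftrightarrow> m = 0"
proof
  assume m: "mdeg m = 0"
  show "m = 0"
  proof (rule poly_mapping_eqI)
    show "Poly_Mapping.lookup m i = Poly_Mapping.lookup 0 i" for i
      using m by (cases "i \<in> Poly_Mapping.keys m") (simp_all add: mdeg_def in_keys_iff)
  qed
qed (simp add: mdeg_def)

text \<open>Variables are sent to constants, so the monomial \<open>m\<close> is reached only from
  \<open>m\<close> itself, by differentiating its coefficient, and from \<open>m\<close> times one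
  variable, with the multiplicity of that variable. The finite set \<open>I\<close> keeps the sum
  finite when there are infinitely many variables.\<close>

lemma lookup_pder:
  assumes d: "ring_derivation d" and I: "finite I" "p \<in> polys_in I"
  shows "Poly_Mapping.lookup (pder d (\<lambda>i. pconst (w i)) p) m = d (Poly_Mapping.lookup p m) +
    (\<Sum>i\<in>I. of_nat (Suc (Poly_Mapping.lookup m i)) * Poly_Mapping.lookup p (m + Poly_Mapping.single i (Suc 0)) * w i)"
proof -
  interpret ring_derivation d by fact
  let ?e = "\<lambda>i. Poly_Mapping.single i (Suc 0)"
  define T where "T n i = of_nat (Suc (Poly_Mapping.lookup m i)) * Poly_Mapping.lookup p n * w i" for n i
  have single: "Poly_Mapping.lookup (Poly_Mapping.single (n - ?e i) (of_nat (Poly_Mapping.lookup n i) * Poly_Mapping.lookup p n) * pconst (w i)) m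
      = (if n = m + ?e i then T n i else 0)" if "i \<in> Poly_Mapping.keys n" for n i
  proof -
    have "n - ?e i = m \<longleftrightarrow> n = m + ?e i"
      using that by (auto simp: poly_mapping_eq_iff fun_eq_iff lookup_add lookup_minus lookup_single when_def in_keys_iff)
    then show ?thesis
      by (auto simp: pconst_def mult_single lookup_single when_def T_def lookup_add)
  qed
  have inner: "(\<Sum>i\<in>Poly_Mapping.keys n. Poly_Mapping.lookup (Poly_Mapping.single (n - ?e i) (of_nat (Poly_Mapping.lookup n i) * Poly_Mapping.lookup p n) * pconst (w i)) m)
      = (\<Sum>i\<in>I. if n = m + ?e i then T n i else 0)" if "n \<in> Poly_Mapping.keys p" for n
  proof -
    have "(\<Sum>i\<in>I. if n = m + ?e i then T n i else 0) = (\<Sum>i\<in>Poly_Mapping.keys n. if n = m + ?e i then T n i else 0)"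
      using I that by (intro sum.mono_neutral_right) (auto simp: polys_in_iff in_keys_iff lookup_add)
    then show ?thesis by (simp add: single)
  qed
  have "Poly_Mapping.lookup (pder d (\<lambda>i. pconst (w i)) p) m =
      (\<Sum>n\<in>Poly_Mapping.keys p. if n = m then d (Poly_Mapping.lookup p n) else 0) +
      (\<Sum>n\<in>Poly_Mapping.keys p. \<Sum>i\<in>I. if n = m + ?e i then T n i else 0)"
    unfolding pder_def
    by (simp add: lookup_sum lookup_add sum.distrib inner lookup_single when_def)
  also have "(\<Sum>n\<in>Poly_Mapping.keys p. \<Sum>i\<in>I. if n = m + ?e i then T n i else 0) =
      (\<Sum>i\<in>I. \<Sum>n\<in>Poly_Mapping.keys p. if n = m + ?e i then T n i else 0)"
    by (rule sum.swap)
  also have "\<dots> = (\<Sum>i\<in>I. T (m + ?e i) i)"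
    by (intro sum.cong refl) (auto simp: sum.delta' in_keys_iff T_def)
  finally show ?thesis by (simp add: T_def sum.delta' in_keys_iff)
qed

lemma finite_variables:
  assumes "p \<in> polys_in V"
  obtains I where "finite I" "I \<subseteq> V" "p \<in> polys_in I"
proof
  show "finite (\<Union>m\<in>Poly_Mapping.keys p. Poly_Mapping.keys m)" by simp
  show "(\<Union>m\<in>Poly_Mapping.keys p. Poly_Mapping.keys m) \<subseteq> V" using assms by (auto simp: polys_in_iff)
  show "p \<in> polys_in (\<Union>m\<in>Poly_Mapping.keys p. Poly_Mapping.keys m)" by (auto simp: polys_in_iff)
qed

text \<open>The variable \<open>i\<close> is to become a common primitive of the elements
  \<open>w x i\<close>, as in the Kolchin-Ostrowski theorem. \<open>independent\<close> says that a
  combination with constant coefficients is exact only if it is trivial; it is phrased with finite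
  \<open>I\<close> since \<open>V\<close> may be infinite.\<close>

locale primitive_extension =
  fixes X :: "'x set" and d :: "'x \<Rightarrow> 'k::field_char_0 \<Rightarrow> 'k" and w :: "'x \<Rightarrow> 'v \<Rightarrow> 'k" and V :: "'v set"
  assumes derivation: "x \<in> X \<Longrightarrow> ring_derivation (d x)"
    and independent: "finite I \<Longrightarrow> I \<subseteq> V \<Longrightarrow> (\<And>i x. i \<in> I \<Longrightarrow> x \<in> X \<Longrightarrow> d x (c i) = 0) \<Longrightarrow>
      (\<And>x. x \<in> X \<Longrightarrow> (\<Sum>i\<in>I. c i * w x i) = d x f) \<Longrightarrow> i \<in> I \<Longrightarrow> c i = 0"
begin

definition der :: "'x \<Rightarrow> (('v \<Rightarrow>\<^sub>0 nat) \<Rightarrow>\<^sub>0 'k) \<Rightarrow> (('v \<Rightarrow>\<^sub>0 nat) \<Rightarrow>\<^sub>0 'k)" where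
  "der x = pder (d x) (\<lambda>i. pconst (w x i))"

text \<open>The additional terms in \<open>lookup_pder\<close> involve coefficients of degree
  \<open>mdeg m + 1\<close>, which lies beyond the bound \<open>e\<close>.\<close>

lemma lookup_der_top:
  assumes "x \<in> X" "\<And>n. n \<in> Poly_Mapping.keys p \<Longrightarrow> mdeg n \<le> e" "e \<le> mdeg m"
  shows "Poly_Mapping.lookup (der x p) m = d x (Poly_Mapping.lookup p m)"
proof -
  obtain I where I: "finite I" "p \<in> polys_in I" using finite_variables[of p UNIV] by auto
  have "Poly_Mapping.lookup p (m + Poly_Mapping.single i (Suc 0)) = 0" for i
    using assms(2)[of "m + Poly_Mapping.single i (Suc 0)"] assms(3)
    unfolding in_keys_iff mdeg_add_single by fastforce
  then show ?thesis using lookup_pder[OF derivation I] assms(1) by (simp add: der_def)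
qed

text \<open>Suppose the degree \<open>e\<close> is positive and remove one variable \<open>i\<close>
  from a monomial \<open>n\<close> of degree \<open>e\<close>, leaving \<open>m\<close>. The
  coefficient of \<open>m\<close> in the derivative vanishes, which expresses a combination of the
  \<open>w x j\<close> as the derivative of minus the coefficient of \<open>m\<close> in
  \<open>p\<close>. The factors \<open>c j\<close> of this combination are constants, being
  multiples of top coefficients. Independence gives \<open>c i = 0\<close>, and in characteristic
  zero the coefficient of \<open>n\<close> vanishes too.\<close>

lemma constant_polynomial:
  assumes p: "p \<in> polys_in V" and const: "\<And>x. x \<in> X \<Longrightarrow> der x p = 0"
  shows "\<exists>c. p = pconst c \<and> (\<forall>x\<in>X. d x c = 0)"
proof -
  define e where "e = Max (insert 0 (mdeg ` Poly_Mapping.keys p))"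
  have le: "mdeg n \<le> e" if "n \<in> Poly_Mapping.keys p" for n
    using that by (simp add: e_def)
  have top: "d x (Poly_Mapping.lookup p m) = 0" if "x \<in> X" "e \<le> mdeg m" for x m
    using lookup_der_top[OF that(1) _ that(2), of p] le const[OF that(1)] by simp
  have "e = 0"
  proof (rule ccontr)
    assume "e \<noteq> 0"
    moreover have "e \<in> insert 0 (mdeg ` Poly_Mapping.keys p)" unfolding e_def by (rule Max_in) auto
    ultimately obtain n where n: "n \<in> Poly_Mapping.keys p" "mdeg n = e" by auto
    then obtain i where i: "i \<in> Poly_Mapping.keys n"
      using \<open>e \<noteq> 0\<close> by (metis ex_in_conv mdeg_def sum.empty)
    define m where "m = n - Poly_Mapping.single i (Suc 0)"
    have m: "m + Poly_Mapping.single i (Suc 0) = n"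
      using i by (intro poly_mapping_eqI) (auto simp: m_def lookup_add lookup_minus lookup_single when_def in_keys_iff)
    have em: "e = Suc (mdeg m)" using n(2) by (simp add: m[symmetric] mdeg_add_single)
    obtain I where I: "finite I" "I \<subseteq> V" "p \<in> polys_in I" using finite_variables[OF p] .
    define c where "c j = of_nat (Suc (Poly_Mapping.lookup m j)) * Poly_Mapping.lookup p (m + Poly_Mapping.single j (Suc 0))" for j
    have "i \<in> I" using I(3) n(1) i by (auto simp: polys_in_iff)
    have "c i = 0"
    proof (rule independent[OF I(1,2) _ _ \<open>i \<in> I\<close>])
      fix x j assume x: "x \<in> X"
      interpret ring_derivation "d x" by (rule derivation) fact
      have "d x (of_nat k) = 0" for k by (induction k) (simp_all add: add)
      then show "d x (c j) = 0"
        using top[OF x, of "m + Poly_Mapping.single j (Suc 0)"] unfolding c_def mult by (simp add: em mdeg_add_single add)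
    next
      fix x assume x: "x \<in> X"
      interpret ring_derivation "d x" by (rule derivation) fact
      show "(\<Sum>j\<in>I. c j * w x j) = d x (- Poly_Mapping.lookup p m)"
        using lookup_pder[OF derivation[OF x] I(1,3), of "w x" m] const[OF x]
        by (simp add: der_def c_def uminus eq_neg_iff_add_eq_0 add.commute)
    qed
    then show False using n(1) m by (simp add: c_def in_keys_iff of_nat_Suc[symmetric] del: of_nat_Suc)
  qed
  then have "Poly_Mapping.keys p \<subseteq> {0}" using le by auto
  then have "p = pconst (Poly_Mapping.lookup p 0)"
    by (intro poly_mapping_eqI) (auto simp: pconst_def lookup_single when_def in_keys_iff)
  moreover have "\<forall>x\<in>X. d x (Poly_Mapping.lookup p 0) = 0" using top \<open>e = 0\<close> by simp
  ultimately show ?thesis by blast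
qed

text \<open>
  Take an element of \<open>J\<close> of least total degree and, among those, with the fewest monomials of top
  degree. After scaling one top coefficient to 1, every derivation lowers this measure and
  therefore kills the element.
\<close>

lemma differentially_simple:
  assumes J: "J \<subseteq> polys_in V" "q \<in> J" "q \<noteq> 0"
    and scale: "\<And>c q. q \<in> J \<Longrightarrow> pconst c * q \<in> J"
    and stable: "\<And>x q. x \<in> X \<Longrightarrow> q \<in> J \<Longrightarrow> der x q \<in> J"
  shows "1 \<in> J"
proof -
  define B where "B e = {q \<in> J. q \<noteq> 0 \<and> (\<forall>m\<in>Poly_Mapping.keys q. mdeg m \<le> e)}" for e
  define top where "top e q = {m \<in> Poly_Mapping.keys q. mdeg m = e}" for e and q :: "('v \<Rightarrow>\<^sub>0 nat) \<Rightarrow>\<^sub>0 'k"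
  define e where "e = (LEAST e. B e \<noteq> {})"
  have "q \<in> B (Max (insert 0 (mdeg ` Poly_Mapping.keys q)))" using J by (simp add: B_def)
  then have "\<exists>e. B e \<noteq> {}" by (metis empty_iff)
  then have ne: "B e \<noteq> {}" unfolding e_def by (rule LeastI_ex[where P = "\<lambda>e. B e \<noteq> {}"])
  then obtain p where p: "p \<in> B e" and min: "\<And>r. r \<in> B e \<Longrightarrow> card (top e p) \<le> card (top e r)"
    by (metis ex_has_least_nat[of "\<lambda>r. r \<in> B e" _ "\<lambda>r. card (top e r)"] ex_in_conv)
  have "top e p \<noteq> {}"
  proof
    assume emp: "top e p = {}"
    show False
    proof (cases e)
      case 0
      moreover obtain m where m: "m \<in> Poly_Mapping.keys p"
        using p by (auto simp: B_def simp flip: keys_eq_empty)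
      moreover have "mdeg m \<le> e" using p m by (simp add: B_def)
      ultimately show False using emp by (auto simp: top_def)
    next
      case (Suc e')
      then have "p \<in> B e'" using p emp by (fastforce simp: B_def top_def le_Suc_eq)
      then have "B e' \<noteq> {}" by (metis empty_iff)
      then have "e \<le> e'" unfolding e_def by (rule Least_le[where P = "\<lambda>e. B e \<noteq> {}"])
      then show False using Suc by simp
    qed
  qed
  then obtain n where n: "n \<in> top e p" by blast
  define r where "r = pconst (1 / Poly_Mapping.lookup p n) * p"
  have pn: "Poly_Mapping.lookup p n \<noteq> 0" using n by (simp add: top_def in_keys_iff)
  have keys: "Poly_Mapping.keys r = Poly_Mapping.keys p"
    using pn by (auto simp: r_def in_keys_iff lookup_pconst_mult)
  have rJ: "r \<in> J" using p by (simp add: r_def B_def scale)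
  have bound: "mdeg m \<le> e" if "m \<in> Poly_Mapping.keys r" for m using that p keys by (simp add: B_def)
  have rn: "Poly_Mapping.lookup r n = 1" using pn by (simp add: r_def lookup_pconst_mult)
  have "der x r = 0" if x: "x \<in> X" for x
  proof (rule ccontr)
    assume nz: "der x r \<noteq> 0"
    interpret ring_derivation "d x" by (rule derivation) fact
    have lookup: "Poly_Mapping.lookup (der x r) m = d x (Poly_Mapping.lookup r m)" if "e \<le> mdeg m" for m
      by (rule lookup_der_top[OF x bound that])
    \<comment> \<open>Top coefficients are merely differentiated in the coefficient field, so no new
      top monomial appears, and \<open>n\<close> is lost because its coefficient is 1.\<close>
    have keys_der: "m \<in> Poly_Mapping.keys r \<and> m \<noteq> n" if "m \<in> Poly_Mapping.keys (der x r)" "e \<le> mdeg m" for m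
      using lookup[OF that(2)] that(1) rn by (auto simp: in_keys_iff)
    have "mdeg m \<le> e" if "m \<in> Poly_Mapping.keys (der x r)" for m
      using keys_der[OF that] bound[of m] by linarith
    then have "der x r \<in> B e"
      using nz stable[OF x rJ] by (simp add: B_def)
    moreover have "top e (der x r) \<subset> top e p"
      using keys_der n keys by (auto simp: top_def)
    moreover have "finite (top e p)" by (simp add: top_def)
    ultimately show False using min psubset_card_mono by (metis leD)
  qed
  \<comment> \<open>An element killed by all derivations is a constant of the coefficient field,
    here non-zero, and scaling by its inverse produces 1.\<close>
  then obtain c where c: "r = pconst c" using constant_polynomial J(1) rJ by blast
  have "c \<noteq> 0" using c rn by auto
  then have "1 = pconst (1 / c) * r" unfolding c by (simp add: pconst_mult[symmetric])
  also have "\<dots> \<in> J" by (rule scale) (rule rJ)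
  finally show ?thesis .
qed

end


section \<open>Quotients of differential algebras\<close>

text \<open>Operations on cosets and on fractions are unions over all representatives. Once the
  value is independent of the representative, this collapses the union.\<close>

lemma UN_eq_const:
  assumes "a \<in> A" "\<And>x. x \<in> A \<Longrightarrow> f x = B"
  shows "(\<Union>x\<in>A. f x) = B"
  using assms by auto

text \<open>A differential algebra without additivity, linearity and the bracket law in the operator
  argument. The algebra of words satisfies only these axioms, so quotients are treated at this
  level.\<close>

locale operator_algebra = cring A
  for F :: "('k::field_char_0, 'd::ab_group_add) dfield" and A :: "('r, 'd, 'k) dalg" (structure) +
  assumes alg_closed [simp]: "alg A c \<in> carrier A"
    and alg_add: "alg A (c + c') = alg A c \<oplus> alg A c'"
    and alg_mult: "alg A (c * c') = alg A c \<otimes> alg A c'"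
    and alg_one [simp]: "alg A 1 = \<one>"
    and dact_closed [simp]: "r \<in> carrier A \<Longrightarrow> dact A x r \<in> carrier A"
    and dact_add: "r \<in> carrier A \<Longrightarrow> s \<in> carrier A \<Longrightarrow> dact A x (r \<oplus> s) = dact A x r \<oplus> dact A x s"
    and dact_mult: "r \<in> carrier A \<Longrightarrow> s \<in> carrier A \<Longrightarrow>
      dact A x (r \<otimes> s) = dact A x r \<otimes> s \<oplus> r \<otimes> dact A x s"
    and dact_alg: "dact A x (alg A c) = alg A (act F x c)"
begin

lemma dact_zero [simp]: "dact A x \<zero> = \<zero>"
  using dact_add[of \<zero> \<zero> x] by simp

lemma alg_zero [simp]: "alg A 0 = \<zero>"
  using alg_add[of 0 0] by simp

lemma dact_one [simp]: "dact A x \<one> = \<zero>"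
  using dact_mult[of \<one> \<one> x] by simp

lemma dact_uminus: "r \<in> carrier A \<Longrightarrow> dact A x (\<ominus> r) = \<ominus> dact A x r"
  using dact_add[of r "\<ominus> r" x] by (simp add: r_neg minus_equality[symmetric] a_comm)

lemma dact_minus: "r \<in> carrier A \<Longrightarrow> s \<in> carrier A \<Longrightarrow> dact A x (r \<ominus> s) = dact A x r \<ominus> dact A x s"
  by (simp add: a_minus_def dact_add dact_uminus)

lemma alg_uminus: "alg A (- c) = \<ominus> alg A c"
  using alg_add[of "- c" c] minus_equality[of "alg A (- c)" "alg A c"] by simp

lemma alg_minus: "alg A (c - c') = alg A c \<ominus> alg A c'"
  using alg_add[of c "- c'"] by (simp add: alg_uminus a_minus_def)

lemma differential_algebraI:
  assumes "\<And>x y r. r \<in> carrier A \<Longrightarrow> dact A (x + y) r = dact A x r \<oplus> dact A y r"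
    and "\<And>c x r. r \<in> carrier A \<Longrightarrow> dact A (scl F c x) r = alg A c \<otimes> dact A x r"
    and "\<And>x y r. r \<in> carrier A \<Longrightarrow> dact A (brk F x y) r = dact A x (dact A y r) \<ominus> dact A y (dact A x r)"
  shows "differential_algebra F A"
  by unfold_locales (simp_all add: assms alg_add alg_mult dact_add dact_mult dact_alg)

end

lemma (in differential_algebra) operator_algebra: "operator_algebra F A"
  by unfold_locales (simp_all add: alg_closed alg_add alg_mult alg_one dact_closed dact_add dact_mult dact_alg)

definition dalg_hom :: "('r, 'd, 'k) dalg \<Rightarrow> ('s, 'd, 'k) dalg \<Rightarrow> ('r \<Rightarrow> 's) set" where
  "dalg_hom A B = {h \<in> ring_hom A B. (\<forall>x. \<forall>r\<in>carrier A. h (dact A x r) = dact B x (h r)) \<and>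
     (\<forall>c. h (alg A c) = alg B c)}"

lemma dalg_hom_compose:
  assumes "g \<in> dalg_hom A B" "h \<in> dalg_hom B C"
  shows "h \<circ> g \<in> dalg_hom A C"
proof -
  have "h \<circ> g \<in> ring_hom A C" using assms by (auto simp: dalg_hom_def intro: ring_hom_trans)
  then show ?thesis using assms by (auto simp: dalg_hom_def ring_hom_closed)
qed

locale stable_ideal = operator_algebra F A + ideal I A
  for F :: "('k::field_char_0, 'd::ab_group_add) dfield" and A :: "('r, 'd, 'k) dalg" (structure) and I +
  assumes stable: "r \<in> I \<Longrightarrow> dact A x r \<in> I"
begin

lemma quot_dalg_simps [simp]:
  "carrier (quot_dalg A I) = a_rcosets I"
  "X \<otimes>\<^bsub>quot_dalg A I\<^esub> Y = X \<otimes>\<^bsub>A Quot I\<^esub> Y"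
  "X \<oplus>\<^bsub>quot_dalg A I\<^esub> Y = X \<oplus>\<^bsub>A Quot I\<^esub> Y"
  "\<one>\<^bsub>quot_dalg A I\<^esub> = I +> \<one>" "\<zero>\<^bsub>quot_dalg A I\<^esub> = I"
  "alg (quot_dalg A I) c = I +> alg A c"
  by (simp_all add: quot_dalg_def ring.defs dalg.defs FactRing_def)

lemma coset_eq_iff: "a \<in> carrier A \<Longrightarrow> b \<in> carrier A \<Longrightarrow> I +> a = I +> b \<longleftrightarrow> a \<ominus> b \<in> I"
  using quotient_eq_iff_same_a_r_cos[OF ideal_axioms] by simp

lemma dact_coset:
  assumes "r \<in> carrier A"
  shows "dact (quot_dalg A I) x (I +> r) = I +> dact A x r"
proof -
  have "I +> dact A x r' = I +> dact A x r" if "r' \<in> I +> r" for r'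
  proof -
    have r': "r' \<in> carrier A" using that assms a_elemrcos_carrier by blast
    have "I +> r' = I +> r" using that assms a_repr_independence' by metis
    then have "r' \<ominus> r \<in> I" using coset_eq_iff r' assms by blast
    from stable[OF this, of x] show ?thesis using r' assms by (simp add: coset_eq_iff dact_minus)
  qed
  then have "(\<Union>r'\<in>I +> r. I +> dact A x r') = I +> dact A x r"
    by (rule UN_eq_const[OF a_rcos_self[OF assms]])
  then show ?thesis
    unfolding quot_dalg_def by (simp only: ring.defs dalg.defs dalg.simps)
qed

lemma coset_cases:
  assumes "X \<in> carrier (quot_dalg A I)"
  obtains r where "r \<in> carrier A" "X = I +> r"
  using assms by (auto simp: A_RCOSETS_def')

lemma coset_closed: "r \<in> carrier A \<Longrightarrow> I +> r \<in> a_rcosets I"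
  using a_rcosetsI[OF a_subset] .

lemma mult_coset: "r \<in> carrier A \<Longrightarrow> s \<in> carrier A \<Longrightarrow> (I +> r) \<otimes>\<^bsub>A Quot I\<^esub> (I +> s) = I +> (r \<otimes> s)"
  by (simp add: FactRing_def rcoset_mult_add)

lemma add_coset: "r \<in> carrier A \<Longrightarrow> s \<in> carrier A \<Longrightarrow> (I +> r) \<oplus>\<^bsub>A Quot I\<^esub> (I +> s) = I +> (r \<oplus> s)"
  by (simp add: FactRing_def a_rcos_sum)

lemma cring_quot_dalg: "cring (quot_dalg A I)"
proof -
  interpret Q: cring "A Quot I" by (rule quotient_is_cring) (rule is_cring)
  have carrier: "a_rcosets I = carrier (A Quot I)" by (simp add: FactRing_def)
  have zero: "\<zero>\<^bsub>A Quot I\<^esub> = I" and one: "\<one>\<^bsub>A Quot I\<^esub> = I +> \<one>"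
    by (simp_all add: FactRing_def)
  show ?thesis
  proof (rule cringI)
    show "abelian_group (quot_dalg A I)"
    proof (rule abelian_groupI, goal_cases)
      case (6 X)
      then show ?case
        using Q.l_neg[of X] Q.a_inv_closed[of X] by (auto simp: carrier zero)
    qed (simp_all add: carrier zero Q.zero_closed[unfolded zero] Q.l_zero[unfolded zero] Q.a_ac)
    show "Group.comm_monoid (quot_dalg A I)"
      by unfold_locales
        (simp_all add: carrier Q.one_closed[unfolded one] Q.l_one[unfolded one] Q.r_one[unfolded one] Q.m_ac)
  qed (simp add: carrier Q.l_distr)
qed

lemma quot_operator_algebra: "operator_algebra F (quot_dalg A I)"
proof -
  interpret Q: cring "quot_dalg A I" by (rule cring_quot_dalg)
  show ?thesis
  proof (unfold_locales, goal_cases)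
    case (5 X x)
    then show ?case by (metis coset_cases coset_closed dact_closed dact_coset quot_dalg_simps(1))
  next
    case (6 X Y x)
    then show ?case by (elim coset_cases) (simp add: dact_coset add_coset dact_add)
  next
    case (7 X Y x)
    then show ?case by (elim coset_cases) (simp add: dact_coset add_coset mult_coset dact_mult)
  qed (simp_all add: coset_closed add_coset mult_coset alg_add alg_mult dact_coset dact_alg)
qed

lemma coset_dalg_hom: "(+>) I \<in> dalg_hom A (quot_dalg A I)"
  unfolding dalg_hom_def
  by (auto intro!: ring_hom_memI simp: coset_closed add_coset mult_coset dact_coset)

lemma coset_eq_zero_iff: "r \<in> carrier A \<Longrightarrow> I +> r = \<zero>\<^bsub>quot_dalg A I\<^esub> \<longleftrightarrow> r \<in> I"
  using a_coset_join1 a_rcos_const is_additive_subgroup by (auto simp: additive_subgroup.a_subset intro: rcos_const_imp_mem)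

text \<open>Serves both quotients: for differential polynomials the defects of the three laws lie in
  the ideal by construction, for further quotients of a differential algebra they are already
  zero.\<close>

lemma quot_differential_algebra:
  assumes plus: "\<And>x y r. r \<in> carrier A \<Longrightarrow> dact A (x + y) r \<ominus> (dact A x r \<oplus> dact A y r) \<in> I"
    and scl: "\<And>c x r. r \<in> carrier A \<Longrightarrow> dact A (scl F c x) r \<ominus> alg A c \<otimes> dact A x r \<in> I"
    and brk: "\<And>x y r. r \<in> carrier A \<Longrightarrow>
      dact A (brk F x y) r \<ominus> (dact A x (dact A y r) \<ominus> dact A y (dact A x r)) \<in> I"
  shows "differential_algebra F (quot_dalg A I)"
proof -
  interpret Q: operator_algebra F "quot_dalg A I" by (rule quot_operator_algebra)
  have minus: "(I +> r) \<ominus>\<^bsub>quot_dalg A I\<^esub> (I +> s) = I +> (r \<ominus> s)"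
    if "r \<in> carrier A" "s \<in> carrier A" for r s
  proof -
    interpret h: ring_hom_ring A "quot_dalg A I" "(+>) I"
      using coset_dalg_hom by (intro ring_hom_ringI2 Q.ring_axioms ring_axioms) (simp add: dalg_hom_def)
    have "\<ominus> s \<in> carrier A" using that(2) by (rule abelian_group.a_inv_closed[OF abelian_group_axioms])
    then show ?thesis
      by (simp only: a_minus_def h.hom_add that h.hom_a_inv)
  qed
  show ?thesis
  proof (rule Q.differential_algebraI, goal_cases)
    case (1 x y X)
    then show ?case by (elim coset_cases) (simp add: dact_coset add_coset coset_eq_iff plus)
  next
    case (2 c x X)
    then show ?case by (elim coset_cases) (simp add: dact_coset mult_coset coset_eq_iff scl)
  next
    case (3 x y X)
    then show ?case by (elim coset_cases) (simp add: dact_coset minus coset_eq_iff brk)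
  qed
qed

end

lemma (in operator_algebra) diff_ideal_stable:
  assumes "S \<subseteq> carrier A"
  shows "stable_ideal F A (diff_ideal A S)"
proof -
  \<comment> \<open>The whole ring belongs to the family, so the intersection is not an empty
    one.\<close>
  have ne: "{I. ideal I A \<and> S \<subseteq> I \<and> (\<forall>x. \<forall>r\<in>I. dact A x r \<in> I)} \<noteq> {}"
    using oneideal assms by auto
  have "ideal (diff_ideal A S) A"
    unfolding diff_ideal_def by (rule i_Intersect[OF _ ne]) simp
  then show ?thesis
    by (intro stable_ideal.intro stable_ideal_axioms.intro operator_algebra_axioms) (auto simp: diff_ideal_def)
qed

lemma diff_ideal_superset: "S \<subseteq> diff_ideal A S"
  by (auto simp: diff_ideal_def)

lemma diff_ideal_minimal: "stable_ideal F A I \<Longrightarrow> S \<subseteq> I \<Longrightarrow> diff_ideal A S \<subseteq> I"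
  unfolding diff_ideal_def stable_ideal_def stable_ideal_axioms_def by auto

lemma (in differential_algebra) quot_diff_ideal:
  assumes "S \<subseteq> carrier A"
  shows "differential_algebra F (quot_dalg A (diff_ideal A S))"
proof -
  interpret operator_algebra F A by (rule operator_algebra)
  interpret stable_ideal F A "diff_ideal A S" by (rule diff_ideal_stable) fact
  show ?thesis
    by (rule quot_differential_algebra) (simp_all add: dact_plus dact_scl dact_brk r_neg minus_eq)
qed

text \<open>The isomorphism theorem for two surjections out of one ring. In this form it suits a
  target R that is itself an iterated quotient: no map has to be defined on the intermediate
  ring.\<close>

lemma ring_iso_common_kernel:
  assumes "ring A" "ring R" "ring M"
    and p: "p \<in> ring_hom A R" "p ` carrier A = carrier R"
    and f: "f \<in> ring_hom A M" "f ` carrier A = carrier M"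
    and ker: "\<And>r. r \<in> carrier A \<Longrightarrow> p r = \<zero>\<^bsub>R\<^esub> \<longleftrightarrow> f r = \<zero>\<^bsub>M\<^esub>"
  obtains h where "h \<in> ring_iso R M" "\<And>r. r \<in> carrier A \<Longrightarrow> h (p r) = f r"
proof -
  interpret A: ring A by fact
  interpret R: ring R by fact
  interpret M: ring M by fact
  interpret p: ring_hom_ring A R p using p by (intro ring_hom_ringI2 assms)
  interpret f: ring_hom_ring A M f using f by (intro ring_hom_ringI2 assms)
  have eq: "p r = p s \<longleftrightarrow> f r = f s" if "r \<in> carrier A" "s \<in> carrier A" for r s
  proof -
    have "p (r \<ominus>\<^bsub>A\<^esub> s) = p r \<ominus>\<^bsub>R\<^esub> p s" "f (r \<ominus>\<^bsub>A\<^esub> s) = f r \<ominus>\<^bsub>M\<^esub> f s"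
      using that by (simp_all add: a_minus_def)
    then show ?thesis
      using ker[OF A.minus_closed[OF that]] R.r_right_minus_eq[of "p r" "p s"] M.r_right_minus_eq[of "f r" "f s"] that
      by (metis f.hom_closed p.hom_closed)
  qed
  define h where "h X = f (SOME r. r \<in> carrier A \<and> p r = X)" for X
  have h: "h (p r) = f r" if "r \<in> carrier A" for r
  proof -
    have "(SOME s. s \<in> carrier A \<and> p s = p r) \<in> carrier A \<and> p (SOME s. s \<in> carrier A \<and> p s = p r) = p r"
      by (rule someI[of _ r]) (simp add: that)
    then show ?thesis unfolding h_def using eq[OF _ that] by blast
  qed
  have "h \<in> ring_hom R M"
    unfolding p(2)[symmetric] by (rule ring_hom_memI) (auto simp: h p(2)[symmetric] simp flip: p.hom_add p.hom_mult p.hom_one)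
  moreover have "inj_on h (carrier R)"
    unfolding p(2)[symmetric] by (auto intro!: inj_onI simp: h eq)
  moreover have "h ` carrier R = carrier M"
    unfolding p(2)[symmetric] f(2)[symmetric] by (auto simp: h image_image)
  ultimately show ?thesis using that h by (auto simp: ring_iso_def bij_betw_def)
qed


section \<open>Fractions\<close>

locale fraction_algebra = differential_algebra F A + domain A
  for F :: "('k::field_char_0, 'd::ab_group_add) dfield" and A :: "('r, 'd, 'k) dalg" (structure)
begin

sublocale operator_algebra F A by (rule operator_algebra)

abbreviation denominators where "denominators \<equiv> carrier A - {\<zero>}"

lemma mult_denominators: "s \<in> denominators \<Longrightarrow> t \<in> denominators \<Longrightarrow> s \<otimes> t \<in> denominators"
  using integral by auto

lemma frac_mem_iff: "(a, b) \<in> frac A r s \<longleftrightarrow> a \<in> carrier A \<and> b \<in> denominators \<and> r \<otimes> b = a \<otimes> s"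
  by (simp add: frac_def)

lemma frac_eq_iff:
  assumes "r \<in> carrier A" "s \<in> denominators" "r' \<in> carrier A" "s' \<in> denominators"
  shows "frac A r s = frac A r' s' \<longleftrightarrow> r \<otimes> s' = r' \<otimes> s"
proof
  assume "frac A r s = frac A r' s'"
  moreover have "(r', s') \<in> frac A r' s'" using assms by (simp add: frac_mem_iff)
  ultimately show "r \<otimes> s' = r' \<otimes> s" by (simp add: frac_mem_iff flip: \<open>frac A r s = frac A r' s'\<close>)
next
  assume eq: "r \<otimes> s' = r' \<otimes> s"
  have sub: "frac A r s \<subseteq> frac A r' s'"
    if "r \<otimes> s' = r' \<otimes> s" "r \<in> carrier A" "s \<in> denominators" "r' \<in> carrier A" "s' \<in> denominators" for r s r' s'
  proof -
    have "r' \<otimes> b = a \<otimes> s'" if ab: "a \<in> carrier A" "b \<in> denominators" "r \<otimes> b = a \<otimes> s" for a b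
    proof -
      have c: "r \<in> carrier A" "s \<in> carrier A" "r' \<in> carrier A" "s' \<in> carrier A" "a \<in> carrier A" "b \<in> carrier A"
        using that \<open>r \<in> carrier A\<close> \<open>s \<in> denominators\<close> \<open>r' \<in> carrier A\<close> \<open>s' \<in> denominators\<close> by auto
      have "s \<otimes> (r' \<otimes> b) = (r' \<otimes> s) \<otimes> b" using c by algebra
      also have "\<dots> = (r \<otimes> b) \<otimes> s'" using c by (simp add: \<open>r \<otimes> s' = r' \<otimes> s\<close>[symmetric] m_ac)
      also have "\<dots> = s \<otimes> (a \<otimes> s')" using c by (simp add: ab m_ac)
      finally show ?thesis using c \<open>s \<in> denominators\<close> by (simp add: m_lcancel)
    qed
    then show ?thesis by (auto simp: frac_def)
  qed
  show "frac A r s = frac A r' s'"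
    using sub[OF eq assms] sub[OF eq[symmetric] assms(3,4,1,2)] by blast
qed

lemma frac_cancel:
  assumes "r \<in> carrier A" "s \<in> denominators" "t \<in> denominators"
  shows "frac A (r \<otimes> t) (s \<otimes> t) = frac A r s"
proof -
  have "s \<in> carrier A" "t \<in> carrier A" using assms by auto
  then show ?thesis using assms by (subst frac_eq_iff) (auto simp: m_ac integral_iff)
qed

lemma carrier_frac_dalg: "carrier (frac_dalg A) = {frac A r s | r s. r \<in> carrier A \<and> s \<in> denominators}"
  by (simp add: frac_dalg_def)

lemma frac_algebra_simps [simp]:
  "\<one>\<^bsub>frac_dalg A\<^esub> = frac A \<one> \<one>" "\<zero>\<^bsub>frac_dalg A\<^esub> = frac A \<zero> \<one>"
  "alg (frac_dalg A) c = frac A (alg A c) \<one>"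
  by (simp_all add: frac_dalg_def)

lemma frac_cases:
  assumes "X \<in> carrier (frac_dalg A)"
  obtains r s where "r \<in> carrier A" "s \<in> denominators" "X = frac A r s"
  using assms by (auto simp: carrier_frac_dalg)

lemma frac_closed [intro]: "r \<in> carrier A \<Longrightarrow> s \<in> denominators \<Longrightarrow> frac A r s \<in> carrier (frac_dalg A)"
  by (auto simp: carrier_frac_dalg)

text \<open>Over one denominator, addition of fractions is addition of numerators, which keeps the
  group axioms and the Leibniz rule within reach of \<open>algebra\<close>.\<close>

lemma common_denominator:
  assumes "X \<in> carrier (frac_dalg A)" "Y \<in> carrier (frac_dalg A)"
  obtains r r' s where "r \<in> carrier A" "r' \<in> carrier A" "s \<in> denominators" "X = frac A r s" "Y = frac A r' s"
proof -
  obtain r s where 1: "r \<in> carrier A" "s \<in> denominators" "X = frac A r s" using assms(1) by (rule frac_cases)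
  obtain r' s' where 2: "r' \<in> carrier A" "s' \<in> denominators" "Y = frac A r' s'" using assms(2) by (rule frac_cases)
  show ?thesis
  proof (rule that)
    show "X = frac A (r \<otimes> s') (s \<otimes> s')" using 1 2 by (simp add: frac_cancel)
    show "Y = frac A (r' \<otimes> s) (s \<otimes> s')" using 1 2 frac_cancel[of r' s' s] by (simp add: m_comm)
  qed (use 1 2 mult_denominators in auto)
qed

lemma frac_mult:
  assumes "r \<in> carrier A" "s \<in> denominators" "r' \<in> carrier A" "s' \<in> denominators"
  shows "frac A r s \<otimes>\<^bsub>frac_dalg A\<^esub> frac A r' s' = frac A (r \<otimes> r') (s \<otimes> s')"
proof -
  have eq: "frac A (a \<otimes> a') (b \<otimes> b') = frac A (r \<otimes> r') (s \<otimes> s')"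
    if ab: "(a, b) \<in> frac A r s" "(a', b') \<in> frac A r' s'" for a b a' b'
  proof -
    have c: "a \<in> carrier A" "b \<in> carrier A" "a' \<in> carrier A" "b' \<in> carrier A" "s \<in> carrier A" "s' \<in> carrier A"
      and e: "r \<otimes> b = a \<otimes> s" "r' \<otimes> b' = a' \<otimes> s'"
      using ab assms by (auto simp: frac_mem_iff)
    have "a \<otimes> a' \<otimes> (s \<otimes> s') = (a \<otimes> s) \<otimes> (a' \<otimes> s')" using c assms by algebra
    also have "\<dots> = r \<otimes> r' \<otimes> (b \<otimes> b')" unfolding e[symmetric] using c assms by algebra
    finally show ?thesis using ab assms c by (subst frac_eq_iff) (auto simp: frac_mem_iff integral_iff)
  qed
  have mem: "(r, s) \<in> frac A r s" "(r', s') \<in> frac A r' s'" using assms by (simp_all add: frac_mem_iff)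
  show ?thesis
    unfolding frac_dalg_def monoid.simps dalg.simps ring.simps
    using eq by (intro UN_eq_const[OF mem(1)]) (auto intro!: UN_eq_const[OF mem(2)])
qed

lemma frac_add:
  assumes "r \<in> carrier A" "s \<in> denominators" "r' \<in> carrier A" "s' \<in> denominators"
  shows "frac A r s \<oplus>\<^bsub>frac_dalg A\<^esub> frac A r' s' = frac A (r \<otimes> s' \<oplus> r' \<otimes> s) (s \<otimes> s')"
proof -
  have eq: "frac A (a \<otimes> b' \<oplus> a' \<otimes> b) (b \<otimes> b') = frac A (r \<otimes> s' \<oplus> r' \<otimes> s) (s \<otimes> s')"
    if ab: "(a, b) \<in> frac A r s" "(a', b') \<in> frac A r' s'" for a b a' b'
  proof -
    have c: "a \<in> carrier A" "b \<in> carrier A" "a' \<in> carrier A" "b' \<in> carrier A" "s \<in> carrier A" "s' \<in> carrier A"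
      and e: "r \<otimes> b = a \<otimes> s" "r' \<otimes> b' = a' \<otimes> s'"
      using ab assms by (auto simp: frac_mem_iff)
    have "(a \<otimes> b' \<oplus> a' \<otimes> b) \<otimes> (s \<otimes> s') = (a \<otimes> s) \<otimes> (b' \<otimes> s') \<oplus> (a' \<otimes> s') \<otimes> (b \<otimes> s)" using c assms by algebra
    also have "\<dots> = (r \<otimes> s' \<oplus> r' \<otimes> s) \<otimes> (b \<otimes> b')" unfolding e[symmetric] using c assms by algebra
    finally show ?thesis using ab assms c by (subst frac_eq_iff) (auto simp: frac_mem_iff integral_iff)
  qed
  have mem: "(r, s) \<in> frac A r s" "(r', s') \<in> frac A r' s'" using assms by (simp_all add: frac_mem_iff)
  show ?thesis
    unfolding frac_dalg_def monoid.simps dalg.simps ring.simps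
    using eq by (intro UN_eq_const[OF mem(1)]) (auto intro!: UN_eq_const[OF mem(2)])
qed

lemma frac_add_same:
  assumes "r \<in> carrier A" "r' \<in> carrier A" "s \<in> denominators"
  shows "frac A r s \<oplus>\<^bsub>frac_dalg A\<^esub> frac A r' s = frac A (r \<oplus> r') s"
proof -
  have "s \<in> carrier A" using assms by simp
  then show ?thesis
    using assms frac_cancel[of "r \<oplus> r'" s s] by (simp add: frac_add l_distr)
qed

text \<open>Independence of the representative: differentiate the cross-multiplied equation
  \<open>r \<otimes> b = a \<otimes> s\<close> and eliminate the mixed terms. The derivatives get
  names so that \<open>algebra\<close> treats them as atoms.\<close>

lemma frac_dact:
  assumes "r \<in> carrier A" "s \<in> denominators"
  shows "dact (frac_dalg A) x (frac A r s) = frac A (dact A x r \<otimes> s \<ominus> r \<otimes> dact A x s) (s \<otimes> s)"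
proof -
  have eq: "frac A (dact A x a \<otimes> b \<ominus> a \<otimes> dact A x b) (b \<otimes> b) = frac A (dact A x r \<otimes> s \<ominus> r \<otimes> dact A x s) (s \<otimes> s)"
    if ab: "(a, b) \<in> frac A r s" for a b
  proof -
    have c [simp]: "a \<in> carrier A" "b \<in> carrier A" "r \<in> carrier A" "s \<in> carrier A"
      and e: "r \<otimes> b = a \<otimes> s" and n: "b \<noteq> \<zero>" "s \<noteq> \<zero>"
      using ab assms by (auto simp: frac_mem_iff)
    define P P' S S' where "P = dact A x r" and "P' = dact A x a" and "S = dact A x s" and "S' = dact A x b"
    have d [simp]: "P \<in> carrier A" "P' \<in> carrier A" "S \<in> carrier A" "S' \<in> carrier A"
      by (simp_all add: P_def P'_def S_def S'_def)
    have e': "P \<otimes> b \<oplus> r \<otimes> S' = P' \<otimes> s \<oplus> a \<otimes> S"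
      using arg_cong[OF e, of "dact A x"] by (simp add: dact_mult P_def P'_def S_def S'_def)
    have "(P \<otimes> s \<ominus> r \<otimes> S) \<otimes> (b \<otimes> b) = (P \<otimes> b) \<otimes> (s \<otimes> b) \<ominus> (r \<otimes> b) \<otimes> (S \<otimes> b)"
      using c d by algebra
    also have "\<dots> = ((P \<otimes> b \<oplus> r \<otimes> S') \<ominus> r \<otimes> S') \<otimes> (s \<otimes> b) \<ominus> (a \<otimes> s) \<otimes> (S \<otimes> b)"
      unfolding e using c d by algebra
    also have "\<dots> = P' \<otimes> s \<otimes> s \<otimes> b \<ominus> (r \<otimes> b) \<otimes> (S' \<otimes> s)"
      unfolding e' using c d by algebra
    also have "\<dots> = (P' \<otimes> b \<ominus> a \<otimes> S') \<otimes> (s \<otimes> s)"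
      unfolding e using c d by algebra
    finally have "(P' \<otimes> b \<ominus> a \<otimes> S') \<otimes> (s \<otimes> s) = (P \<otimes> s \<ominus> r \<otimes> S) \<otimes> (b \<otimes> b)" ..
    then show ?thesis unfolding P_def P'_def S_def S'_def
      by (subst frac_eq_iff) (auto simp: integral_iff n)
  qed
  have mem: "(r, s) \<in> frac A r s" using assms by (simp_all add: frac_mem_iff)
  show ?thesis
    unfolding frac_dalg_def monoid.simps dalg.simps ring.simps
    using eq by (intro UN_eq_const[OF mem]) auto
qed

lemma frac_eq_zero_iff:
  assumes "r \<in> carrier A" "s \<in> denominators"
  shows "frac A r s = \<zero>\<^bsub>frac_dalg A\<^esub> \<longleftrightarrow> r = \<zero>"
  using assms by (simp add: frac_eq_iff) 

lemma frac_zero: "s \<in> denominators \<Longrightarrow> frac A \<zero> s = \<zero>\<^bsub>frac_dalg A\<^esub>"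
  by (subst frac_eq_zero_iff) auto

lemma frac_one: "s \<in> denominators \<Longrightarrow> frac A s s = \<one>\<^bsub>frac_dalg A\<^esub>"
  by (auto simp: frac_eq_iff)

lemma one_denominator: "\<one> \<in> denominators"
  by simp

lemma cring_frac_dalg: "cring (frac_dalg A)"
proof (rule cringI)
  show "abelian_group (frac_dalg A)"
  proof (rule abelian_groupI, goal_cases)
    case (1 X Y)
    then obtain r r' s where "r \<in> carrier A" "r' \<in> carrier A" "s \<in> denominators" "X = frac A r s" "Y = frac A r' s"
      by (rule common_denominator)
    then show ?case by (auto simp: frac_add_same)
  next
    case 2
    show ?case using frac_closed[OF zero_closed one_denominator] by simp
  next
    case (3 X Y Z)
    obtain r s where X: "r \<in> carrier A" "s \<in> denominators" "X = frac A r s" using 3(1) by (rule frac_cases)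
    obtain r' t' t where YZ: "r' \<in> carrier A" "t' \<in> carrier A" "t \<in> denominators" "Y = frac A r' t" "Z = frac A t' t"
      using 3(2,3) by (rule common_denominator)
    have X': "X = frac A (r \<otimes> t) (s \<otimes> t)" using X YZ by (simp add: frac_cancel)
    have Y': "Y = frac A (r' \<otimes> s) (s \<otimes> t)" "Z = frac A (t' \<otimes> s) (s \<otimes> t)"
      using X YZ frac_cancel[of r' t s] frac_cancel[of t' t s] by (simp_all add: m_comm)
    have "s \<otimes> t \<in> denominators" using X YZ mult_denominators by blast
    then show ?case unfolding X' Y' using X YZ by (simp add: frac_add_same a_assoc)
  next
    case (4 X Y)
    then obtain r r' s where "r \<in> carrier A" "r' \<in> carrier A" "s \<in> denominators" "X = frac A r s" "Y = frac A r' s"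
      by (rule common_denominator)
    then show ?case by (simp add: frac_add_same a_comm)
  next
    case (5 X)
    then obtain r s where X: "r \<in> carrier A" "s \<in> denominators" "X = frac A r s" by (rule frac_cases)
    then have "\<zero>\<^bsub>frac_dalg A\<^esub> = frac A \<zero> s" by (simp only: frac_zero)
    then show ?case using X by (simp only: frac_add_same zero_closed l_zero)
  next
    case (6 X)
    then obtain r s where X: "r \<in> carrier A" "s \<in> denominators" "X = frac A r s" by (rule frac_cases)
    have "frac A (\<ominus> r) s \<oplus>\<^bsub>frac_dalg A\<^esub> X = \<zero>\<^bsub>frac_dalg A\<^esub>"
      using X by (simp only: frac_add_same a_inv_closed l_neg frac_zero)
    then show ?case using X by (intro bexI[of _ "frac A (\<ominus> r) s"]) (auto intro: frac_closed)
  qed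
  show "Group.comm_monoid (frac_dalg A)"
  proof (unfold_locales, goal_cases)
    case (1 X Y)
    then show ?case
      by (elim frac_cases) (auto simp: frac_mult integral_iff intro!: frac_closed)
  next
    case (2 X Y Z)
    then show ?case
      by (elim frac_cases) (auto simp: frac_mult m_assoc integral_iff)
  next
    case (6 X Y)
    then show ?case
      by (elim frac_cases) (auto simp: frac_mult m_comm)
  qed (auto simp: frac_mult elim!: frac_cases)
next
  fix X Y Z assume XYZ: "X \<in> carrier (frac_dalg A)" "Y \<in> carrier (frac_dalg A)" "Z \<in> carrier (frac_dalg A)"
  obtain r r' s where XY: "r \<in> carrier A" "r' \<in> carrier A" "s \<in> denominators" "X = frac A r s" "Y = frac A r' s"
    using XYZ(1,2) by (rule common_denominator)
  obtain q t where Z: "q \<in> carrier A" "t \<in> denominators" "Z = frac A q t" using XYZ(3) by (rule frac_cases)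
  have "s \<otimes> t \<in> denominators" using XY Z mult_denominators by blast
  then show "(X \<oplus>\<^bsub>frac_dalg A\<^esub> Y) \<otimes>\<^bsub>frac_dalg A\<^esub> Z =
      X \<otimes>\<^bsub>frac_dalg A\<^esub> Z \<oplus>\<^bsub>frac_dalg A\<^esub> Y \<otimes>\<^bsub>frac_dalg A\<^esub> Z"
    using XY Z by (simp add: frac_add_same frac_mult l_distr)
qed

lemma field_frac_dalg: "field (frac_dalg A)"
proof -
  interpret L: cring "frac_dalg A" by (rule cring_frac_dalg)
  show ?thesis
  proof (rule L.cring_fieldI2)
    show "\<zero>\<^bsub>frac_dalg A\<^esub> \<noteq> \<one>\<^bsub>frac_dalg A\<^esub>"
      using frac_eq_zero_iff[OF one_closed one_denominator] by auto
    fix X assume "X \<in> carrier (frac_dalg A)" and nz: "X \<noteq> \<zero>\<^bsub>frac_dalg A\<^esub>"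
    then obtain r s where X: "r \<in> carrier A" "s \<in> denominators" "X = frac A r s" by (elim frac_cases)
    then have "r \<in> denominators" using nz frac_eq_zero_iff by auto
    then have "X \<otimes>\<^bsub>frac_dalg A\<^esub> frac A s r = frac A (s \<otimes> r) (s \<otimes> r)"
      using X by (simp add: frac_mult m_comm[of r s])
    also have "\<dots> = \<one>\<^bsub>frac_dalg A\<^esub>"
      using X \<open>r \<in> denominators\<close> by (intro frac_one mult_denominators)
    finally have "X \<otimes>\<^bsub>frac_dalg A\<^esub> frac A s r = \<one>\<^bsub>frac_dalg A\<^esub>" .
    moreover have "frac A s r \<in> carrier (frac_dalg A)" using X \<open>r \<in> denominators\<close> by blast
    ultimately show "\<exists>Y\<in>carrier (frac_dalg A). X \<otimes>\<^bsub>frac_dalg A\<^esub> Y = \<one>\<^bsub>frac_dalg A\<^esub>" by blast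
  qed
qed

lemma frac_dact_one:
  assumes "r \<in> carrier A"
  shows "dact (frac_dalg A) x (frac A r \<one>) = frac A (dact A x r) \<one>"
  using assms by (simp add: frac_dact a_minus_def)

lemma operator_algebra_frac_dalg: "operator_algebra F (frac_dalg A)"
proof -
  interpret L: cring "frac_dalg A" by (rule cring_frac_dalg)
  have sub: "r \<otimes> s \<ominus> r' \<otimes> s' \<in> carrier A"
    if "r \<in> carrier A" "s \<in> carrier A" "r' \<in> carrier A" "s' \<in> carrier A" for r s r' s'
    using that by simp
  show ?thesis
  proof (unfold_locales, goal_cases)
    case (5 X x)
    then obtain r s where X: "r \<in> carrier A" "s \<in> denominators" "X = frac A r s" by (elim frac_cases)
    then show ?case
      using mult_denominators[of s s] unfolding X(3) frac_dact[OF X(1,2)] by (intro frac_closed) auto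
  next
    case (6 X Y x)
    then obtain r r' s where XY: "r \<in> carrier A" "r' \<in> carrier A" "s \<in> denominators" "X = frac A r s" "Y = frac A r' s"
      by (rule common_denominator)
    then have c: "s \<in> carrier A" "s \<otimes> s \<in> denominators" using mult_denominators by auto
    have "dact A x (r \<oplus> r') \<otimes> s \<ominus> (r \<oplus> r') \<otimes> dact A x s =
        (dact A x r \<otimes> s \<ominus> r \<otimes> dact A x s) \<oplus> (dact A x r' \<otimes> s \<ominus> r' \<otimes> dact A x s)"
      unfolding dact_add[OF XY(1,2)] using XY(1,2) c(1) dact_closed by algebra
    then show ?case
      unfolding XY(4,5) using XY(1-3) c by (simp add: frac_add_same frac_dact sub)
  next
    case (7 X Y x)
    then obtain r r' s where XY: "r \<in> carrier A" "r' \<in> carrier A" "s \<in> denominators" "X = frac A r s" "Y = frac A r' s"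
      by (rule common_denominator)
    then have c: "s \<in> carrier A" "s \<otimes> s \<in> denominators" "s \<otimes> s \<otimes> s \<in> denominators"
      using mult_denominators by auto
    define P P' S where "P = dact A x r" and "P' = dact A x r'" and "S = dact A x s"
    have d: "P \<in> carrier A" "P' \<in> carrier A" "S \<in> carrier A" using XY(1,2) c by (simp_all add: P_def P'_def S_def)
    have "dact (frac_dalg A) x (X \<otimes>\<^bsub>frac_dalg A\<^esub> Y) =
        frac A ((P \<otimes> r' \<oplus> r \<otimes> P') \<otimes> (s \<otimes> s) \<ominus> r \<otimes> r' \<otimes> (S \<otimes> s \<oplus> s \<otimes> S)) (s \<otimes> s \<otimes> (s \<otimes> s))"
      unfolding XY(4,5) using XY(1-3) c by (simp add: frac_mult frac_dact dact_mult P_def P'_def S_def)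
    also have "(P \<otimes> r' \<oplus> r \<otimes> P') \<otimes> (s \<otimes> s) \<ominus> r \<otimes> r' \<otimes> (S \<otimes> s \<oplus> s \<otimes> S) =
        ((P \<otimes> s \<ominus> r \<otimes> S) \<otimes> r' \<oplus> r \<otimes> (P' \<otimes> s \<ominus> r' \<otimes> S)) \<otimes> s"
      using XY(1,2) c(1) d by algebra
    also have "s \<otimes> s \<otimes> (s \<otimes> s) = s \<otimes> s \<otimes> s \<otimes> s" using c by algebra
    \<comment> \<open>The quotient rule for the product has denominator \<open>s\<close> to the
      fourth power, the right-hand side of the Leibniz rule the third power; one factor
      \<open>s\<close> cancels.\<close>
    also have "frac A (((P \<otimes> s \<ominus> r \<otimes> S) \<otimes> r' \<oplus> r \<otimes> (P' \<otimes> s \<ominus> r' \<otimes> S)) \<otimes> s) (s \<otimes> s \<otimes> s \<otimes> s) =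
        frac A ((P \<otimes> s \<ominus> r \<otimes> S) \<otimes> r' \<oplus> r \<otimes> (P' \<otimes> s \<ominus> r' \<otimes> S)) (s \<otimes> s \<otimes> s)"
      using XY(1-3) c d by (intro frac_cancel) auto
    also have "\<dots> = frac A ((P \<otimes> s \<ominus> r \<otimes> S) \<otimes> r') (s \<otimes> s \<otimes> s) \<oplus>\<^bsub>frac_dalg A\<^esub> frac A (r \<otimes> (P' \<otimes> s \<ominus> r' \<otimes> S)) (s \<otimes> s \<otimes> s)"
      using XY(1-3) c d by (simp add: frac_add_same)
    also have "\<dots> = dact (frac_dalg A) x X \<otimes>\<^bsub>frac_dalg A\<^esub> Y \<oplus>\<^bsub>frac_dalg A\<^esub> X \<otimes>\<^bsub>frac_dalg A\<^esub> dact (frac_dalg A) x Y"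
      unfolding XY(4,5) using XY(1-3) c d by (simp add: frac_dact frac_mult m_assoc P_def P'_def S_def)
    finally show ?case .
  next
    case (8 x c)
    show ?case by (simp add: frac_dact_one dact_alg)
  qed (auto simp: frac_add_same frac_mult alg_add alg_mult)
qed

text \<open>
  Both sides of the bracket law are derivations of the fraction field, so it is enough that they
  agree on the numerator and on the denominator.
\<close>

lemma differential_algebra_frac_dalg: "differential_algebra F (frac_dalg A)"
proof -
  let ?L = "frac_dalg A"
  interpret L: operator_algebra F ?L by (rule operator_algebra_frac_dalg)
  interpret Lf: field ?L by (rule field_frac_dalg)
  show ?thesis
  proof (rule L.differential_algebraI, goal_cases)
    case (1 x y X)
    then obtain r s where X: "r \<in> carrier A" "s \<in> denominators" "X = frac A r s" by (elim frac_cases)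
    then have c: "s \<in> carrier A" "s \<otimes> s \<in> denominators" using mult_denominators by auto
    have "dact A (x + y) r \<otimes> s \<ominus> r \<otimes> dact A (x + y) s =
        (dact A x r \<otimes> s \<ominus> r \<otimes> dact A x s) \<oplus> (dact A y r \<otimes> s \<ominus> r \<otimes> dact A y s)"
      unfolding dact_plus[OF X(1)] dact_plus[OF c(1)] using X(1) c(1) dact_closed by algebra
    then show ?case unfolding X(3) using X(1,2) c by (simp add: frac_dact frac_add_same)
  next
    case (2 a x X)
    then obtain r s where X: "r \<in> carrier A" "s \<in> denominators" "X = frac A r s" by (elim frac_cases)
    then have c: "s \<in> carrier A" "s \<otimes> s \<in> denominators" using mult_denominators by auto
    have "dact A (scl F a x) r \<otimes> s \<ominus> r \<otimes> dact A (scl F a x) s =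
        alg A a \<otimes> (dact A x r \<otimes> s \<ominus> r \<otimes> dact A x s)"
      unfolding dact_scl[OF X(1)] dact_scl[OF c(1)] using X(1) c(1) dact_closed alg_closed by algebra
    then show ?case unfolding X(3) using X(1,2) c by (simp add: frac_dact frac_mult)
  next
    case (3 x y X)
    define b where "b Z = dact ?L (brk F x y) Z" for Z
    define k where "k Z = dact ?L x (dact ?L y Z) \<ominus>\<^bsub>?L\<^esub> dact ?L y (dact ?L x Z)" for Z
    have closed: "b Z \<in> carrier ?L" "k Z \<in> carrier ?L" if "Z \<in> carrier ?L" for Z
      using that unfolding b_def k_def by simp_all
    have b_mult: "b (Z \<otimes>\<^bsub>?L\<^esub> W) = b Z \<otimes>\<^bsub>?L\<^esub> W \<oplus>\<^bsub>?L\<^esub> Z \<otimes>\<^bsub>?L\<^esub> b W"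
      if "Z \<in> carrier ?L" "W \<in> carrier ?L" for Z W
      unfolding b_def using that by (rule L.dact_mult)
    have k_mult: "k (Z \<otimes>\<^bsub>?L\<^esub> W) = k Z \<otimes>\<^bsub>?L\<^esub> W \<oplus>\<^bsub>?L\<^esub> Z \<otimes>\<^bsub>?L\<^esub> k W"
      if "Z \<in> carrier ?L" "W \<in> carrier ?L" for Z W
    proof -
      have d: "dact ?L v Z \<in> carrier ?L" "dact ?L v W \<in> carrier ?L"
        "dact ?L v (dact ?L v' Z) \<in> carrier ?L" "dact ?L v (dact ?L v' W) \<in> carrier ?L" for v v'
        using that by simp_all
      show ?thesis
        unfolding k_def
        by (simp only: L.dact_mult L.dact_add that d L.m_closed) (use that d in \<open>algebra\<close>)
    qed
    have agree: "b (frac A r \<one>) = k (frac A r \<one>)" if "r \<in> carrier A" for r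
    proof -
      have m: "frac A p \<one> \<ominus>\<^bsub>?L\<^esub> frac A q \<one> = frac A (p \<ominus> q) \<one>" if "p \<in> carrier A" "q \<in> carrier A" for p q
      proof -
        have "frac A (p \<ominus> q) \<one> \<oplus>\<^bsub>?L\<^esub> frac A q \<one> = frac A p \<one>"
          using that by (simp add: frac_add_same a_minus_def a_assoc l_neg)
        then show ?thesis using frac_closed[OF _ one_denominator] that
          by (metis L.add.inv_solve_right' L.minus_eq minus_closed)
      qed
      show ?thesis unfolding b_def k_def using that by (simp add: frac_dact_one m dact_brk)
    qed
    obtain r s where X: "r \<in> carrier A" "s \<in> denominators" "X = frac A r s" using 3 by (elim frac_cases)
    let ?S = "frac A s \<one>"
    have S: "?S \<in> carrier ?L" "?S \<noteq> \<zero>\<^bsub>?L\<^esub>" "X \<in> carrier ?L"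
      using X frac_closed[of s \<one>] 3 frac_eq_zero_iff[of s \<one>] by (auto)
    have "X \<otimes>\<^bsub>?L\<^esub> ?S = frac A (r \<otimes> s) (\<one> \<otimes> s)" using X by (simp add: frac_mult)
    then have XS: "X \<otimes>\<^bsub>?L\<^esub> ?S = frac A r \<one>" using X by (simp only: frac_cancel one_denominator)
    have "b X \<otimes>\<^bsub>?L\<^esub> ?S \<oplus>\<^bsub>?L\<^esub> X \<otimes>\<^bsub>?L\<^esub> b ?S = k X \<otimes>\<^bsub>?L\<^esub> ?S \<oplus>\<^bsub>?L\<^esub> X \<otimes>\<^bsub>?L\<^esub> b ?S"
      using b_mult[OF S(3,1)] k_mult[OF S(3,1)] agree[OF X(1)] agree[of s] X(2) unfolding XS by simp
    then have "b X \<otimes>\<^bsub>?L\<^esub> ?S = k X \<otimes>\<^bsub>?L\<^esub> ?S"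
      using S(1,3) closed by (metis L.add.right_cancel L.m_closed)
    then have "b X = k X" using S closed by (metis Lf.m_rcancel)
    then show ?case by (simp add: b_def k_def)
  qed
qed

lemma frac_constant_iff:
  assumes "r \<in> carrier A" "s \<in> denominators"
  shows "dact (frac_dalg A) x (frac A r s) = \<zero>\<^bsub>frac_dalg A\<^esub> \<longleftrightarrow> dact A x r \<otimes> s = r \<otimes> dact A x s"
  using assms mult_denominators[of s s] unfolding frac_dact[OF assms]
  by (subst frac_eq_zero_iff) auto

end


section \<open>Parameterized fields with one parametric derivation\<close>

lemma lookup_tensor_scl [simp]: "Poly_Mapping.lookup (tensor_scl c p) x = c * Poly_Mapping.lookup p x"
  by (simp add: tensor_scl_def Poly_Mapping.map.rep_eq when_def)

lemma tensor_scl_single: "tensor_scl c (Poly_Mapping.single x b) = Poly_Mapping.single x (c * b)"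
  by (rule poly_mapping_eqI) (simp add: lookup_single when_def)

interpretation tensor: Modules.module tensor_scl
  by unfold_locales (auto intro!: poly_mapping_eqI simp: lookup_add algebra_simps)

context differential_field
begin

lemma scl_add_right: "scl F c (x + y) = scl F c x + scl F c y"
  and scl_add_left: "scl F (b + c) x = scl F b x + scl F c x"
  and scl_scl: "scl F b (scl F c x) = scl F (b * c) x"
  and scl_one: "scl F 1 x = x"
  using vector_space by (simp_all add: vector_space_def)

lemma scl_zero: "scl F 0 x = 0"
  using scl_add_left[of 0 0 x] by simp

lemma scl_zero_right [simp]: "scl F c 0 = 0"
  using scl_add_right[of c 0 0] by simp

lemma act_zero_right [simp]: "act F x 0 = 0"
  and act_diff: "act F x (a - b) = act F x a - act F x b"
  and act_one [simp]: "act F x 1 = 0"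
  and act_sum: "act F x (sum f A) = (\<Sum>i\<in>A. act F x (f i))"
  using ring_derivation.zero[OF act_derivation] ring_derivation.diff[OF act_derivation]
    ring_derivation.one[OF act_derivation] ring_derivation.sum[OF act_derivation] by metis+

lemma brk_antisym: "brk F x y = - brk F y x"
  using brk_self[of "x + y"] unfolding brk_add_left brk_add_right
  by (simp add: brk_self eq_neg_iff_add_eq_0 add.commute)

lemma brk_uminus_right: "brk F x (- y) = - brk F x y"
proof -
  have "brk F x 0 = 0" using brk_add_right[of x 0 0] by simp
  then show ?thesis using brk_add_right[of x y "- y"] by (simp add: eq_neg_iff_add_eq_0 add.commute)
qed

end

locale ordinary_parameterized_field = parameterized_differential_field P
  for P :: "('k::field_char_0, 'dk::ab_group_add, 'K::field_char_0, 'dK::ab_group_add) pdfield" +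
  fixes dt :: 'dk
  assumes dt_nonzero: "dt \<noteq> 0" and dt_span: "range (\<lambda>c. scl (base_fld P) c dt) = UNIV"
begin

abbreviation "k \<equiv> base_fld P"
abbreviation "K \<equiv> ext_fld P"

lemma emb_zero [simp]: "emb P 0 = 0"
  using emb_add[of 0 0] by simp

lemma emb_eq_0_iff [simp]: "emb P c = 0 \<longleftrightarrow> c = 0"
proof
  assume "emb P c = 0"
  then show "c = 0" using emb_mult[of c "inverse c"] emb_one by (cases "c = 0") auto
qed simp

definition coord :: "'dk \<Rightarrow> 'k" where
  "coord y = (SOME c. scl k c dt = y)"

lemma scl_coord: "scl k (coord y) dt = y"
proof -
  have "\<exists>c. scl k c dt = y" using dt_span by (metis UNIV_I imageE)
  then show ?thesis unfolding coord_def by (rule someI_ex)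
qed

lemma coord_scl_dt: "coord (scl k c dt) = c"
proof (rule ccontr)
  let ?b = "coord (scl k c dt)"
  assume "?b \<noteq> c"
  have "scl k (?b - c) dt + scl k c dt = scl k c dt"
    unfolding base.scl_add_left[symmetric] by (simp add: scl_coord)
  then have "scl k (inverse (?b - c)) (scl k (?b - c) dt) = scl k (inverse (?b - c)) (scl k 0 dt)"
    by (simp add: base.scl_zero)
  then have "dt = 0" using \<open>?b \<noteq> c\<close> by (simp add: base.scl_scl base.scl_one base.scl_zero)
  then show False using dt_nonzero by simp
qed

lemma coord_add: "coord (x + y) = coord x + coord y"
  by (metis base.scl_add_left coord_scl_dt scl_coord)

lemma coord_scl: "coord (scl k c x) = c * coord x"
  by (metis base.scl_scl coord_scl_dt scl_coord)

lemma coord_dt: "coord dt = 1"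
  by (metis base.scl_one coord_scl_dt)

text \<open>The coordinate isomorphism of the tensor product with K, which sends b \<otimes> c dt to
  b c, on representatives. By \<open>tensor_null_iff\<close> its kernel is the space of relations,
  so equality of cosets becomes equality in K.\<close>

definition tensor_coord :: "('dk \<Rightarrow>\<^sub>0 'K) \<Rightarrow> 'K" where
  "tensor_coord p = (\<Sum>y\<in>Poly_Mapping.keys p. Poly_Mapping.lookup p y * emb P (coord y))"

lemma tensor_coord_add: "tensor_coord (p + q) = tensor_coord p + tensor_coord q"
  unfolding tensor_coord_def by (rule setsum_keys_plus_distrib) (simp_all add: algebra_simps)

lemma tensor_coord_single: "tensor_coord (Poly_Mapping.single y b) = b * emb P (coord y)"
  by (simp add: tensor_coord_def)

lemma tensor_coord_diff: "tensor_coord (p - q) = tensor_coord p - tensor_coord q"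
  using tensor_coord_add[of "p - q" q] by simp

lemma tensor_coord_scl: "tensor_coord (tensor_scl c p) = c * tensor_coord p"
  by (induction p rule: poly_mapping_single_induct)
    (simp_all add: tensor_scl_single tensor_coord_single tensor_coord_add tensor.scale_right_distrib algebra_simps)

lemma tensor_null_subspace: "tensor.subspace (tensor_null P)"
  unfolding tensor_null_def by (rule tensor.subspace_span)

lemma tensor_coord_null:
  assumes "p \<in> tensor_null P"
  shows "tensor_coord p = 0"
proof -
  have "tensor_null P \<subseteq> {p. tensor_coord p = 0}"
    unfolding tensor_null_def
  proof (rule tensor.span_minimal)
    show "tensor.subspace {p. tensor_coord p = 0}"
      by (rule tensor.subspaceI) (simp_all add: tensor_coord_add tensor_coord_scl, simp add: tensor_coord_def)
  qed (auto simp: tensor_coord_diff tensor_coord_single coord_add coord_scl emb_add emb_mult emb_one)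
  then show ?thesis using assms by blast
qed

lemma tensor_normal_form: "p - Poly_Mapping.single dt (tensor_coord p) \<in> tensor_null P"
proof (induction p rule: poly_mapping_single_induct)
  case (single y b)
  have "Poly_Mapping.single (scl k (coord y) dt) 1 - Poly_Mapping.single dt (emb P (coord y)) \<in> tensor_null P"
    unfolding tensor_null_def by (rule tensor.span_base) auto
  from tensor.subspace_scale[OF tensor_null_subspace this, of b] show ?case
    by (simp add: tensor_coord_single tensor.scale_right_diff_distrib tensor_scl_single scl_coord)
next
  case (add p q)
  from tensor.subspace_add[OF tensor_null_subspace this] show ?case
    by (simp add: tensor_coord_add single_add algebra_simps)
qed

lemma tensor_null_iff: "p \<in> tensor_null P \<longleftrightarrow> tensor_coord p = 0"
  using tensor_normal_form[of p] tensor_coord_null[of p] by auto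

lemma tensor_class_iff: "q \<in> tensor_class P p \<longleftrightarrow> tensor_coord q = tensor_coord p"
  by (simp add: tensor_class_def tensor_null_iff tensor_coord_diff)

text \<open>The form \<open>dt\<close> dual to the parametric derivation, pulled back to \<open>D_K\<close>.\<close>

definition \<tau> :: "'dK \<Rightarrow> 'K" where
  "\<tau> x = tensor_coord (SOME p. p \<in> str P x)"

lemma str_eq_class: "\<exists>p. str P x = tensor_class P p"
  using str_surj by (metis UNIV_I imageE image_eqI)

lemma str_iff: "p \<in> str P x \<longleftrightarrow> tensor_coord p = \<tau> x"
proof -
  obtain q where q: "str P x = tensor_class P q" using str_eq_class by blast
  then have "q \<in> str P x" by (simp add: tensor_class_iff)
  then have "(SOME p. p \<in> str P x) \<in> str P x" by (rule someI)
  then show ?thesis unfolding \<tau>_def q tensor_class_iff by simp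
qed

lemma tensor_coord_rep: "tensor_coord (Poly_Mapping.single dt b) = b"
  by (simp add: tensor_coord_single coord_dt emb_one)

lemma \<tau>_add: "\<tau> (x + y) = \<tau> x + \<tau> y"
  using str_add[of "Poly_Mapping.single dt (\<tau> x)" x "Poly_Mapping.single dt (\<tau> y)" y]
  by (simp add: str_iff tensor_coord_rep tensor_coord_add)

lemma \<tau>_scl: "\<tau> (scl K c x) = c * \<tau> x"
  using str_scl[of "Poly_Mapping.single dt (\<tau> x)" x c]
  by (simp add: str_iff tensor_coord_rep tensor_coord_scl)

lemma \<tau>_diff: "\<tau> (x - y) = \<tau> x - \<tau> y"
  using \<tau>_add[of "x - y" y] by simp

lemma rel_der_iff: "x \<in> rel_der P \<longleftrightarrow> \<tau> x = 0"
proof -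
  have "str P x = tensor_class P 0 \<longleftrightarrow> (\<forall>p. tensor_coord p = \<tau> x \<longleftrightarrow> tensor_coord p = 0)"
    by (auto simp: set_eq_iff str_iff tensor_class_iff tensor_coord_def[of 0])
  also have "\<dots> \<longleftrightarrow> \<tau> x = 0" using tensor_coord_rep by metis
  finally show ?thesis by (simp add: rel_der_def)
qed

lemma lift_iff: "str P x = pure_tensor P 1 dt \<longleftrightarrow> \<tau> x = 1"
proof -
  have "str P x = pure_tensor P 1 dt \<longleftrightarrow> (\<forall>p. tensor_coord p = \<tau> x \<longleftrightarrow> tensor_coord p = 1)"
    by (auto simp: set_eq_iff str_iff pure_tensor_def tensor_class_iff tensor_coord_rep)
  also have "\<dots> \<longleftrightarrow> \<tau> x = 1" using tensor_coord_rep by metis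
  finally show ?thesis .
qed

lemma ex_lift: "\<exists>x. str P x = pure_tensor P 1 dt"
  unfolding pure_tensor_def using str_surj by (metis UNIV_I image_iff)

text \<open>This is d \<tau> = 0. The coordinate form on the one-dimensional space D_k is closed,
  \<tau> is its pullback to D_K, and pullback commutes with d. The existence of a connection on
  relative forms rests on this identity.\<close>

lemma \<tau>_brk: "\<tau> (brk K x y) = act K x (\<tau> y) - act K y (\<tau> x)"
proof -
  define \<eta> where "\<eta> xs = (if length xs = 1 then coord (hd xs) else 0)" for xs
  have form: "\<eta> \<in> forms k UNIV 1"
    unfolding forms_def by (auto simp: \<eta>_def coord_add coord_scl length_Suc_conv)
  have closed: "de_rham k UNIV \<eta> [v, w] = 0" for v w
  proof -
    obtain a b where v: "v = scl k a dt" and w: "w = scl k b dt" by (metis scl_coord)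
    have "brk k v w = scl k (act k v b) dt + scl k b (brk k v dt)"
      unfolding w base.brk_scl by (simp add: add.commute)
    also have "brk k v dt = - scl k (act k dt a) dt"
      unfolding base.brk_antisym[of v] unfolding v base.brk_scl base.brk_self
      using base.scl_add_right[of a 0 0] by simp
    finally have "coord (brk k v w) = a * act k dt b + coord (scl k b (- scl k (act k dt a) dt))"
      by (simp add: coord_add coord_scl_dt v base.act_scl)
    moreover have "coord (- y) = - coord y" for y
      using coord_add[of y "- y"] coord_scl[of 0 dt] by (simp add: base.scl_zero eq_neg_iff_add_eq_0 add.commute)
    ultimately have "coord (brk k v w) = a * act k dt b - b * act k dt a"
      by (simp add: coord_scl coord_dt)
    then show ?thesis by (simp add: de_rham_form1 \<eta>_def v w coord_scl_dt base.act_scl)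
  qed
  have "induced_form P (de_rham k UNIV \<eta>) [x, y] = 0"
    by (simp add: induced_form_def contract_def closed)
  then have "de_rham K UNIV (induced_form P \<eta>) [x, y] = 0"
    by (simp add: induced_de_rham[OF form])
  moreover have "induced_form P \<eta> [z] = \<tau> z" for z
    by (simp add: induced_form_def contract_def \<eta>_def \<tau>_def tensor_coord_def)
  ultimately show ?thesis by (simp add: de_rham_form1)
qed

end

section \<open>Relative 1-forms\<close>

lemma length_nths_remove:
  assumes "finite A" "A \<subseteq> {..<length xs}"
  shows "length (nths xs (- A)) = length xs - card A"
proof -
  have "{i. i < length xs \<and> i \<in> - A} = {..<length xs} - A" by auto
  then show ?thesis using assms by (simp add: length_nths card_Diff_subset)
qed

text \<open>Forms are total functions on lists, so an equality of forms must also be checked on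
  lists of the wrong length.\<close>

lemma (in differential_field) de_rham_degree:
  assumes "\<And>xs. length xs \<noteq> p \<Longrightarrow> \<omega> xs = 0" "length xs \<noteq> Suc p"
  shows "de_rham F S \<omega> xs = 0"
proof -
  have "length (nths xs (- {i})) \<noteq> p" if "i < length xs" for i
    using length_nths_remove[of "{i}" xs] that assms(2) by simp
  moreover have "length (brk F x y # nths xs (- {i, j})) \<noteq> p" if "i < length xs" "j \<in> {i<..<length xs}" for i j x y
    using length_nths_remove[of "{i, j}" xs] that assms(2) by auto
  ultimately show ?thesis by (simp add: de_rham_def restrict_form_def assms(1))
qed

text \<open>In Cartan's formula the derivative of \<open>\<omega> [x]\<close> along \<open>y\<close>
  occurs twice, in d of the contraction and in the contraction of d, with opposite signs.\<close>

lemma (in differential_field) lie_der_form1: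
  assumes "\<And>xs. length xs \<noteq> 1 \<Longrightarrow> \<omega> xs = 0"
  shows "lie_der F x \<omega> [y] = act F x (\<omega> [y]) - \<omega> [brk F x y]"
    and "length xs \<noteq> 1 \<Longrightarrow> lie_der F x \<omega> xs = 0"
proof -
  have contract: "contract x \<omega> = form0 (\<omega> [x])"
    by (rule ext) (simp add: contract_def form0_def assms)
  show "lie_der F x \<omega> [y] = act F x (\<omega> [y]) - \<omega> [brk F x y]"
    unfolding lie_der_def contract by (simp add: de_rham_form0 contract_def de_rham_form1)
  assume "length xs \<noteq> 1"
  then have "de_rham F UNIV (form0 (\<omega> [x])) xs = 0" "de_rham F UNIV \<omega> (x # xs) = 0"
    using de_rham_degree[of 0 "form0 (\<omega> [x])" xs UNIV] de_rham_degree[of 1 \<omega> "x # xs" UNIV] assms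
    by (simp_all add: form0_def)
  then show "lie_der F x \<omega> xs = 0" unfolding lie_der_def contract by (simp add: contract_def)
qed

section \<open>Forms on D_{K/k} and the Lie derivative along a lift\<close>

context ordinary_parameterized_field
begin

text \<open>The bracket claims come from \<open>\<tau>_brk\<close>: on \<open>brk K u x\<close> the
  form \<tau> takes the value u(0) - x(1) = 0. The last claim is the projection to D_{K/k} along
  \<open>u\<close>.\<close>

lemma rel_der_add: "x \<in> rel_der P \<Longrightarrow> y \<in> rel_der P \<Longrightarrow> x + y \<in> rel_der P"
  and rel_der_scl: "x \<in> rel_der P \<Longrightarrow> scl K c x \<in> rel_der P"
  and rel_der_brk: "x \<in> rel_der P \<Longrightarrow> y \<in> rel_der P \<Longrightarrow> brk K x y \<in> rel_der P"
  and rel_der_brk_lift: "\<tau> u = 1 \<Longrightarrow> x \<in> rel_der P \<Longrightarrow> brk K u x \<in> rel_der P"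
  and rel_der_diff_lift: "\<tau> u = 1 \<Longrightarrow> x - scl K (\<tau> x) u \<in> rel_der P"
  by (simp_all add: rel_der_iff \<tau>_add \<tau>_scl \<tau>_brk \<tau>_diff)

lemma forms1_iff:
  "\<omega> \<in> forms K S 1 \<longleftrightarrow> (\<forall>xs. (\<forall>x\<in>S. xs \<noteq> [x]) \<longrightarrow> \<omega> xs = 0) \<and>
     (\<forall>x\<in>S. \<forall>y\<in>S. \<forall>c. \<omega> [x + scl K c y] = \<omega> [x] + c * \<omega> [y])"
proof -
  have "(length xs = 1 \<and> set xs \<subseteq> S) \<longleftrightarrow> (\<exists>x\<in>S. xs = [x])" for xs by (auto simp: length_Suc_conv)
  moreover have "\<omega> xs = 0" if "\<not> distinct xs" "\<And>xs. (\<forall>x\<in>S. xs \<noteq> [x]) \<longrightarrow> \<omega> xs = 0" for xs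
  proof -
    have "\<forall>x\<in>S. xs \<noteq> [x]" using that(1) by auto
    then show ?thesis using that(2) by blast
  qed
  ultimately show ?thesis unfolding forms_def by auto
qed

lemma rel_form1_zero: "\<omega> \<in> rel_forms P 1 \<Longrightarrow> \<forall>x\<in>rel_der P. xs \<noteq> [x] \<Longrightarrow> \<omega> xs = 0"
  and rel_form1_linear: "\<omega> \<in> rel_forms P 1 \<Longrightarrow> x \<in> rel_der P \<Longrightarrow> y \<in> rel_der P \<Longrightarrow>
    \<omega> [x + scl K c y] = \<omega> [x] + c * \<omega> [y]"
  unfolding rel_forms_def forms1_iff by auto

lemma rel_form1_add:
  assumes "\<omega> \<in> rel_forms P 1" "x \<in> rel_der P" "y \<in> rel_der P"
  shows "\<omega> [x + y] = \<omega> [x] + \<omega> [y]"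
  using rel_form1_linear[OF assms, of 1] by (simp add: ext.scl_one)

lemma rel_form1_scl:
  assumes "\<omega> \<in> rel_forms P 1" "y \<in> rel_der P"
  shows "\<omega> [scl K c y] = c * \<omega> [y]"
proof -
  have z: "0 \<in> rel_der P" using rel_der_scl[OF assms(2), of 0] by (simp add: ext.scl_zero)
  have "\<omega> [0] = 0" using rel_form1_add[OF assms(1) z z] by simp
  then show ?thesis using rel_form1_linear[OF assms(1) z assms(2), of c] by simp
qed

lemma rel_form1_eqI:
  assumes "\<omega> \<in> rel_forms P 1" "\<omega>' \<in> rel_forms P 1" "\<And>x. x \<in> rel_der P \<Longrightarrow> \<omega> [x] = \<omega>' [x]"
  shows "\<omega> = \<omega>'"
proof
  show "\<omega> xs = \<omega>' xs" for xs
    using assms rel_form1_zero[OF assms(1), of xs] rel_form1_zero[OF assms(2), of xs] by metis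
qed

text \<open>\<open>rel_lie\<close> chooses an arbitrary extension of the relative form. The choice
  is invisible because \<open>brk K u x\<close> stays in D_{K/k}, where all extensions agree; only
  the existence of one has to be shown.\<close>

lemma rel_lie_eq:
  assumes \<omega>: "\<omega> \<in> rel_forms P 1" and u: "\<tau> u = 1"
  shows "rel_lie P u \<omega> = (\<lambda>xs. if \<exists>x\<in>rel_der P. xs = [x] then act K u (\<omega> xs) - \<omega> [brk K u (hd xs)] else 0)"
proof -
  let ?Q = "\<lambda>\<eta>. \<eta> \<in> forms K UNIV 1 \<and> restrict_form (rel_der P) \<eta> = \<omega>"
  \<comment> \<open>The extension that vanishes on the lift \<open>u\<close>.\<close>
  define \<eta> where "\<eta> xs = (if length xs = 1 then \<omega> [hd xs - scl K (\<tau> (hd xs)) u] else 0)" for xs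
  have "\<eta> [x + scl K c y] = \<eta> [x] + c * \<eta> [y]" for x y c
  proof -
    have \<eta>: "\<eta> [z] = \<omega> [z - scl K (\<tau> z) u]" for z by (simp add: \<eta>_def)
    have eq: "x + scl K c y - scl K (\<tau> (x + scl K c y)) u = (x - scl K (\<tau> x) u) + scl K c (y - scl K (\<tau> y) u)"
    proof -
      have "scl K c y = scl K c (y - scl K (\<tau> y) u) + scl K (c * \<tau> y) u"
        using ext.scl_add_right[of c "y - scl K (\<tau> y) u" "scl K (\<tau> y) u"] by (simp add: ext.scl_scl)
      moreover have "scl K (\<tau> (x + scl K c y)) u = scl K (\<tau> x) u + scl K (c * \<tau> y) u"
        by (simp add: \<tau>_add \<tau>_scl ext.scl_add_left)
      ultimately show ?thesis by simp
    qed
    show ?thesis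
      unfolding \<eta> eq by (intro rel_form1_linear[OF \<omega>] rel_der_diff_lift u)
  qed
  then have "\<eta> \<in> forms K UNIV 1" unfolding forms1_iff by (auto simp: \<eta>_def length_Suc_conv)
  moreover have "restrict_form (rel_der P) \<eta> xs = \<omega> xs" for xs
  proof (cases "\<exists>x\<in>rel_der P. xs = [x]")
    case True
    then show ?thesis by (auto simp: restrict_form_def \<eta>_def rel_der_iff ext.scl_zero)
  next
    case False
    then have "restrict_form (rel_der P) \<eta> xs = 0" by (auto simp: restrict_form_def \<eta>_def length_Suc_conv)
    then show ?thesis using False rel_form1_zero[OF \<omega>] by metis
  qed
  ultimately have "?Q \<eta>" by blast
  then have Q: "?Q (SOME \<eta>. ?Q \<eta>)" by (rule someI[of ?Q])
  define \<theta> where "\<theta> = (SOME \<eta>. ?Q \<eta>)"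
  have \<theta>: "\<theta> \<in> forms K UNIV 1" "restrict_form (rel_der P) \<theta> = \<omega>" using Q by (auto simp: \<theta>_def)
  have deg: "\<theta> xs = 0" if "length xs \<noteq> 1" for xs
    using \<theta>(1) that unfolding forms1_iff by (auto simp: length_Suc_conv)
  have val: "\<theta> [x] = \<omega> [x]" if "x \<in> rel_der P" for x
    using that unfolding \<theta>(2)[symmetric] by (simp add: restrict_form_def)
  show ?thesis
  proof
    fix xs
    show "rel_lie P u \<omega> xs = (if \<exists>x\<in>rel_der P. xs = [x] then act K u (\<omega> xs) - \<omega> [brk K u (hd xs)] else 0)"
    proof (cases "\<exists>x\<in>rel_der P. xs = [x]")
      case True
      then obtain x where "x \<in> rel_der P" "xs = [x]" by blast
      then show ?thesis unfolding rel_lie_def \<theta>_def[symmetric]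
        using ext.lie_der_form1(1)[of \<theta>, OF deg] by (simp add: restrict_form_def val rel_der_brk_lift u)
    next
      case False
      then have "length xs \<noteq> 1 \<or> \<not> set xs \<subseteq> rel_der P" by (auto simp: length_Suc_conv)
      then show ?thesis unfolding rel_lie_def \<theta>_def[symmetric]
        using ext.lie_der_form1(2)[of \<theta>, OF deg] False by (auto simp: restrict_form_def)
    qed
  qed
qed

lemma rel_lie_apply:
  "\<omega> \<in> rel_forms P 1 \<Longrightarrow> \<tau> u = 1 \<Longrightarrow> x \<in> rel_der P \<Longrightarrow> rel_lie P u \<omega> [x] = act K u (\<omega> [x]) - \<omega> [brk K u x]"
  by (simp add: rel_lie_eq)

text \<open>For K-linearity, the term u(c) \<omega>(y) of the product rule cancels against the one
  from [u, c y] = c [u, y] + u(c) y.\<close>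

lemma rel_lie_form1:
  assumes \<omega>: "\<omega> \<in> rel_forms P 1" and u: "\<tau> u = 1"
  shows "rel_lie P u \<omega> \<in> rel_forms P 1"
proof -
  have "rel_lie P u \<omega> [x + scl K c y] = rel_lie P u \<omega> [x] + c * rel_lie P u \<omega> [y]"
    if x: "x \<in> rel_der P" and y: "y \<in> rel_der P" for x y c
  proof -
    have brk: "brk K u (x + scl K c y) = brk K u x + (scl K c (brk K u y) + scl K (act K u c) y)"
      by (simp add: ext.brk_add_right ext.brk_scl)
    have "\<omega> [brk K u (x + scl K c y)] = \<omega> [brk K u x] + (c * \<omega> [brk K u y] + act K u c * \<omega> [y])"
      unfolding brk using x y u
      by (simp add: rel_form1_add[OF \<omega>] rel_form1_scl[OF \<omega>] rel_der_add rel_der_scl rel_der_brk_lift)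
    then show ?thesis
      using x y by (simp add: rel_lie_apply[OF \<omega> u] rel_der_add rel_der_scl rel_form1_linear[OF \<omega>]
        ext.act_add ext.act_mult algebra_simps)
  qed
  then show ?thesis unfolding rel_forms_def forms1_iff by (auto simp: rel_lie_eq[OF \<omega> u])
qed

section \<open>Closed and exact relative 1-forms\<close>

lemma closed_forms1_iff:
  "\<omega> \<in> closed_forms1 P \<longleftrightarrow> \<omega> \<in> rel_forms P 1 \<and>
    (\<forall>x\<in>rel_der P. \<forall>y\<in>rel_der P. \<omega> [brk K x y] = act K x (\<omega> [y]) - act K y (\<omega> [x]))"
proof -
  have "rel_de_rham P \<omega> = (\<lambda>_. 0) \<longleftrightarrow>
    (\<forall>x\<in>rel_der P. \<forall>y\<in>rel_der P. \<omega> [brk K x y] = act K x (\<omega> [y]) - act K y (\<omega> [x]))"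
    if \<omega>: "\<omega> \<in> rel_forms P 1"
  proof
    assume "rel_de_rham P \<omega> = (\<lambda>_. 0)"
    then show "\<forall>x\<in>rel_der P. \<forall>y\<in>rel_der P. \<omega> [brk K x y] = act K x (\<omega> [y]) - act K y (\<omega> [x])"
      using de_rham_form1[of _ "rel_der P" _ K \<omega>] by (simp add: rel_de_rham_def)
  next
    assume *: "\<forall>x\<in>rel_der P. \<forall>y\<in>rel_der P. \<omega> [brk K x y] = act K x (\<omega> [y]) - act K y (\<omega> [x])"
    have deg: "\<omega> xs = 0" if "length xs \<noteq> 1" for xs
      using that by (intro rel_form1_zero[OF \<omega>]) auto
    show "rel_de_rham P \<omega> = (\<lambda>_. 0)"
    proof
      fix xs
      show "rel_de_rham P \<omega> xs = 0"
      proof (cases "length xs = 2")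
        case True
        then obtain x y where xs: "xs = [x, y]" by (auto simp: numeral_2_eq_2 length_Suc_conv)
        show ?thesis
        proof (cases "x \<in> rel_der P \<and> y \<in> rel_der P")
          case True
          then show ?thesis using * by (simp add: rel_de_rham_def xs de_rham_form1)
        next
          case False
          then show ?thesis by (auto simp: rel_de_rham_def xs de_rham_def restrict_form_def)
        qed
      next
        case False
        then show ?thesis using ext.de_rham_degree[of 1 \<omega> xs, OF deg] by (simp add: rel_de_rham_def)
      qed
    qed
  qed
  then show ?thesis by (auto simp: closed_forms1_def)
qed

lemma closed_form1: "\<omega> \<in> closed_forms1 P \<Longrightarrow> \<omega> \<in> rel_forms P 1"
  by (simp add: closed_forms1_def)

text \<open>By the Jacobi identity the bracket with \<open>u\<close> is a derivation of the bracket
  on D_{K/k}; this is what makes the Lie derivative commute with d here.\<close>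

lemma rel_lie_closed:
  assumes \<omega>: "\<omega> \<in> closed_forms1 P" and u: "\<tau> u = 1"
  shows "rel_lie P u \<omega> \<in> closed_forms1 P"
proof -
  note f = closed_form1[OF \<omega>]
  have cl: "\<omega> [brk K x y] = act K x (\<omega> [y]) - act K y (\<omega> [x])" if "x \<in> rel_der P" "y \<in> rel_der P" for x y
    using \<omega> that by (simp add: closed_forms1_iff)
  have "rel_lie P u \<omega> [brk K x y] = act K x (rel_lie P u \<omega> [y]) - act K y (rel_lie P u \<omega> [x])"
    if x: "x \<in> rel_der P" and y: "y \<in> rel_der P" for x y
  proof -
    note b = rel_der_brk_lift[OF u x] rel_der_brk_lift[OF u y]
    have "brk K u (brk K x y) = brk K (brk K u x) y + brk K x (brk K u y)"
    proof -
      have "brk K x (brk K y u) = - brk K x (brk K u y)"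
        by (simp only: ext.brk_antisym[of y u] ext.brk_uminus_right)
      moreover have "brk K y (brk K u x) = - brk K (brk K u x) y" by (rule ext.brk_antisym)
      ultimately show ?thesis using ext.jacobi[of u x y] by (simp add: algebra_simps)
    qed
    then have "\<omega> [brk K u (brk K x y)] = \<omega> [brk K (brk K u x) y] + \<omega> [brk K x (brk K u y)]"
      using x y b by (simp add: rel_form1_add[OF f] rel_der_brk)
    then show ?thesis using x y b
      by (simp add: rel_lie_apply[OF f u] rel_der_brk cl ext.act_diff ext.act_brk)
  qed
  then show ?thesis unfolding closed_forms1_iff using rel_lie_form1[OF f u] by blast
qed

abbreviation exact :: "'K \<Rightarrow> 'dK list \<Rightarrow> 'K" where
  "exact f \<equiv> rel_de_rham P (form0 f)"

lemma exact_apply: "x \<in> rel_der P \<Longrightarrow> exact f [x] = act K x f"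
  by (simp add: rel_de_rham_def de_rham_form0)

lemma exact_eq: "exact f xs = (if \<exists>x\<in>rel_der P. xs = [x] then act K (hd xs) f else 0)"
proof (cases "length xs = 1")
  case True
  then obtain x where x: "xs = [x]" by (auto simp: length_Suc_conv)
  show ?thesis
  proof (cases "x \<in> rel_der P")
    case False
    then show ?thesis by (simp add: x rel_de_rham_def de_rham_def restrict_form_def)
  qed (simp add: x exact_apply)
next
  case False
  then have "exact f xs = 0"
    using ext.de_rham_degree[of 0 "form0 f" xs] by (simp add: rel_de_rham_def form0_def)
  then show ?thesis using False by auto
qed

lemma exact_add: "exact (f + g) xs = exact f xs + exact g xs"
  and exact_diff: "exact (f - g) xs = exact f xs - exact g xs"
  and exact_0 [simp]: "exact 0 xs = 0"
  by (auto simp: exact_eq ext.act_add ext.act_diff)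

lemma act_emb: "x \<in> rel_der P \<Longrightarrow> act K x (emb P c) = 0"
  using rel_constants by blast

lemma exact_emb: "exact (emb P c * f) xs = emb P c * exact f xs"
  by (auto simp: exact_eq ext.act_mult act_emb)

lemma exact_sum: "exact (\<Sum>i\<in>A. g i) xs = (\<Sum>i\<in>A. exact (g i) xs)"
  by (induction A rule: infinite_finite_induct) (simp_all add: exact_add)

lemma exact_closed: "exact f \<in> closed_forms1 P"
  unfolding closed_forms1_iff rel_forms_def forms1_iff
  by (auto simp: exact_apply rel_der_add rel_der_scl rel_der_brk ext.act_plus ext.act_scl ext.act_brk)
    (simp add: exact_eq)

lemma closed_forms1_combination:
  assumes "\<And>i. i \<in> A \<Longrightarrow> \<eta> i \<in> closed_forms1 P"
  shows "(\<lambda>xs. \<Sum>i\<in>A. emb P (c i) * \<eta> i xs) \<in> closed_forms1 P"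
proof -
  have "(\<lambda>xs. \<Sum>i\<in>A. emb P (c i) * \<eta> i xs) \<in> rel_forms P 1"
    using assms unfolding closed_forms1_iff rel_forms_def forms1_iff
    by (auto simp: sum.distrib sum_distrib_left algebra_simps)
  moreover have "(\<Sum>i\<in>A. emb P (c i) * \<eta> i [brk K x y]) =
      act K x (\<Sum>i\<in>A. emb P (c i) * \<eta> i [y]) - act K y (\<Sum>i\<in>A. emb P (c i) * \<eta> i [x])"
    if "x \<in> rel_der P" "y \<in> rel_der P" for x y
    using assms that unfolding closed_forms1_iff
    by (simp add: ext.act_sum ext.act_mult act_emb sum_subtractf right_diff_distrib)
  ultimately show ?thesis unfolding closed_forms1_iff by blast
qed

section \<open>Classes in H^1(K/k) and the Gauss--Manin connection\<close>

lemma coh_class_mem: "\<eta> \<in> coh_class P \<omega> \<longleftrightarrow> \<eta> \<in> closed_forms1 P \<and> (\<exists>f. \<forall>xs. \<eta> xs = \<omega> xs + exact f xs)"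
  unfolding coh_class_def by (auto simp: fun_eq_iff algebra_simps)

lemma coh_class_eqI:
  assumes "\<And>xs. \<omega> xs = \<omega>' xs + exact f xs"
  shows "coh_class P \<omega> = coh_class P \<omega>'"
proof -
  have "(\<exists>g. \<forall>xs. \<eta> xs = \<omega> xs + exact g xs) \<longleftrightarrow> (\<exists>g. \<forall>xs. \<eta> xs = \<omega>' xs + exact g xs)" for \<eta>
  proof
    assume "\<exists>g. \<forall>xs. \<eta> xs = \<omega> xs + exact g xs"
    then obtain g where "\<forall>xs. \<eta> xs = \<omega> xs + exact g xs" ..
    then show "\<exists>g. \<forall>xs. \<eta> xs = \<omega>' xs + exact g xs"
      by (intro exI[of _ "f + g"]) (simp add: exact_add assms)
  next
    assume "\<exists>g. \<forall>xs. \<eta> xs = \<omega>' xs + exact g xs"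
    then obtain g where "\<forall>xs. \<eta> xs = \<omega>' xs + exact g xs" ..
    then show "\<exists>g. \<forall>xs. \<eta> xs = \<omega> xs + exact g xs"
      by (intro exI[of _ "g - f"]) (simp add: exact_diff assms)
  qed
  then show ?thesis by (auto simp: set_eq_iff coh_class_mem)
qed

lemma coh_class_representative:
  assumes "\<omega> \<in> closed_forms1 P"
  obtains f where "(SOME \<eta>. \<eta> \<in> coh_class P \<omega>) \<in> closed_forms1 P"
    "\<And>xs. (SOME \<eta>. \<eta> \<in> coh_class P \<omega>) xs = \<omega> xs + exact f xs"
proof -
  have "\<omega> \<in> coh_class P \<omega>" using assms by (auto simp: coh_class_mem intro: exI[of _ 0])
  then have "(SOME \<eta>. \<eta> \<in> coh_class P \<omega>) \<in> coh_class P \<omega>"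
    by (rule someI[of "\<lambda>\<eta>. \<eta> \<in> coh_class P \<omega>"])
  then show ?thesis using that by (auto simp: coh_class_mem)
qed

text \<open>Two corrections are combined. Passing from \<omega> to \<omega> + d f adds d(v(f)).
  Passing from \<open>u\<close> to \<open>v\<close> adds the Lie derivative along v - u, an element
  of D_{K/k}, and for closed \<omega> this is d of the contraction \<omega>(v - u).\<close>

lemma rel_lie_lift_independent:
  assumes \<omega>: "\<omega> \<in> closed_forms1 P" and \<omega>': "\<omega>' \<in> closed_forms1 P" "\<And>xs. \<omega>' xs = \<omega> xs + exact f xs"
    and u: "\<tau> u = 1" "\<tau> v = 1"
  shows "rel_lie P v \<omega>' xs = rel_lie P u \<omega> xs + exact (act K v f + \<omega> [v - u]) xs"
proof (cases "\<exists>x\<in>rel_der P. xs = [x]")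
  case True
  then obtain x where x: "x \<in> rel_der P" "xs = [x]" by blast
  define z where "z = v - u"
  have v: "v = u + z" by (simp add: z_def)
  have z: "z \<in> rel_der P" by (simp add: z_def rel_der_iff \<tau>_diff u)
  have bx: "brk K v x \<in> rel_der P" "brk K u x \<in> rel_der P" by (simp_all add: rel_der_brk_lift u x)
  have "\<omega> [brk K v x] = \<omega> [brk K u x] + \<omega> [brk K z x]"
    unfolding v ext.brk_add_left using closed_form1[OF \<omega>] bx z x by (simp add: rel_form1_add rel_der_brk)
  also have "\<omega> [brk K z x] = act K z (\<omega> [x]) - act K x (\<omega> [z])"
    using \<omega> x z by (simp add: closed_forms1_iff)
  finally show ?thesis
    using x z bx
    by (simp add: rel_lie_apply[OF closed_form1[OF \<omega>] u(1)] rel_lie_apply[OF closed_form1[OF \<omega>'(1)] u(2)]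
        \<omega>'(2) exact_apply ext.act_add ext.act_brk z_def[symmetric])
      (simp add: v ext.act_plus ext.act_add)
next
  case False
  then show ?thesis
    by (simp add: rel_lie_eq[OF closed_form1[OF \<omega>] u(1)] rel_lie_eq[OF closed_form1[OF \<omega>'(1)] u(2)] exact_eq)
qed

text \<open>The connection is defined with its own choice of lift and of representative; this
  replaces them by the given \<open>u\<close> and \<omega>.\<close>

lemma gauss_manin_coh_class:
  assumes \<omega>: "\<omega> \<in> closed_forms1 P" and u: "\<tau> u = 1"
  shows "gauss_manin P dt (coh_class P \<omega>) = coh_class P (rel_lie P u \<omega>)"
proof -
  define v where "v = (SOME u. str P u = pure_tensor P 1 dt)"
  have "str P v = pure_tensor P 1 dt" unfolding v_def using ex_lift by (rule someI_ex)
  then have v: "\<tau> v = 1" by (simp add: lift_iff)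
  obtain f where "(SOME \<eta>. \<eta> \<in> coh_class P \<omega>) \<in> closed_forms1 P"
    "\<And>xs. (SOME \<eta>. \<eta> \<in> coh_class P \<omega>) xs = \<omega> xs + exact f xs"
    using coh_class_representative[OF \<omega>] by blast
  from rel_lie_lift_independent[OF \<omega> this u v] show ?thesis
    unfolding gauss_manin_def v_def[symmetric] by (rule coh_class_eqI)
qed

lemma rel_lie_pow_closed:
  assumes "\<omega> \<in> closed_forms1 P" "\<tau> u = 1"
  shows "(rel_lie P u ^^ i) \<omega> \<in> closed_forms1 P"
  by (induction i) (simp_all add: assms rel_lie_closed)

lemma gauss_manin_pow:
  assumes "\<omega> \<in> closed_forms1 P" "\<tau> u = 1"
  shows "(gauss_manin P dt ^^ i) (coh_class P \<omega>) = coh_class P ((rel_lie P u ^^ i) \<omega>)"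
  by (induction i) (simp_all add: gauss_manin_coh_class rel_lie_pow_closed assms)

lemma rel_lie_op_closed:
  assumes "\<omega> \<in> closed_forms1 P" "\<tau> u = 1"
  shows "rel_lie_op P u D \<omega> \<in> closed_forms1 P"
  unfolding rel_lie_op_def by (rule closed_forms1_combination) (rule rel_lie_pow_closed[OF assms])

text \<open>Each power of the connection is evaluated on some chosen form, off by an exact form d(f
  i). The coefficients of the operator are constants for D_{K/k} and pass through d, so the total
  error is exact.\<close>

lemma annihilates_iff:
  assumes \<omega>: "\<omega> \<in> closed_forms1 P" and u: "\<tau> u = 1"
  shows "annihilates P dt D \<omega> \<longleftrightarrow> (\<exists>f. rel_lie_op P u D \<omega> = exact f)"
proof -
  have "\<exists>f. \<forall>xs. (SOME \<eta>. \<eta> \<in> (gauss_manin P dt ^^ i) (coh_class P \<omega>)) xs = (rel_lie P u ^^ i) \<omega> xs + exact f xs" for i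
    unfolding gauss_manin_pow[OF \<omega> u] using coh_class_representative[OF rel_lie_pow_closed[OF \<omega> u]] by metis
  then obtain f where f: "\<And>i xs. (SOME \<eta>. \<eta> \<in> (gauss_manin P dt ^^ i) (coh_class P \<omega>)) xs = (rel_lie P u ^^ i) \<omega> xs + exact (f i) xs"
    by metis
  have "gauss_manin_op P dt D (coh_class P \<omega>) = coh_class P (rel_lie_op P u D \<omega>)"
    unfolding gauss_manin_op_def
    by (rule coh_class_eqI[of _ _ "\<Sum>i\<le>Polynomial.degree D. emb P (Polynomial.coeff D i) * f i"])
      (simp add: f rel_lie_op_def exact_sum exact_emb distrib_left sum.distrib)
  moreover have "coh_class P (rel_lie_op P u D \<omega>) = coh_class P (\<lambda>_. 0) \<longleftrightarrow> (\<exists>f. rel_lie_op P u D \<omega> = exact f)"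
  proof
    assume "coh_class P (rel_lie_op P u D \<omega>) = coh_class P (\<lambda>_. 0)"
    moreover have "rel_lie_op P u D \<omega> \<in> coh_class P (rel_lie_op P u D \<omega>)"
      using rel_lie_op_closed[OF \<omega> u] by (auto simp: coh_class_mem intro: exI[of _ 0])
    ultimately show "\<exists>f. rel_lie_op P u D \<omega> = exact f" by (auto simp: coh_class_mem fun_eq_iff)
  next
    assume "\<exists>f. rel_lie_op P u D \<omega> = exact f"
    then obtain f where "rel_lie_op P u D \<omega> = exact f" ..
    then show "coh_class P (rel_lie_op P u D \<omega>) = coh_class P (\<lambda>_. 0)" by (intro coh_class_eqI[of _ _ f]) simp
  qed
  ultimately show ?thesis by (simp add: annihilates_def)
qed

lemma rel_lie_op_sum:
  assumes "finite I" "\<And>i. i \<notin> I \<Longrightarrow> Polynomial.coeff D i = 0"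
  shows "rel_lie_op P u D \<omega> xs = (\<Sum>i\<in>I. emb P (Polynomial.coeff D i) * (rel_lie P u ^^ i) \<omega> xs)"
proof -
  have "rel_lie_op P u D \<omega> xs = (\<Sum>i\<in>I \<union> {..Polynomial.degree D}. emb P (Polynomial.coeff D i) * (rel_lie P u ^^ i) \<omega> xs)"
    unfolding rel_lie_op_def using assms
    by (intro sum.mono_neutral_left) (auto simp: coeff_eq_0)
  also have "\<dots> = (\<Sum>i\<in>I. emb P (Polynomial.coeff D i) * (rel_lie P u ^^ i) \<omega> xs)"
    using assms by (intro sum.mono_neutral_right) auto
  finally show ?thesis .
qed

text \<open>The coefficients are assembled into an operator D'. If it were non-zero it would
  annihilate the class of \<omega>, and its degree, where the coefficient does not vanish, would
  belong to \<open>I\<close>. This contradicts the minimality of the order of \<open>D\<close>, or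
  the absence of annihilators when \<open>D = 0\<close>.\<close>

lemma minimal_annihilator_independent:
  assumes \<omega>: "\<omega> \<in> closed_forms1 P" and u: "\<tau> u = 1" and D: "minimal_annihilator P dt \<omega> D"
    and I: "finite I" "\<And>i. i \<in> I \<Longrightarrow> D = 0 \<or> i < Polynomial.degree D"
    and c: "\<And>i. i \<in> I \<Longrightarrow> c i \<in> range (emb P)"
    and rel: "\<And>x. x \<in> rel_der P \<Longrightarrow> (\<Sum>i\<in>I. c i * (rel_lie P u ^^ i) \<omega> [x]) = act K x f"
    and i: "i \<in> I"
  shows "c i = 0"
proof (rule ccontr)
  assume "c i \<noteq> 0"
  have "\<forall>j\<in>I. \<exists>b. c j = emb P b" using c by blast
  then obtain b where b: "\<And>j. j \<in> I \<Longrightarrow> c j = emb P (b j)" by metis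
  define D' where "D' = (\<Sum>j\<in>I. Polynomial.monom (b j) j)"
  have coeff: "Polynomial.coeff D' j = (if j \<in> I then b j else 0)" for j
    using I(1) by (simp add: D'_def Polynomial.coeff_sum sum.delta)
  have "Polynomial.coeff D' i \<noteq> 0" using i b[OF i] \<open>c i \<noteq> 0\<close> by (auto simp: coeff)
  then have D'0: "D' \<noteq> 0" by auto
  have "rel_lie_op P u D' \<omega> = exact f"
  proof (rule rel_form1_eqI)
    fix x assume x: "x \<in> rel_der P"
    have "rel_lie_op P u D' \<omega> [x] = (\<Sum>j\<in>I. emb P (Polynomial.coeff D' j) * (rel_lie P u ^^ j) \<omega> [x])"
      by (rule rel_lie_op_sum[OF I(1)]) (simp add: coeff)
    then show "rel_lie_op P u D' \<omega> [x] = exact f [x]"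
      using rel[OF x] b by (simp add: coeff exact_apply[OF x])
  qed (intro closed_form1 rel_lie_op_closed exact_closed \<omega> u)+
  then have ann: "annihilates P dt D' \<omega>" using annihilates_iff[OF \<omega> u] by blast
  then have D0: "D \<noteq> 0" and le: "Polynomial.degree D \<le> Polynomial.degree D'"
    using D D'0 unfolding minimal_annihilator_def by (auto split: if_splits)
  have "Polynomial.coeff D' (Polynomial.degree D') \<noteq> 0" using D'0 by simp
  then have "Polynomial.degree D' \<in> I" by (auto simp: coeff split: if_splits)
  then show False using I(2) D0 le by fastforce
qed

end


section \<open>The algebra of words\<close>

lemma word_dalg_simps [simp]:
  "carrier (word_dalg F) = UNIV" "p \<otimes>\<^bsub>word_dalg F\<^esub> q = p * q" "p \<oplus>\<^bsub>word_dalg F\<^esub> q = p + q"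
  "\<one>\<^bsub>word_dalg F\<^esub> = 1" "\<zero>\<^bsub>word_dalg F\<^esub> = 0"
  "dact (word_dalg F) = word_der F" "alg (word_dalg F) = pconst"
  by (auto simp: word_dalg_def mpoly_ring_def ring.defs dalg.defs)

lemma word_relationsI:
  "pvar ((x + x') # w) - pvar (x # w) - pvar (x' # w) \<in> word_relations F"
  "pvar (scl F c x # w) - pconst c * pvar (x # w) \<in> word_relations F"
  "pvar (brk F x x' # w) - (pvar (x # x' # w) - pvar (x' # x # w)) \<in> word_relations F"
  unfolding word_relations_def
  by (rule UnI1, rule UnI1, blast) (rule UnI1, rule UnI2, blast, rule UnI2, blast)

context differential_field
begin

lemma word_operator_algebra: "operator_algebra F (word_dalg F)"
proof -
  have "cring (word_dalg F)"
  proof (rule cringI)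
    show "abelian_group (word_dalg F)"
      by (rule abelian_groupI) (auto simp: ac_simps intro: exI[of _ "- x" for x])
    show "Group.comm_monoid (word_dalg F)" by unfold_locales (auto simp: ac_simps)
  qed (simp add: distrib_right)
  then show ?thesis
    by (intro operator_algebra.intro operator_algebra_axioms.intro)
      (simp_all add: pconst_add pconst_mult word_der_pconst
        ring_derivation.add[OF word_der_derivation] ring_derivation.mult[OF word_der_derivation])
qed

lemma word_a_inv [simp]: "\<ominus>\<^bsub>word_dalg F\<^esub> p = - p"
proof -
  interpret operator_algebra F "word_dalg F" by (rule word_operator_algebra)
  show ?thesis using minus_equality[of "- p" p] by simp
qed

lemma word_a_minus [simp]: "p \<ominus>\<^bsub>word_dalg F\<^esub> q = p - q"
  by (simp add: a_minus_def)

lemma word_finsum: "finite A \<Longrightarrow> finsum (word_dalg F) f A = sum f A"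
proof (induction A rule: finite_induct)
  case empty
  interpret operator_algebra F "word_dalg F" by (rule word_operator_algebra)
  show ?case by simp
next
  case (insert x A)
  interpret operator_algebra F "word_dalg F" by (rule word_operator_algebra)
  show ?case using insert by simp
qed

text \<open>By the Leibniz rule \<open>d p\<close> is a combination of the values of
  \<open>d\<close> on variables, with polynomial coefficients.\<close>

lemma word_derivation_in_ideal:
  assumes "stable_ideal F (word_dalg F) I" "ring_derivation d" "\<And>c. d (pconst c) = 0" "\<And>w. d (pvar w) \<in> I"
  shows "d p \<in> I"
proof -
  interpret stable_ideal F "word_dalg F" I by fact
  interpret d: ring_derivation d by fact
  have zero: "0 \<in> I" using zero_closed by simp
  have "p \<in> polys_in UNIV" by simp
  then show ?thesis
  proof (induction rule: polys_in_induct)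
    case (add p q)
    then show ?case using a_closed[of "d p" "d q"] by (simp add: d.add)
  next
    case (mult p q)
    then show ?case
      using a_closed[of "d p * q" "p * d q"] I_l_closed[of "d q" p] I_r_closed[of "d p" q] by (simp add: d.mult)
  qed (simp_all add: assms zero)
qed

lemma dpoly_ideal: "stable_ideal F (word_dalg F) (diff_ideal (word_dalg F) (word_relations F))"
  by (rule operator_algebra.diff_ideal_stable[OF word_operator_algebra]) simp

text \<open>The defect of each law is a derivation. It vanishes on constants since K itself obeys
  the law, and its values on variables are the imposed relations. Thus relations on words enforce
  the laws on all polynomials.\<close>

lemma dpoly_differential_algebra: "differential_algebra F (dpoly_alg F)"
proof -
  define I where "I = diff_ideal (word_dalg F) (word_relations F)"
  interpret stable_ideal F "word_dalg F" I unfolding I_def by (rule dpoly_ideal)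
  have rel: "word_relations F \<subseteq> I" unfolding I_def by (rule diff_ideal_superset)
  have neg: "p \<in> I \<Longrightarrow> q = - p \<Longrightarrow> q \<in> I" for p q using a_inv_closed[of p] by simp
  note der [simp] = ring_derivation.add[OF word_der_derivation] ring_derivation.mult[OF word_der_derivation]
    ring_derivation.diff[OF word_der_derivation]
  show ?thesis
    unfolding dpoly_alg_def I_def[symmetric]
  proof (rule quot_differential_algebra, goal_cases)
    case (1 x y p)
    have d: "ring_derivation (\<lambda>p. word_der F (x + y) p - (word_der F x p + word_der F y p))"
      by unfold_locales (simp_all add: algebra_simps)
    have "pvar ((x + y) # w) - pvar (x # w) - pvar (y # w) \<in> I" for w
      using rel word_relationsI by blast
    then show ?case
      using word_derivation_in_ideal[OF stable_ideal_axioms d]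
      by (simp add: word_der_pconst word_der_pvar act_plus pconst_add diff_diff_eq)
  next
    case (2 c x p)
    have d: "ring_derivation (\<lambda>p. word_der F (scl F c x) p - pconst c * word_der F x p)"
      by unfold_locales (simp_all add: algebra_simps)
    have "pvar (scl F c x # w) - pconst c * pvar (x # w) \<in> I" for w
      using rel word_relationsI by blast
    then show ?case
      using word_derivation_in_ideal[OF stable_ideal_axioms d]
      by (simp add: word_der_pconst word_der_pvar act_scl pconst_mult)
  next
    case (3 x y p)
    have d: "ring_derivation (\<lambda>p. word_der F (brk F x y) p - (word_der F x (word_der F y p) - word_der F y (word_der F x p)))"
      by unfold_locales (simp_all add: algebra_simps)
    have "pvar (brk F x y # w) - (pvar (x # y # w) - pvar (y # x # w)) \<in> I" for w
      using rel word_relationsI by blast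
    then show ?case
      using word_derivation_in_ideal[OF stable_ideal_axioms d]
      by (simp add: word_der_pconst word_der_pvar act_brk pconst_diff)
  qed
qed

end

text \<open>The quotient map is surjective, so images of ideals are ideals. This pushes the kernel
  of the evaluation on words down to the differential polynomials.\<close>

lemma (in stable_ideal) stable_ideal_image:
  assumes "stable_ideal F A J"
  shows "stable_ideal F (quot_dalg A I) ((+>) I ` J)"
proof -
  interpret J: stable_ideal F A J by fact
  interpret Q: operator_algebra F "quot_dalg A I" by (rule quot_operator_algebra)
  have carr: "r \<in> carrier A" if "r \<in> J" for r using that J.a_subset by blast
  have inv: "\<ominus>\<^bsub>quot_dalg A I\<^esub> (I +> r) = I +> (\<ominus> r)" if "r \<in> carrier A" for r
    using that by (intro Q.minus_equality) (simp_all add: add_coset coset_closed l_neg a_subset)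
  have "ideal ((+>) I ` J) (quot_dalg A I)"
  proof (rule idealI)
    show "ring (quot_dalg A I)" by (rule Q.ring_axioms)
    show "subgroup ((+>) I ` J) (add_monoid (quot_dalg A I))"
    proof (unfold_locales, goal_cases)
      case 1
      then show ?case using carr by (auto simp: coset_closed)
    next
      case (2 X Y)
      then show ?case using carr by (auto simp: add_coset)
    next
      case 3
      then show ?case using J.zero_closed by (intro image_eqI[of _ _ \<zero>]) (simp_all add: a_subset)
    next
      case (4 X)
      then obtain r where r: "r \<in> J" "X = I +> r" by blast
      then have "inv\<^bsub>add_monoid (quot_dalg A I)\<^esub> X = I +> (\<ominus> r)"
        using inv[OF carr[OF r(1)]] by (simp add: a_inv_def)
      then show ?case using J.a_inv_closed[OF r(1)] by blast
    qed
    show "X \<otimes>\<^bsub>quot_dalg A I\<^esub> Y \<in> (+>) I ` J" if "Y \<in> (+>) I ` J" "X \<in> carrier (quot_dalg A I)" for X Y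
      using that(2) by (rule coset_cases) (use that(1) carr J.I_l_closed in \<open>auto simp: mult_coset\<close>)
    show "Y \<otimes>\<^bsub>quot_dalg A I\<^esub> X \<in> (+>) I ` J" if "Y \<in> (+>) I ` J" "X \<in> carrier (quot_dalg A I)" for X Y
      using that(2) by (rule coset_cases) (use that(1) carr J.I_r_closed in \<open>auto simp: mult_coset\<close>)
  qed
  then show ?thesis
    by (intro stable_ideal.intro stable_ideal_axioms.intro Q.operator_algebra_axioms)
      (use carr J.stable in \<open>auto simp: dact_coset\<close>)
qed


section \<open>The polynomial model\<close>

locale ppv_setting = ordinary_parameterized_field P dt
  for P :: "('k::field_char_0, 'dk::ab_group_add, 'K::field_char_0, 'dK::ab_group_add) pdfield" and dt :: 'dk +
  fixes \<omega> :: "'dK list \<Rightarrow> 'K" and u :: 'dK and D :: "'k poly" and a :: 'K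
  assumes closed: "\<omega> \<in> closed_forms1 P" and lift: "\<tau> u = 1"
    and minimal: "minimal_annihilator P dt \<omega> D"
    and primitive: "rel_lie_op P u D \<omega> = exact a" and zero_case: "D = 0 \<Longrightarrow> a = 0"
begin

abbreviation "n \<equiv> Polynomial.degree D"
abbreviation "cf i \<equiv> emb P (Polynomial.coeff D i)"

text \<open>The case \<open>D = 0\<close> is listed separately because the zero polynomial has
  degree 0 here, while all y_i are then free. If \<open>D\<close> is a non-zero constant,
  \<open>V\<close> is empty and the model is K.\<close>

definition V :: "nat set" where
  "V = {i. D = 0 \<or> i < n}"

definition w :: "nat \<Rightarrow> 'dK \<Rightarrow> 'K" where
  "w i x = (rel_lie P u ^^ i) \<omega> [x]"

definition rel_part :: "'dK \<Rightarrow> 'dK" where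
  "rel_part x = x - scl K (\<tau> x) u"

text \<open>\<open>Y j\<close> is the element \<open>u\<^sup>j y\<close>, for \<open>j\<close> at most the order of the operator.\<close>

definition Y :: "nat \<Rightarrow> (nat \<Rightarrow>\<^sub>0 nat) \<Rightarrow>\<^sub>0 'K" where
  "Y j = (if j \<in> V then pvar j else pconst (a / cf n) - (\<Sum>i<n. pconst (cf i / cf n) * pvar i))"

text \<open>Decompose x into its part in D_{K/k} and \<tau>(x) u. The first sends y_i to a value of
  \<omega>_i, the second to y_{i+1}; the equation for \<open>D\<close> enters only through
  \<open>Y (Suc i)\<close> when \<open>Suc i\<close> is the order.\<close>

definition E :: "'dK \<Rightarrow> ((nat \<Rightarrow>\<^sub>0 nat) \<Rightarrow>\<^sub>0 'K) \<Rightarrow> (nat \<Rightarrow>\<^sub>0 nat) \<Rightarrow>\<^sub>0 'K" where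
  "E x = pder (act K x) (\<lambda>i. pconst (w i (rel_part x)) + pconst (\<tau> x) * Y (Suc i))"

lemma w_closed: "(rel_lie P u ^^ i) \<omega> \<in> closed_forms1 P"
  by (rule rel_lie_pow_closed[OF closed lift])

lemma w_add: "x \<in> rel_der P \<Longrightarrow> y \<in> rel_der P \<Longrightarrow> w i (x + y) = w i x + w i y"
  and w_scl: "x \<in> rel_der P \<Longrightarrow> w i (scl K c x) = c * w i x"
  and w_brk: "x \<in> rel_der P \<Longrightarrow> y \<in> rel_der P \<Longrightarrow> w i (brk K x y) = act K x (w i y) - act K y (w i x)"
  and w_Suc: "x \<in> rel_der P \<Longrightarrow> w (Suc i) x = act K u (w i x) - w i (brk K u x)"
  using w_closed[of i] unfolding w_def closed_forms1_iff
  by (simp_all only: rel_form1_add rel_form1_scl rel_lie_apply[OF _ lift] funpow.simps comp_apply)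

lemma rel_part_rel: "rel_part x \<in> rel_der P"
  unfolding rel_part_def by (rule rel_der_diff_lift[OF lift])

lemma rel_part_id: "x \<in> rel_der P \<Longrightarrow> rel_part x = x"
  by (simp add: rel_part_def rel_der_iff ext.scl_zero)

lemma rel_part_eqI: "x = r + scl K c u \<Longrightarrow> r \<in> rel_der P \<Longrightarrow> rel_part x = r \<and> \<tau> x = c"
  by (simp add: rel_part_def rel_der_iff \<tau>_add \<tau>_scl lift)

lemma rel_part_decomp: "rel_part x + scl K (\<tau> x) u = x"
  by (simp add: rel_part_def)

lemma rel_zero: "0 \<in> rel_der P"
  using rel_part_rel[of 0] rel_der_scl[of _ 0] by (metis ext.scl_zero)

lemma w_zero: "w i 0 = 0"
  using w_add[OF rel_zero rel_zero, of i] by simp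

lemma rel_part_add: "rel_part (x + y) = rel_part x + rel_part y"
proof -
  have "x + y = (rel_part x + rel_part y) + scl K (\<tau> x + \<tau> y) u"
    by (simp add: rel_part_def ext.scl_add_left)
  from rel_part_eqI[OF this] show ?thesis using rel_der_add rel_part_rel by blast
qed

lemma rel_part_scl: "rel_part (scl K c x) = scl K c (rel_part x)"
proof -
  have "scl K c x = scl K c (rel_part x) + scl K (c * \<tau> x) u"
    unfolding ext.scl_scl[symmetric] ext.scl_add_right[symmetric] rel_part_decomp ..
  from rel_part_eqI[OF this] show ?thesis using rel_der_scl rel_part_rel by blast
qed

text \<open>The integrability condition for y_i. With x = x' + s u and y = y' + t u, the part of
  [x, y] in D_{K/k} is [x', y'] + s [u, y'] - t [u, x']. Closedness of \<omega>_i handles the first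
  bracket and the recursion \<open>w_Suc\<close> the other two.\<close>

lemma w_rel_part_brk:
  "w i (rel_part (brk K x y)) =
    act K x (w i (rel_part y)) - act K y (w i (rel_part x)) +
    \<tau> y * w (Suc i) (rel_part x) - \<tau> x * w (Suc i) (rel_part y)"
proof -
  define x' y' s t where "x' = rel_part x" and "y' = rel_part y" and "s = \<tau> x" and "t = \<tau> y"
  have x: "x = x' + scl K s u" and y: "y = y' + scl K t u"
    by (simp_all add: x'_def y'_def s_def t_def rel_part_decomp)
  have rel: "x' \<in> rel_der P" "y' \<in> rel_der P" by (simp_all only: x'_def y'_def rel_part_rel)
  have neg_right: "scl K c (- z) = - scl K c z" for c z
    using ext.scl_add_right[of c z "- z"] by (simp add: eq_neg_iff_add_eq_0 add.commute)
  have left: "brk K (scl K c u) z = scl K c (brk K u z) - scl K (act K z c) u" for c z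
  proof -
    have "brk K z (scl K c u) = - scl K c (brk K u z) + scl K (act K z c) u"
      by (simp only: ext.brk_scl ext.brk_antisym[of z u] neg_right)
    then show ?thesis by (simp add: ext.brk_antisym[of "scl K c u" z])
  qed
  define r where "r = brk K x' y' + (scl K s (brk K u y') + scl K (- t) (brk K u x'))"
  have neg: "scl K (- c) z = - scl K c z" for c z
    using ext.scl_add_left[of c "- c" z] by (simp add: ext.scl_zero eq_neg_iff_add_eq_0 add.commute)
  \<comment> \<open>The multiple of \<open>u\<close> can stay anonymous, since
    \<open>rel_part_eqI\<close> discards it.\<close>
  have "\<exists>c. brk K x y = r + scl K c u"
  proof -
    have "brk K (scl K s u) (scl K t u) = scl K (s * act K u t) u - scl K (t * act K u s) u"
      by (simp add: left ext.brk_scl ext.brk_self ext.act_scl ext.scl_scl neg_right)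
    moreover have "brk K x' (scl K t u) = scl K (- t) (brk K u x') + scl K (act K x' t) u"
      unfolding ext.brk_antisym[of x'] left neg by simp
    ultimately have "brk K x y = r + (scl K (s * act K u t) u - scl K (t * act K u s) u + scl K (act K x' t) u - scl K (act K y' s) u)"
      unfolding x y r_def by (simp add: ext.brk_add_left ext.brk_add_right left algebra_simps)
    also have "scl K (s * act K u t) u - scl K (t * act K u s) u + scl K (act K x' t) u - scl K (act K y' s) u
        = scl K (s * act K u t + (- (t * act K u s)) + act K x' t + (- act K y' s)) u"
      unfolding ext.scl_add_left neg by simp
    finally show ?thesis by blast
  qed
  moreover have r_rel: "r \<in> rel_der P"
    unfolding r_def by (intro rel_der_add rel_der_scl rel_der_brk rel_der_brk_lift rel lift)
  ultimately have rp: "rel_part (brk K x y) = r" using rel_part_eqI by blast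
  have wr: "w i r = (act K x' (w i y') - act K y' (w i x')) + (s * (act K u (w i y') - w (Suc i) y') - t * (act K u (w i x') - w (Suc i) x'))"
    unfolding r_def using rel
    by (simp add: w_add w_scl w_brk w_Suc rel_der_add rel_der_scl rel_der_brk rel_der_brk_lift lift)
  have "act K x f = act K x' f + s * act K u f" "act K y f = act K y' f + t * act K u f" for f
    unfolding x y by (simp_all add: ext.act_plus ext.act_scl)
  then show ?thesis
    unfolding rp wr x'_def[symmetric] y'_def[symmetric] s_def[symmetric] t_def[symmetric]
    by (simp add: algebra_simps)
qed

lemma E_derivation: "ring_derivation (E x)"
  unfolding E_def by (intro pder_derivation ext.act_derivation)

lemma E_pconst [simp]: "E x (pconst c) = pconst (act K x c)"
  unfolding E_def by (intro pder_pconst ext.act_derivation)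

lemma E_pvar: "E x (pvar i) = pconst (w i (rel_part x)) + pconst (\<tau> x) * Y (Suc i)"
  unfolding E_def by (rule pder_pvar[OF ext.act_derivation])

lemmas E_add = ring_derivation.add[OF E_derivation]
lemmas E_mult = ring_derivation.mult[OF E_derivation]
lemmas E_diff = ring_derivation.diff[OF E_derivation]
lemmas E_sum = ring_derivation.sum[OF E_derivation]

lemma Y_closed: "Y j \<in> polys_in V"
proof (cases "j \<in> V")
  case False
  then have "i \<in> V" if "i < n" for i using that by (simp add: V_def)
  then show ?thesis using False unfolding Y_def
    by (auto intro!: polys_in_diff polys_in_sum polys_in_mult polys_in_pvar)
qed (simp add: Y_def polys_in_pvar)

lemma E_closed: "p \<in> polys_in V \<Longrightarrow> E x p \<in> polys_in V"
  unfolding E_def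
  by (rule pder_closed[OF ext.act_derivation]) (auto intro!: polys_in_add polys_in_mult Y_closed)

section \<open>The laws of a differential algebra for the action on the model\<close>

lemma E_plus: "p \<in> polys_in V \<Longrightarrow> E (x + y) p = E x p + E y p"
proof (rule derivations_agree[of "E (x + y)" "\<lambda>p. E x p + E y p"])
  show "ring_derivation (\<lambda>p. E x p + E y p)" by (intro ring_derivation_add E_derivation)
  show "E (x + y) (pvar i) = E x (pvar i) + E y (pvar i)" for i
    unfolding E_pvar rel_part_add w_add[OF rel_part_rel rel_part_rel] \<tau>_add by (simp add: pconst_add algebra_simps)
qed (simp_all add: E_derivation ext.act_plus pconst_add)

lemma E_scl: "p \<in> polys_in V \<Longrightarrow> E (scl K c x) p = pconst c * E x p"
proof (rule derivations_agree[of "E (scl K c x)" "\<lambda>p. pconst c * E x p"])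
  show "ring_derivation (\<lambda>p. pconst c * E x p)" by (intro ring_derivation_scale E_derivation)
  show "E (scl K c x) (pvar i) = pconst c * E x (pvar i)" for i
    unfolding E_pvar rel_part_scl w_scl[OF rel_part_rel] \<tau>_scl by (simp add: pconst_mult algebra_simps)
qed (simp_all add: E_derivation ext.act_scl pconst_mult)

lemma E_decomp: "p \<in> polys_in V \<Longrightarrow> E x p = E (rel_part x) p + pconst (\<tau> x) * E u p"
  using E_plus[of p "rel_part x" "scl K (\<tau> x) u"] E_scl[of p "\<tau> x" u] by (simp add: rel_part_decomp)

lemma primitive_apply: "x \<in> rel_der P \<Longrightarrow> (\<Sum>i\<le>n. cf i * w i x) = act K x a"
  using fun_cong[OF primitive, of "[x]"] by (simp add: rel_lie_op_def w_def exact_apply)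

lemma act_divide_cf:
  assumes x: "x \<in> rel_der P"
  shows "act K x (b / cf j) = act K x b / cf j"
proof -
  have "act K x (inverse (cf j)) = 0"
  proof (cases "cf j = 0")
    case False
    then have "act K x (inverse (cf j) * cf j) = 0" by simp
    then show ?thesis using False by (simp add: ext.act_mult act_emb[OF x])
  qed simp
  then show ?thesis by (simp add: divide_inverse ext.act_mult act_emb[OF x])
qed

text \<open>For \<open>j\<close> in \<open>V\<close> this is the definition of the action. For
  \<open>j = n\<close> it is the consistency of the equation: the expression replacing y_n has
  derivative \<omega>_n precisely because the sum of the c_i \<omega>_i is d a.\<close>

lemma E_rel_Y:
  assumes x: "x \<in> rel_der P" and j: "j \<in> V \<or> j = n"
  shows "E x (Y j) = pconst (w j x)"
proof -
  have \<tau>: "\<tau> x = 0" using x by (simp add: rel_der_iff)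
  have var: "E x (pvar i) = pconst (w i x)" for i
    unfolding E_pvar rel_part_id[OF x] by (simp add: \<tau>)
  show ?thesis
  proof (cases "j \<in> V")
    case True
    then show ?thesis by (simp add: Y_def var)
  next
    case False
    then have j: "j = n" and D: "D \<noteq> 0" using j by (auto simp: V_def)
    have cn: "cf n \<noteq> 0" using D by simp
    have "E x (Y j) = pconst (act K x a / cf n) - (\<Sum>i<n. pconst (cf i / cf n) * pconst (w i x))"
      using False by (simp add: Y_def E_diff E_sum E_mult var act_divide_cf[OF x] act_emb[OF x])
    also have "\<dots> = pconst ((act K x a - (\<Sum>i<n. cf i * w i x)) / cf n)"
    proof -
      have "(\<Sum>i<n. pconst (cf i / cf n) * pconst (w i x)) =
          (pconst ((\<Sum>i<n. cf i * w i x) / cf n) :: (nat \<Rightarrow>\<^sub>0 nat) \<Rightarrow>\<^sub>0 'K)"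
        by (simp add: sum_divide_distrib pconst_sum pconst_mult[symmetric])
      then show ?thesis by (simp add: diff_divide_distrib pconst_diff)
    qed
    also have "act K x a - (\<Sum>i<n. cf i * w i x) = cf n * w n x"
      unfolding primitive_apply[OF x, symmetric] by (simp add: lessThan_Suc_atMost[symmetric])
    finally show ?thesis using cn j by simp
  qed
qed

text \<open>For Q = u y_i, derivatives along any z are w_{i+1} of the relative part of z plus
  \<tau>(z) E u Q. In the commutator the terms \<tau>(x) \<tau>(y) E u Q cancel, so E u Q is never
  computed, and \<open>w_rel_part_brk\<close> with \<open>\<tau>_brk\<close> settles the
  rest.\<close>

lemma E_brk: "p \<in> polys_in V \<Longrightarrow> E (brk K x y) p = E x (E y p) - E y (E x p)"
proof (rule derivations_agree[of "E (brk K x y)" "\<lambda>p. E x (E y p) - E y (E x p)"])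
  show "ring_derivation (\<lambda>p. E x (E y p) - E y (E x p))" by (intro ring_derivation_commutator E_derivation)
  fix i assume i: "i \<in> V"
  define Q where "Q = Y (Suc i)"
  have "Suc i \<in> V \<or> Suc i = n" using i by (auto simp: V_def)
  then have EQ: "E z Q = pconst (w (Suc i) (rel_part z)) + pconst (\<tau> z) * E u Q" for z
    unfolding Q_def by (subst E_decomp[OF Y_closed]) (simp only: E_rel_Y[OF rel_part_rel])
  show "E (brk K x y) (pvar i) = E x (E y (pvar i)) - E y (E x (pvar i))"
    unfolding E_pvar Q_def[symmetric] w_rel_part_brk \<tau>_brk E_add E_mult E_pconst EQ[of x] EQ[of y]
    by (simp add: pconst_add pconst_diff pconst_mult algebra_simps)
qed (simp_all add: E_derivation ext.act_brk pconst_diff)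

end


section \<open>Identification of the ring\<close>

context ppv_setting
begin

text \<open>Starts from \<open>Y 0\<close> and not from the variable 0: when the order is 0 and
  \<open>D\<close> is non-zero, y itself is an element of K.\<close>

definition eval_word :: "'dK list \<Rightarrow> (nat \<Rightarrow>\<^sub>0 nat) \<Rightarrow>\<^sub>0 'K" where
  "eval_word xs = foldr E xs (Y 0)"

definition \<phi> :: "(('dK list \<Rightarrow>\<^sub>0 nat) \<Rightarrow>\<^sub>0 'K) \<Rightarrow> (nat \<Rightarrow>\<^sub>0 nat) \<Rightarrow>\<^sub>0 'K" where
  "\<phi> = peval pconst eval_word"

text \<open>A section of \<open>\<phi>\<close> over the polynomials in \<open>V\<close>, sending y_i
  to the word of \<open>i\<close> letters \<open>u\<close>. Through it the kernel of
  \<open>\<phi>\<close> is shown to lie in that of \<open>\<pi>\<close>.\<close>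

definition \<sigma> :: "((nat \<Rightarrow>\<^sub>0 nat) \<Rightarrow>\<^sub>0 'K) \<Rightarrow> ('dK list \<Rightarrow>\<^sub>0 nat) \<Rightarrow>\<^sub>0 'K" where
  "\<sigma> = peval pconst (\<lambda>i. pvar (replicate i u))"

lemma poly_evaluation_pconst: "poly_evaluation pconst"
  by unfold_locales (simp_all add: pconst_add pconst_mult)

lemma \<phi>_simps:
  "\<phi> (pconst c) = pconst c" "\<phi> (pvar v) = eval_word v"
  "\<phi> (p + q) = \<phi> p + \<phi> q" "\<phi> (p * q) = \<phi> p * \<phi> q" "\<phi> (p - q) = \<phi> p - \<phi> q"
  unfolding \<phi>_def by (simp_all add: poly_evaluation.peval_pconst poly_evaluation.peval_pvar
    poly_evaluation.peval_add poly_evaluation.peval_mult poly_evaluation.peval_diff poly_evaluation_pconst)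

lemma \<sigma>_simps:
  "\<sigma> (pconst c) = pconst c" "\<sigma> (pvar i) = pvar (replicate i u)"
  "\<sigma> (p + q) = \<sigma> p + \<sigma> q" "\<sigma> (p * q) = \<sigma> p * \<sigma> q" "\<sigma> (p - q) = \<sigma> p - \<sigma> q"
  unfolding \<sigma>_def by (simp_all add: poly_evaluation.peval_pconst poly_evaluation.peval_pvar
    poly_evaluation.peval_add poly_evaluation.peval_mult poly_evaluation.peval_diff poly_evaluation_pconst)

lemma \<phi>_zero: "\<phi> 0 = 0"
  using \<phi>_simps(1)[of 0] by simp

lemma \<sigma>_zero: "\<sigma> 0 = 0"
  using \<sigma>_simps(1)[of 0] by simp

lemma \<phi>_sum: "\<phi> (sum f A) = (\<Sum>x\<in>A. \<phi> (f x))"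
  by (induction A rule: infinite_finite_induct) (simp_all add: \<phi>_zero \<phi>_simps(3))

lemma \<sigma>_sum: "\<sigma> (sum f A) = (\<Sum>x\<in>A. \<sigma> (f x))"
  by (induction A rule: infinite_finite_induct) (simp_all add: \<sigma>_zero \<sigma>_simps(3))

lemma eval_word_simps [simp]: "eval_word [] = Y 0" "eval_word (x # xs) = E x (eval_word xs)"
  by (simp_all add: eval_word_def)

lemma eval_word_closed: "eval_word xs \<in> polys_in V"
  by (induction xs) (simp_all add: Y_closed E_closed)

lemma \<phi>_closed: "\<phi> p \<in> polys_in V"
proof -
  have "p \<in> polys_in UNIV" by simp
  then show ?thesis
    by (induction rule: polys_in_induct)
      (auto simp: \<phi>_simps eval_word_closed intro: polys_in_add polys_in_mult)
qed

lemma \<phi>_word_der: "\<phi> (word_der K x p) = E x (\<phi> p)"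
proof -
  note d = ring_derivation.add[OF ext.word_der_derivation] ring_derivation.mult[OF ext.word_der_derivation]
  have "p \<in> polys_in UNIV" by simp
  then show ?thesis
    by (induction rule: polys_in_induct)
      (simp_all add: \<phi>_simps ext.word_der_pconst ext.word_der_pvar d E_add E_mult)
qed

lemma eval_word_replicate: "i \<in> V \<or> i = n \<Longrightarrow> eval_word (replicate i u) = Y i"
proof (induction i)
  case (Suc i)
  then have i: "i \<in> V" by (auto simp: V_def)
  have "rel_part u = 0" by (simp add: rel_part_def lift ext.scl_one)
  with Suc i show ?case by (simp add: Y_def[of i] E_pvar lift w_zero)
qed simp

lemma \<phi>_\<sigma>: "q \<in> polys_in V \<Longrightarrow> \<phi> (\<sigma> q) = q"
  by (induction rule: polys_in_induct)
    (simp_all add: \<phi>_simps \<sigma>_simps eval_word_replicate, simp add: Y_def)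

text \<open>Representatives of \<open>ppv_generators\<close> in the algebra of words, where
  computations are with honest polynomials.\<close>

definition gens :: "(('dK list \<Rightarrow>\<^sub>0 nat) \<Rightarrow>\<^sub>0 'K) set" where
  "gens = {pvar [x] - pconst (\<omega> [x]) | x. x \<in> rel_der P} \<union>
     {(\<Sum>i\<le>n. pconst (cf i) * pvar (replicate i u)) - pconst a}"

lemma kernel_stable: "stable_ideal K (word_dalg K) {p. \<phi> p = 0}"
proof -
  interpret operator_algebra K "word_dalg K" by (rule ext.word_operator_algebra)
  have neg: "\<phi> (- p) = - \<phi> p" for p using \<phi>_simps(5)[of 0 p] \<phi>_zero by simp
  have "ideal {p. \<phi> p = 0} (word_dalg K)"
  proof (rule idealI[OF ring_axioms])
    show "subgroup {p. \<phi> p = 0} (add_monoid (word_dalg K))"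
      by unfold_locales (simp_all only: a_inv_def[symmetric], simp_all add: \<phi>_simps \<phi>_zero neg)
  qed (simp_all add: \<phi>_simps)
  then show ?thesis
    by (intro stable_ideal.intro stable_ideal_axioms.intro operator_algebra_axioms)
      (simp_all add: \<phi>_word_der ring_derivation.zero[OF E_derivation])
qed

lemma \<phi>_relations: "word_relations K \<subseteq> {p. \<phi> p = 0}"
  unfolding word_relations_def
  by (auto simp: \<phi>_simps E_plus E_scl E_brk eval_word_closed)

lemma \<phi>_gens: "gens \<subseteq> {p. \<phi> p = 0}"
proof -
  have "\<phi> (pvar [x] - pconst (\<omega> [x])) = 0" if x: "x \<in> rel_der P" for x
  proof -
    have "0 \<in> V \<or> 0 = n" by (auto simp: V_def)
    from E_rel_Y[OF x this] show ?thesis by (simp add: \<phi>_simps w_def)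
  qed
  moreover have "\<phi> ((\<Sum>i\<le>n. pconst (cf i) * pvar (replicate i u)) - pconst a) = 0"
  proof (cases "D = 0")
    case True
    \<comment> \<open>For \<open>D = 0\<close> the sum is its single zero term and the generator is
      the constant \<open>- a\<close>, which vanishes by \<open>zero_case\<close>.\<close>
    then have "(\<Sum>i\<le>n. pconst (cf i) * pvar (replicate i u)) - pconst a = 0" using zero_case by simp
    then show ?thesis by (simp only: \<phi>_zero)
  next
    case False
    have "(\<Sum>i<n. pconst (cf i) * Y i) = pconst (cf n) * (\<Sum>i<n. pconst (cf i / cf n) * pvar i)"
      unfolding sum_distrib_left mult.assoc[symmetric] pconst_mult[symmetric]
      using False by (intro sum.cong) (simp_all add: Y_def V_def)
    moreover have "pconst (cf n) * Y n = pconst a - pconst (cf n) * (\<Sum>i<n. pconst (cf i / cf n) * pvar i)"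
      using False by (simp add: Y_def V_def right_diff_distrib pconst_mult[symmetric])
    moreover have "(\<Sum>i\<le>n. pconst (cf i) * eval_word (replicate i u)) = (\<Sum>i\<le>n. pconst (cf i) * Y i)"
      by (intro sum.cong refl arg_cong2[where f = "(*)"] eval_word_replicate) (auto simp: V_def)
    ultimately show ?thesis
      by (simp add: \<phi>_simps \<phi>_sum lessThan_Suc_atMost[symmetric])
  qed
  ultimately show ?thesis unfolding gens_def by auto
qed

section \<open>R as an iterated quotient of the algebra of words\<close>

abbreviation "W \<equiv> word_dalg K"
abbreviation "I1 \<equiv> diff_ideal W (word_relations K)"
abbreviation "A1 \<equiv> dpoly_alg K"
abbreviation "I2 \<equiv> diff_ideal A1 (ppv_generators P \<omega> u D a)"
abbreviation "R \<equiv> ppv_ring P \<omega> u D a"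

definition \<pi> :: "(('dK list \<Rightarrow>\<^sub>0 nat) \<Rightarrow>\<^sub>0 'K) \<Rightarrow> ('K, 'dK) dpoly set" where
  "\<pi> p = I2 +>\<^bsub>A1\<^esub> (I1 +>\<^bsub>W\<^esub> p)"

lemma A1_def: "A1 = quot_dalg W I1"
  by (rule dpoly_alg_def)

lemma ppv_generators_eq: "ppv_generators P \<omega> u D a = (+>\<^bsub>W\<^esub>) I1 ` gens"
proof -
  interpret I: stable_ideal K W I1 by (rule ext.dpoly_ideal)
  interpret A: differential_algebra K A1 by (rule ext.dpoly_differential_algebra)
  let ?c = "(+>\<^bsub>W\<^esub>) I1"
  have c: "?c \<in> dalg_hom W A1" unfolding A1_def by (rule I.coset_dalg_hom)
  interpret c: ring_hom_cring W A1 ?c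
    by (intro ring_hom_cring.intro ring_hom_cring_axioms.intro I.is_cring A.is_cring)
      (use c in \<open>simp add: dalg_hom_def\<close>)
  have dact: "dact A1 x (?c p) = ?c (word_der K x p)" and alg: "alg A1 b = ?c (pconst b)" for x p b
    using c by (simp_all add: dalg_hom_def)
  have pow: "(dact A1 u ^^ i) (dpoly_var K) = ?c (pvar (replicate i u))" for i
    by (induction i) (simp_all add: dpoly_var_def dact ext.word_der_pvar)
  have minus: "?c p \<ominus>\<^bsub>A1\<^esub> ?c q = ?c (p - q)" for p q
    using c.hom_add[of p "- q"] c.hom_a_inv[of q] by (simp add: a_minus_def)
  have gen1: "dact A1 x (dpoly_var K) \<ominus>\<^bsub>A1\<^esub> alg A1 b = ?c (pvar [x] - pconst b)" for x b
    using pow[of 0] by (simp add: dact alg minus ext.word_der_pvar)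
  have "(\<Oplus>\<^bsub>A1\<^esub>i\<in>{..n}. alg A1 (cf i) \<otimes>\<^bsub>A1\<^esub> (dact A1 u ^^ i) (dpoly_var K)) =
      (\<Oplus>\<^bsub>A1\<^esub>i\<in>{..n}. ?c (pconst (cf i) * pvar (replicate i u)))"
    unfolding pow alg using c.hom_mult by simp
  also have "\<dots> = ?c (\<Sum>i\<le>n. pconst (cf i) * pvar (replicate i u))"
    using c.hom_finsum[of "\<lambda>i. pconst (cf i) * pvar (replicate i u)" "{..n}"]
    by (simp add: ext.word_finsum comp_def)
  finally have gen2: "(\<Oplus>\<^bsub>A1\<^esub>i\<in>{..n}. alg A1 (cf i) \<otimes>\<^bsub>A1\<^esub> (dact A1 u ^^ i) (dpoly_var K)) \<ominus>\<^bsub>A1\<^esub> alg A1 a =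
      ?c ((\<Sum>i\<le>n. pconst (cf i) * pvar (replicate i u)) - pconst a)"
    by (simp add: alg minus)
  show ?thesis
    unfolding ppv_generators_def Let_def gen1 gen2 gens_def by blast
qed

lemma generators_closed: "ppv_generators P \<omega> u D a \<subseteq> carrier A1"
proof -
  interpret I: stable_ideal K W I1 by (rule ext.dpoly_ideal)
  show ?thesis unfolding ppv_generators_eq A1_def using I.coset_closed by auto
qed

lemma ppv_ideal: "stable_ideal K A1 I2"
  using differential_algebra.operator_algebra[OF ext.dpoly_differential_algebra] generators_closed
  by (rule operator_algebra.diff_ideal_stable)

lemma ppv_ring_differential_algebra: "differential_algebra K R"
  unfolding ppv_ring_def using ext.dpoly_differential_algebra generators_closed
  by (rule differential_algebra.quot_diff_ideal)

lemma \<pi>_dalg_hom: "\<pi> \<in> dalg_hom W R"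
proof -
  have "\<pi> = (+>\<^bsub>A1\<^esub>) I2 \<circ> (+>\<^bsub>W\<^esub>) I1" by (rule ext) (simp add: \<pi>_def)
  moreover have "(+>\<^bsub>W\<^esub>) I1 \<in> dalg_hom W A1"
    unfolding A1_def by (rule stable_ideal.coset_dalg_hom[OF ext.dpoly_ideal])
  moreover have "(+>\<^bsub>A1\<^esub>) I2 \<in> dalg_hom A1 R"
    unfolding ppv_ring_def by (rule stable_ideal.coset_dalg_hom[OF ppv_ideal])
  ultimately show ?thesis by (simp only:) (rule dalg_hom_compose)
qed

lemma \<pi>_surj: "range \<pi> = carrier R"
proof
  show "range \<pi> \<subseteq> carrier R"
    using \<pi>_dalg_hom by (auto simp: dalg_hom_def dest: ring_hom_closed)
  show "carrier R \<subseteq> range \<pi>"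
  proof
    fix X assume "X \<in> carrier R"
    then obtain Z where Z: "Z \<in> carrier A1" "X = I2 +>\<^bsub>A1\<^esub> Z"
      unfolding ppv_ring_def by (rule stable_ideal.coset_cases[OF ppv_ideal])
    from Z(1) obtain p where "Z = I1 +>\<^bsub>W\<^esub> p"
      unfolding A1_def by (rule stable_ideal.coset_cases[OF ext.dpoly_ideal])
    then show "X \<in> range \<pi>" using Z(2) by (auto simp: \<pi>_def)
  qed
qed

sublocale R: differential_algebra K R
  by (rule ppv_ring_differential_algebra)

lemma \<pi>_hom: "\<pi> \<in> ring_hom W R"
  using \<pi>_dalg_hom by (simp add: dalg_hom_def)

lemma \<pi>_closed [simp]: "\<pi> p \<in> carrier R"
  using \<pi>_surj by blast

lemma \<pi>_simps:
  "\<pi> (p + q) = \<pi> p \<oplus>\<^bsub>R\<^esub> \<pi> q" "\<pi> (p * q) = \<pi> p \<otimes>\<^bsub>R\<^esub> \<pi> q"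
  "\<pi> 1 = \<one>\<^bsub>R\<^esub>" "\<pi> (pconst c) = alg R c" "\<pi> (word_der K x p) = dact R x (\<pi> p)"
  using ring_hom_add[OF \<pi>_hom, of p q] ring_hom_mult[OF \<pi>_hom, of p q] ring_hom_one[OF \<pi>_hom] \<pi>_dalg_hom
  by (simp_all add: dalg_hom_def)

lemma \<pi>_zero: "\<pi> 0 = \<zero>\<^bsub>R\<^esub>"
  using \<pi>_simps(4)[of 0] R.operator_algebra[THEN operator_algebra.alg_zero] by simp

lemma \<pi>_uminus: "\<pi> (- p) = \<ominus>\<^bsub>R\<^esub> \<pi> p"
  using \<pi>_simps(1)[of "- p" p] by (simp add: \<pi>_zero R.minus_equality)

lemma \<pi>_diff: "\<pi> (p - q) = \<pi> p \<ominus>\<^bsub>R\<^esub> \<pi> q"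
  using \<pi>_simps(1)[of p "- q"] by (simp add: \<pi>_uminus a_minus_def)

lemma \<pi>_gens:
  assumes "g \<in> gens"
  shows "\<pi> g = \<zero>\<^bsub>R\<^esub>"
proof -
  interpret I: stable_ideal K A1 I2 by (rule ppv_ideal)
  have "I1 +>\<^bsub>W\<^esub> g \<in> I2"
    using assms diff_ideal_superset[of "ppv_generators P \<omega> u D a" A1] unfolding ppv_generators_eq by blast
  then show ?thesis
    unfolding \<pi>_def ppv_ring_def using I.coset_eq_zero_iff[of "I1 +>\<^bsub>W\<^esub> g"] I.a_subset by blast
qed

text \<open>The image of the kernel of \<open>\<phi>\<close> in the differential polynomials is a
  stable ideal containing the generators, hence contains \<open>I2\<close>. So \<open>p\<close>
  agrees modulo \<open>I1\<close> with an element of the kernel, and \<open>I1\<close> is itself in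
  the kernel.\<close>

lemma \<phi>_zero_if_\<pi>_zero:
  assumes "\<pi> p = \<zero>\<^bsub>R\<^esub>"
  shows "\<phi> p = 0"
proof -
  interpret I: stable_ideal K W I1 by (rule ext.dpoly_ideal)
  interpret I2: stable_ideal K A1 I2 by (rule ppv_ideal)
  have I1: "I1 \<subseteq> {p. \<phi> p = 0}"
    by (rule diff_ideal_minimal[OF kernel_stable \<phi>_relations])
  have "stable_ideal K A1 ((+>\<^bsub>W\<^esub>) I1 ` {p. \<phi> p = 0})"
    unfolding A1_def by (rule I.stable_ideal_image[OF kernel_stable])
  then have "I2 \<subseteq> (+>\<^bsub>W\<^esub>) I1 ` {p. \<phi> p = 0}"
    by (rule diff_ideal_minimal) (use \<phi>_gens in \<open>auto simp: ppv_generators_eq\<close>)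
  moreover have "I1 +>\<^bsub>W\<^esub> p \<in> I2"
    using assms I2.coset_eq_zero_iff[of "I1 +>\<^bsub>W\<^esub> p"] I.coset_closed[of p]
    by (simp add: \<pi>_def ppv_ring_def A1_def)
  ultimately obtain q where q: "\<phi> q = 0" "I1 +>\<^bsub>W\<^esub> p = I1 +>\<^bsub>W\<^esub> q" by blast
  then have "p - q \<in> I1" using I.coset_eq_iff[of p q] by simp
  then have "\<phi> (p - q) = 0" using I1 by blast
  then show ?thesis using q by (simp add: \<phi>_simps)
qed

section \<open>Relations in R and comparison of the two kernels\<close>

abbreviation "y \<equiv> \<pi> (pvar [])"

lemma \<pi>_replicate: "\<pi> (pvar (replicate i u)) = (dact R u ^^ i) y"
proof (induction i)
  case (Suc i)
  then show ?case using \<pi>_simps(5)[of u "pvar (replicate i u)"] by (simp add: ext.word_der_pvar)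
qed simp

lemma dact_pow_closed: "(dact R u ^^ i) y \<in> carrier R"
  unfolding \<pi>_replicate[symmetric] by simp

text \<open>Only the case \<open>i = 0\<close> is imposed. The others follow from x u = u x -
  [u, x], since [u, x] is again in D_{K/k}; this is why the claim is proved for all \<open>x\<close>
  at once, and the outcome is the recursion \<open>w_Suc\<close>.\<close>

lemma dact_rel: "x \<in> rel_der P \<Longrightarrow> dact R x ((dact R u ^^ i) y) = alg R (w i x)"
proof (induction i arbitrary: x)
  case 0
  then have "pvar [x] - pconst (w 0 x) \<in> gens" by (auto simp: gens_def w_def)
  from \<pi>_gens[OF this] have "\<pi> (pvar [x]) = alg R (w 0 x)"
    by (simp add: \<pi>_diff \<pi>_simps(4) R.alg_closed)
  then show ?case using \<pi>_simps(5)[of x "pvar []"] by (simp add: ext.word_der_pvar)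
next
  case (Suc i)
  let ?r = "(dact R u ^^ i) y"
  interpret o: operator_algebra K R by (rule R.operator_algebra)
  have c: "dact R u (dact R x ?r) \<in> carrier R" "dact R x (dact R u ?r) \<in> carrier R"
    using dact_pow_closed by simp_all
  have "alg R (w i (brk K u x)) = dact R u (dact R x ?r) \<ominus>\<^bsub>R\<^esub> dact R x (dact R u ?r)"
    using R.dact_brk[OF dact_pow_closed, of u x] Suc.IH[OF rel_der_brk_lift[OF lift Suc.prems]] by simp
  then have "dact R x (dact R u ?r) = dact R u (dact R x ?r) \<ominus>\<^bsub>R\<^esub> alg R (w i (brk K u x))"
    using c R.minus_minus by (simp add: a_minus_def R.minus_add R.a_assoc[symmetric] R.r_neg)
  also have "\<dots> = alg R (w (Suc i) x)"
    by (simp add: Suc.IH[OF Suc.prems] w_Suc[OF Suc.prems] o.dact_alg o.alg_minus)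
  finally show ?case by simp
qed

lemma \<pi>_\<sigma>_Y:
  assumes "j \<in> V \<or> j = n"
  shows "\<pi> (\<sigma> (Y j)) = \<pi> (pvar (replicate j u))"
proof (cases "j \<in> V")
  case True
  then show ?thesis by (simp add: Y_def \<sigma>_simps)
next
  case False
  then have j: "j = n" and cn: "cf n \<noteq> 0" using assms by (auto simp: V_def)
  define g where "g = (\<Sum>i\<le>n. pconst (cf i) * pvar (replicate i u)) - pconst a"
  have "g \<in> gens" by (simp add: g_def gens_def)
  \<comment> \<open>Dividing the second generator by the leading coefficient solves it for the word
    of \<open>n\<close> letters \<open>u\<close>.\<close>
  have "pconst (1 / cf n) * g = pvar (replicate n u) - \<sigma> (Y n)"
  proof -
    have "pconst (1 / cf n) * (\<Sum>i<n. pconst (cf i) * pvar (replicate i u)) = (\<Sum>i<n. pconst (cf i / cf n) * pvar (replicate i u))"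
      unfolding sum_distrib_left mult.assoc[symmetric] pconst_mult[symmetric] by simp
    moreover have "\<sigma> (Y n) = pconst (a / cf n) - (\<Sum>i<n. pconst (cf i / cf n) * pvar (replicate i u))"
      using False j by (simp add: Y_def \<sigma>_simps \<sigma>_sum)
    moreover have "pconst (1 / cf n) * (pconst (cf n) * q) = q" for q :: "('dK list \<Rightarrow>\<^sub>0 nat) \<Rightarrow>\<^sub>0 'K"
      using cn by (simp add: mult.assoc[symmetric] pconst_mult[symmetric])
    ultimately show ?thesis
      by (simp add: g_def lessThan_Suc_atMost[symmetric] right_diff_distrib distrib_left pconst_mult[symmetric])
  qed
  then have "\<pi> (pvar (replicate n u)) \<ominus>\<^bsub>R\<^esub> \<pi> (\<sigma> (Y n)) = \<zero>\<^bsub>R\<^esub>"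
    unfolding \<pi>_diff[symmetric] by (metis \<pi>_gens[OF \<open>g \<in> gens\<close>] \<pi>_closed \<pi>_simps(2) R.r_null)
  then show ?thesis by (simp add: j)
qed

text \<open>\<open>\<sigma>\<close> does not commute with the operators on words, but it does so
  modulo the relations of R. On a variable this is \<open>dact_rel\<close> for the relative part and
  \<open>\<pi>_\<sigma>_Y\<close> for the multiple of \<open>u\<close>.\<close>

lemma \<pi>_\<sigma>_E: "q \<in> polys_in V \<Longrightarrow> \<pi> (word_der K x (\<sigma> q)) = \<pi> (\<sigma> (E x q))"
proof (induction rule: polys_in_induct)
  case (pvar i)
  then have i: "Suc i \<in> V \<or> Suc i = n" by (auto simp: V_def)
  let ?r = "(dact R u ^^ i) y"
  have "\<pi> (word_der K x (\<sigma> (pvar i))) = dact R (rel_part x + scl K (\<tau> x) u) ?r"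
    by (simp add: \<sigma>_simps \<pi>_simps(5) \<pi>_replicate rel_part_decomp)
  also have "\<dots> = alg R (w i (rel_part x)) \<oplus>\<^bsub>R\<^esub> alg R (\<tau> x) \<otimes>\<^bsub>R\<^esub> \<pi> (pvar (replicate (Suc i) u))"
    by (simp only: R.dact_plus R.dact_scl dact_pow_closed dact_rel[OF rel_part_rel] \<pi>_replicate funpow.simps comp_apply)
  also have "\<dots> = \<pi> (\<sigma> (E x (pvar i)))"
    by (simp only: E_pvar \<sigma>_simps \<pi>_simps \<pi>_\<sigma>_Y[OF i])
  finally show ?case .
next
  case (add p q)
  then show ?case by (simp add: \<sigma>_simps E_add \<pi>_simps ring_derivation.add[OF ext.word_der_derivation])
next
  case (mult p q)
  then show ?case by (simp add: \<sigma>_simps E_mult \<pi>_simps ring_derivation.mult[OF ext.word_der_derivation])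
qed (simp add: \<sigma>_simps ext.word_der_pconst)

text \<open>Rewriting a word to its normal form in the y_i does not change its class in R. An
  element killed by \<open>\<phi>\<close> therefore has class zero.\<close>

lemma \<pi>_\<sigma>_\<phi>: "\<pi> (\<sigma> (\<phi> p)) = \<pi> p"
proof -
  have "p \<in> polys_in UNIV" by simp
  then show ?thesis
  proof (induction rule: polys_in_induct)
    case (pvar xs)
    show ?case
    proof (induction xs)
      case Nil
      have "0 \<in> V \<or> 0 = n" by (auto simp: V_def)
      from \<pi>_\<sigma>_Y[OF this] show ?case by (simp add: \<phi>_simps)
    next
      case (Cons x xs)
      have "\<pi> (\<sigma> (\<phi> (pvar (x # xs)))) = \<pi> (word_der K x (\<sigma> (\<phi> (pvar xs))))"
        using \<pi>_\<sigma>_E[OF eval_word_closed] by (simp add: \<phi>_simps)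
      also have "\<dots> = \<pi> (pvar (x # xs))"
        unfolding \<pi>_simps(5) Cons.IH unfolding \<pi>_simps(5)[symmetric] ext.word_der_pvar ..
      finally show ?case .
    qed
  qed (simp_all add: \<phi>_simps \<sigma>_simps \<pi>_simps)
qed

lemma \<pi>_zero_iff: "\<pi> p = \<zero>\<^bsub>R\<^esub> \<longleftrightarrow> \<phi> p = 0"
proof
  assume "\<phi> p = 0"
  then show "\<pi> p = \<zero>\<^bsub>R\<^esub>" using \<pi>_\<sigma>_\<phi>[of p] by (simp add: \<sigma>_zero \<pi>_zero)
qed (rule \<phi>_zero_if_\<pi>_zero)

lemma ppv_ring_iso:
  obtains h where "h \<in> ring_iso R (mpoly_ring V)" "\<And>p. h (\<pi> p) = \<phi> p"
proof -
  interpret W: operator_algebra K W by (rule ext.word_operator_algebra)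
  interpret M: cring "mpoly_ring V :: ((nat \<Rightarrow>\<^sub>0 nat) \<Rightarrow>\<^sub>0 'K) ring" by (rule cring_mpoly_ring)
  have hom: "\<phi> \<in> ring_hom W (mpoly_ring V)"
    by (rule ring_hom_memI) (use \<phi>_simps(1)[of 1] in \<open>simp_all add: \<phi>_closed \<phi>_simps\<close>)
  have surj: "\<phi> ` carrier W = polys_in V"
  proof (rule Set.set_eqI)
    show "q \<in> \<phi> ` carrier W \<longleftrightarrow> q \<in> polys_in V" for q
      using \<phi>_closed \<phi>_\<sigma>[of q] by (auto simp: image_iff intro: exI[of _ "\<sigma> q"])
  qed
  show ?thesis
    by (rule ring_iso_common_kernel[OF W.ring_axioms R.ring_axioms M.ring_axioms \<pi>_hom _ hom surj])
      (use \<pi>_surj \<pi>_zero_iff that in auto)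
qed

end


section \<open>The field of fractions\<close>

lemma domain_iso:
  assumes "cring R" "domain M" "h \<in> ring_iso R M"
  shows "domain R"
proof -
  interpret R: cring R by fact
  interpret M: domain M by fact
  interpret h: ring_hom_ring R M h
    using assms(3) by (intro ring_hom_ringI2 R.ring_axioms M.ring_axioms) (simp add: ring_iso_def)
  have inj: "inj_on h (carrier R)" using assms(3) by (simp add: ring_iso_def bij_betw_def)
  have zero: "r = \<zero>\<^bsub>R\<^esub>" if "r \<in> carrier R" "h r = \<zero>\<^bsub>M\<^esub>" for r
    using inj_onD[OF inj, of r "\<zero>\<^bsub>R\<^esub>"] that by simp
  show ?thesis
  proof unfold_locales
    show "\<one>\<^bsub>R\<^esub> \<noteq> \<zero>\<^bsub>R\<^esub>"
      using h.hom_one h.hom_zero M.one_not_zero by metis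
    show "r = \<zero>\<^bsub>R\<^esub> \<or> s = \<zero>\<^bsub>R\<^esub>"
      if "r \<otimes>\<^bsub>R\<^esub> s = \<zero>\<^bsub>R\<^esub>" "r \<in> carrier R" "s \<in> carrier R" for r s
    proof -
      have "h r \<otimes>\<^bsub>M\<^esub> h s = \<zero>\<^bsub>M\<^esub>" using that by (simp flip: h.hom_mult)
      then show ?thesis using zero that M.integral[of "h r" "h s"] h.hom_closed by blast
    qed
  qed
qed

context ppv_setting
begin

text \<open>Elements of K killed by D_{K/k} are those of k, so a relation with constant coefficients
  is an operator over k applied to \<omega>, and minimality of \<open>D\<close> applies.\<close>

sublocale ext_prim: primitive_extension "rel_der P" "act K" "\<lambda>x i. w i x" V
proof (rule primitive_extension.intro)
  show "ring_derivation (act K x)" for x by (rule ext.act_derivation)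
  fix I c f i
  assume I: "finite I" "I \<subseteq> V" and c: "\<And>i x. i \<in> I \<Longrightarrow> x \<in> rel_der P \<Longrightarrow> act K x (c i) = 0"
    and rel: "\<And>x. x \<in> rel_der P \<Longrightarrow> (\<Sum>i\<in>I. c i * w i x) = act K x f" and i: "i \<in> I"
  show "c i = 0"
  proof (rule minimal_annihilator_independent[OF closed lift minimal I(1) _ _ _ i])
    show "D = 0 \<or> j < n" if "j \<in> I" for j using that I(2) by (auto simp: V_def)
    show "c j \<in> range (emb P)" if "j \<in> I" for j using c[OF that] unfolding rel_constants[symmetric] by blast
    show "(\<Sum>i\<in>I. c i * (rel_lie P u ^^ i) \<omega> [x]) = act K x f" if "x \<in> rel_der P" for x
      using rel[OF that] by (simp add: w_def)
  qed
qed

lemma der_eq_E: "x \<in> rel_der P \<Longrightarrow> ext_prim.der x = E x"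
  unfolding ext_prim.der_def E_def by (simp add: rel_part_id rel_der_iff)

text \<open>If q f / g = t and f / g is constant, then (x q) f / g = x t; \<open>key\<close> is this
  statement without division. So the denominators \<open>J\<close> are stable and contain 1, by
  differential simplicity.\<close>

lemma constant_fraction:
  assumes f: "f \<in> polys_in V" and g: "g \<in> polys_in V" "g \<noteq> 0"
    and const: "\<And>x. x \<in> rel_der P \<Longrightarrow> E x f * g = f * E x g"
  shows "\<exists>c. f = pconst (emb P c) * g"
proof -
  define J where "J = {q \<in> polys_in V. \<exists>t\<in>polys_in V. q * f = g * t}"
  have key: "E x q * f = g * E x t" if x: "x \<in> rel_der P" and eq: "q * f = g * t" for x q t
  proof -
    have "E x q * f + q * E x f = E x g * t + g * E x t"
      using arg_cong[OF eq, of "E x"] by (simp add: E_mult)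
    then have m: "(E x q * f + q * E x f) * g = (E x g * t + g * E x t) * g" by (rule arg_cong)
    have "q * E x f * g = q * f * E x g" by (simp only: mult.assoc const[OF x])
    also have "\<dots> = g * t * E x g" by (simp only: eq)
    finally have e: "q * E x f * g = g * t * E x g" .
    have "g * (E x q * f) = (E x q * f + q * E x f) * g - q * E x f * g" by (simp add: algebra_simps)
    also have "\<dots> = g * (g * E x t)" unfolding m e by (simp add: algebra_simps)
    finally have "g * (E x q * f) = g * (g * E x t)" .
    then show ?thesis using g(2) by simp
  qed
  have "1 \<in> J"
  proof (rule ext_prim.differentially_simple)
    show "J \<subseteq> polys_in V" by (auto simp: J_def)
    show "g \<in> J" using f g by (auto simp: J_def)
    show "g \<noteq> 0" by (rule g(2))
    show "pconst c * q \<in> J" if "q \<in> J" for c q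
    proof -
      from that obtain t where "q \<in> polys_in V" "t \<in> polys_in V" "q * f = g * t" by (auto simp: J_def)
      then show ?thesis
        by (auto simp: J_def mult.assoc mult.left_commute polys_in_mult intro!: bexI[of _ "pconst c * t"])
    qed
    show "ext_prim.der x q \<in> J" if "x \<in> rel_der P" "q \<in> J" for x q
      unfolding der_eq_E[OF that(1)] using that key by (auto simp: J_def intro: E_closed)
  qed
  then obtain t where t: "t \<in> polys_in V" "1 * f = g * t" by (auto simp: J_def)
  \<comment> \<open>This is \<open>key\<close> for q = 1, whose derivative is zero.\<close>
  have "ext_prim.der x t = 0" if "x \<in> rel_der P" for x
    using key[OF that t(2)] g(2) unfolding der_eq_E[OF that] by (simp add: ring_derivation.one[OF E_derivation])
  then obtain c where c: "t = pconst c" "\<forall>x\<in>rel_der P. act K x c = 0"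
    using ext_prim.constant_polynomial[OF t(1)] by blast
  then obtain b where "c = emb P b" using rel_constants by blast
  then show ?thesis using t c by (auto simp: mult.commute)
qed

text \<open>The isomorphism \<open>h\<close> intertwines the action on R with \<open>E\<close>.
  Constancy of r/s, written as x(r) s = r x(s), is thereby transported to the hypothesis of
  \<open>constant_fraction\<close>.\<close>

lemma ppv_ring_properties:
  "differential_algebra K R"
  "\<exists>(V :: nat set) h. h \<in> ring_iso R (mpoly_ring V) \<and> (\<forall>c. h (alg R c) = pconst c)"
  "domain R"
  "ppv_extension P \<omega> (frac_dalg R)"
proof -
  obtain h where h: "h \<in> ring_iso R (mpoly_ring V)" and h\<pi>: "\<And>p. h (\<pi> p) = \<phi> p"
    using ppv_ring_iso by blast
  have h_alg: "h (alg R c) = pconst c" for c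
    using h\<pi>[of "pconst c"] by (simp add: \<pi>_simps \<phi>_simps)
  show da: "differential_algebra K R" by (rule ppv_ring_differential_algebra)
  show "\<exists>(V :: nat set) h. h \<in> ring_iso R (mpoly_ring V) \<and> (\<forall>c. h (alg R c) = pconst c)"
    using h h_alg by blast
  show dom: "domain R" by (rule domain_iso[OF R.is_cring domain_mpoly_ring h])
  interpret F: fraction_algebra K R by (rule fraction_algebra.intro[OF da dom])
  let ?L = "frac_dalg R"
  interpret L: field ?L by (rule F.field_frac_dalg)
  interpret LD: differential_algebra K ?L by (rule F.differential_algebra_frac_dalg)
  have h_simps: "h (r \<otimes>\<^bsub>R\<^esub> s) = h r * h s" "h r \<in> polys_in V" if "r \<in> carrier R" "s \<in> carrier R" for r s
    using h that by (auto simp: ring_iso_def ring_hom_def)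
  have h_inj: "r = s" if "h r = h s" "r \<in> carrier R" "s \<in> carrier R" for r s
    using h that by (auto simp: ring_iso_def bij_betw_def inj_on_def)
  have h_zero: "h \<zero>\<^bsub>R\<^esub> = 0" using h_alg[of 0] by simp
  have h_dact: "h (dact R x r) = E x (h r)" if "r \<in> carrier R" for x r
  proof -
    have "r \<in> range \<pi>" using that by (simp only: \<pi>_surj)
    then obtain p where p: "r = \<pi> p" by (elim imageE)
    show ?thesis unfolding p \<pi>_simps(5)[symmetric] h\<pi> by (rule \<phi>_word_der)
  qed
  have constants: "{r \<in> carrier ?L. \<forall>x\<in>rel_der P. dact ?L x r = \<zero>\<^bsub>?L\<^esub>} = range (\<lambda>c. alg ?L (emb P c))"
  proof (intro equalityI subsetI)
    fix X assume "X \<in> {r \<in> carrier ?L. \<forall>x\<in>rel_der P. dact ?L x r = \<zero>\<^bsub>?L\<^esub>}"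
    then have X: "X \<in> carrier ?L" and const: "\<And>x. x \<in> rel_der P \<Longrightarrow> dact ?L x X = \<zero>\<^bsub>?L\<^esub>" by auto
    obtain r s where rs: "r \<in> carrier R" "s \<in> carrier R - {\<zero>\<^bsub>R\<^esub>}" "X = frac R r s"
      using X by (rule F.frac_cases)
    have "E x (h r) * h s = h r * E x (h s)" if x: "x \<in> rel_der P" for x
    proof -
      have "dact R x r \<otimes>\<^bsub>R\<^esub> s = r \<otimes>\<^bsub>R\<^esub> dact R x s"
        using const[OF x] unfolding rs(3) F.frac_constant_iff[OF rs(1,2)] .
      from arg_cong[OF this, of h] show ?thesis using rs(1,2) by (simp add: h_simps(1) h_dact)
    qed
    moreover have "h s \<noteq> 0" using rs(2) h_inj[of s "\<zero>\<^bsub>R\<^esub>"] by (auto simp: h_zero)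
    ultimately obtain c where c: "h r = pconst (emb P c) * h s"
      using constant_fraction[of "h r" "h s"] h_simps(2) rs(1,2) by blast
    have "r = alg R (emb P c) \<otimes>\<^bsub>R\<^esub> s"
      by (rule h_inj) (use rs(1,2) c in \<open>simp_all add: h_simps(1) h_alg\<close>)
    then have "X = alg ?L (emb P c)"
      using rs(1,2) by (simp add: rs(3) F.frac_eq_iff)
    then show "X \<in> range (\<lambda>c. alg ?L (emb P c))" by blast
  next
    fix X assume "X \<in> range (\<lambda>c. alg ?L (emb P c))"
    then obtain c where X: "X = alg ?L (emb P c)" by blast
    have "dact ?L x X = \<zero>\<^bsub>?L\<^esub>" if "x \<in> rel_der P" for x
      unfolding X LD.dact_alg act_emb[OF that] by simp
    then show "X \<in> {r \<in> carrier ?L. \<forall>x\<in>rel_der P. dact ?L x r = \<zero>\<^bsub>?L\<^esub>}"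
      using LD.alg_closed X by blast
  qed
  have z: "frac R y \<one>\<^bsub>R\<^esub> \<in> carrier ?L" by (intro F.frac_closed) simp_all
  have dz: "dact ?L x (frac R y \<one>\<^bsub>R\<^esub>) = alg ?L (\<omega> [x])" if "x \<in> rel_der P" for x
    using dact_rel[OF that, of 0] by (simp add: F.frac_dact_one w_def)
  have generated: "M = carrier ?L"
    if M: "subfield M ?L" and alg: "range (alg ?L) \<subseteq> M" and zM: "frac R y \<one>\<^bsub>R\<^esub> \<in> M"
      and stable: "\<forall>x. \<forall>r\<in>M. dact ?L x r \<in> M" for M
  proof -
    note subring = subringE[OF subfieldE(1)[OF M]]
    have one: "\<one>\<^bsub>R\<^esub> \<in> carrier R - {\<zero>\<^bsub>R\<^esub>}" by simp
    \<comment> \<open>All of R is reached from the constants and y by ring operations and operators,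
      as the variable of a word arises by applying its letters to y.\<close>
    have num: "frac R (\<pi> p) \<one>\<^bsub>R\<^esub> \<in> M" for p
    proof -
      have "p \<in> polys_in UNIV" by simp
      then show ?thesis
      proof (induction rule: polys_in_induct)
        case (pconst c)
        then show ?case using alg by (auto simp: \<pi>_simps)
      next
        case (pvar xs)
        show ?case
        proof (induction xs)
          case (Cons x xs)
          have "dact ?L x (frac R (\<pi> (pvar xs)) \<one>\<^bsub>R\<^esub>) = frac R (\<pi> (pvar (x # xs))) \<one>\<^bsub>R\<^esub>"
            by (simp only: F.frac_dact_one[OF \<pi>_closed] \<pi>_simps(5)[symmetric] ext.word_der_pvar)
          then show ?case using stable Cons by metis
        qed (rule zM)
      next
        case (add p q)
        then show ?case
          using subring(7)[OF add.IH] by (simp add: \<pi>_simps F.frac_add_same[OF \<pi>_closed \<pi>_closed one])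
      next
        case (mult p q)
        then show ?case
          using subring(6)[OF mult.IH] by (simp add: \<pi>_simps F.frac_mult[OF \<pi>_closed one \<pi>_closed one])
      qed
    qed
    show ?thesis
    proof
      show "M \<subseteq> carrier ?L" by (rule subring(1))
      show "carrier ?L \<subseteq> M"
      proof
        fix X assume "X \<in> carrier ?L"
        then obtain r s where rs: "r \<in> carrier R" "s \<in> carrier R - {\<zero>\<^bsub>R\<^esub>}" "X = frac R r s"
          by (rule F.frac_cases)
        have "r \<in> range \<pi>" "s \<in> range \<pi>" using rs(1,2) by (simp_all only: \<pi>_surj Diff_iff)
        then obtain p q where pq: "r = \<pi> p" "s = \<pi> q" by (elim imageE)
        let ?S = "frac R s \<one>\<^bsub>R\<^esub>"
        have S: "?S \<in> M - {\<zero>\<^bsub>?L\<^esub>}"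
          using num[of q] rs(2) F.frac_eq_zero_iff[OF _ one, of s] by (auto simp: pq(2))
        have Xc: "X \<in> carrier ?L" using rs by (auto intro: F.frac_closed)
        have "?S \<otimes>\<^bsub>?L\<^esub> X = frac R (r \<otimes>\<^bsub>R\<^esub> s) (\<one>\<^bsub>R\<^esub> \<otimes>\<^bsub>R\<^esub> s)"
          using rs by (simp add: F.frac_mult R.m_comm)
        also have "\<dots> = frac R r \<one>\<^bsub>R\<^esub>" using rs by (intro F.frac_cancel) auto
        finally have "?S \<otimes>\<^bsub>?L\<^esub> X \<in> M" using num[of p] by (simp add: pq(1))
        then show "X \<in> M" by (rule L.subfield_m_inv_simprule[OF M S Xc])
      qed
    qed
  qed
  show "ppv_extension P \<omega> ?L"
    unfolding ppv_extension_def
  proof (intro conjI L.field_axioms LD.differential_algebra_axioms constants bexI[OF _ z] ballI allI impI)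
    show "dact ?L x (frac R y \<one>\<^bsub>R\<^esub>) = alg ?L (\<omega> [x])" if "x \<in> rel_der P" for x
      by (rule dz[OF that])
  qed (elim conjE, rule generated)
qed

end

theorem proposition5p4:
  fixes P :: "('k::field_char_0, 'dk::ab_group_add, 'K::field_char_0, 'dK::ab_group_add) pdfield"
    and dt :: 'dk and \<omega> :: "'dK list \<Rightarrow> 'K" and D :: "'k poly" and u :: 'dK
  assumes "parameterized_differential_field P"
    and "dt \<noteq> 0" and "range (\<lambda>c. scl (base_fld P) c dt) = UNIV"
    and "\<omega> \<in> rel_forms P 1" and "rel_de_rham P \<omega> = (\<lambda>_. 0)"
    and "minimal_annihilator P dt \<omega> D"
    and "str P u = pure_tensor P 1 dt"
  shows "(\<exists>a. rel_lie_op P u D \<omega> = rel_de_rham P (form0 a)) \<and>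
    (\<forall>a. rel_lie_op P u D \<omega> = rel_de_rham P (form0 a) \<and> (D = 0 \<longrightarrow> a = 0) \<longrightarrow>
      differential_algebra (ext_fld P) (ppv_ring P \<omega> u D a) \<and>
      (\<exists>(V :: nat set) h. h \<in> ring_iso (ppv_ring P \<omega> u D a) (mpoly_ring V) \<and>
         (\<forall>c. h (alg (ppv_ring P \<omega> u D a) c) = pconst c)) \<and>
      domain (ppv_ring P \<omega> u D a) \<and>
      ppv_extension P \<omega> (frac_dalg (ppv_ring P \<omega> u D a)))"
proof -
  interpret ordinary_parameterized_field P dt
    using assms(1-3) by (intro ordinary_parameterized_field.intro ordinary_parameterized_field_axioms.intro)
  have closed: "\<omega> \<in> closed_forms1 P" using assms(4,5) by (simp add: closed_forms1_def)
  have lift: "\<tau> u = 1" using assms(7) by (simp add: lift_iff)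
  have "\<exists>a. rel_lie_op P u D \<omega> = exact a"
  proof (cases "D = 0")
    case True
    \<comment> \<open>The zero operator gives the zero form, which is d 0.\<close>
    then show ?thesis by (intro exI[of _ 0]) (simp add: rel_lie_op_def fun_eq_iff)
  next
    case False
    then have "annihilates P dt D \<omega>" using assms(6) by (auto simp: minimal_annihilator_def split: if_splits)
    then show ?thesis using annihilates_iff[OF closed lift] by blast
  qed
  moreover have "ppv_setting P dt \<omega> u D a" if "rel_lie_op P u D \<omega> = exact a" "D = 0 \<longrightarrow> a = 0" for a
    using that closed lift assms(6)
    by (intro ppv_setting.intro ppv_setting_axioms.intro ordinary_parameterized_field_axioms) auto
  ultimately show ?thesis
    by (intro conjI allI impI) (auto intro: ppv_setting.ppv_ring_properties)
qed

end
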